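(* Let $p\geq 2$ and $n\geq 3$, and let $(\pi,\sigma)\in\mathcal{P}_{p,n}$. Then $(\pi,\sigma)$ is a maximal element of the poset $\mathcal{P}_{p,n}$ if and only if $\sigma$ is not a partial reversal.
   Context: Let $G=\mathrm{GL}_p(\mathbb{C})$ act on $\mathcal{V}=\mathcal{M}_p^n$ ($n$-tuples of complex $p\times p$ matrices) by simultaneous conjugation. $\Pi(p,k)$ is the set of ordered partitions (compositions) $\pi=(p_1,\dots,p_k)$ of $p$ into $k$ positive parts. For $\sigma\in S_k$, $\sigma(\pi)=(p_{\sigma(1)},\dots,p_{\sigma(k)})$. For $\pi\in\Pi(p,k)$, $\mathcal{V}_\pi\subseteq\mathcal{V}$ is the subspace of tuples all of whose entries are block upper triangular with respect to the block sizes $\pi$. For $\sigma\in S_k$, $\mathcal{C}_{\pi,\sigma}\subseteq\mathcal{V}^2$ is the subspace of pairs $(\mathbf{A},\mathbf{A}')$ with $\mathbf{A}\in\mathcal{V}_\pi$, $\mathbf{A}'\in\mathcal{V}_{\sigma(\pi)}$ and $\mathbf{B}'_{i,i}=\mathbf{B}_{\sigma(i),\sigma(i)}$ for $i=1,\dots,k$, where $\mathbf{B}_{i,i}$ (resp. $\mathbf{B}'_{i,i}$) is the tuple of $i$-th diagonal $\pi$-blocks of $\mathbf{A}$ (resp. $i$-th diagonal $\sigma(\pi)$-blocks of $\mathbf{A}'$). $G^2$ acts componentwise on $\mathcal{V}^2$ and closures are Zariski closures. $\mathcal{P}_{p,n}=\bigsqcup_{k=1}^p(\Pi(p,k)\times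 S_k)$, ordered by $(\pi,\sigma)\preceq(\hat\pi,\hat\sigma)$ iff $\overline{G^2\cdot\mathcal{C}_{\pi,\sigma}}\subseteq\overline{G^2\cdot\mathcal{C}_{\hat\pi,\hat\sigma}}$. A permutation $\sigma\in S_k$ is a partial reversal if $\sigma(l)=\sigma(l+1)+1$ for some $1\leq l<k$. *)

theory Defs
  imports
    "Jordan_Normal_Form.Gauss_Jordan_Elimination"
    "HOL-Combinatorics.List_Permutation"
    "HOL.Hull"
begin

section \<open>Tuples of matrices and simultaneous conjugation\<close>

type_synonym cmat = "complex mat"

definition mat_tuples :: "nat \<Rightarrow> nat \<Rightarrow> cmat list set" where
  "mat_tuples p n = {A. length A = n \<and> set A \<subseteq> carrier_mat p p}"

definition GL :: "nat \<Rightarrow> cmat set" where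
  "GL p = {g \<in> carrier_mat p p. invertible_mat g}"

definition conj_tuple :: "cmat \<Rightarrow> cmat list \<Rightarrow> cmat list" where
  "conj_tuple g A = map (\<lambda>X. g * X * the (mat_inverse g)) A"

definition G2_orbit :: "nat \<Rightarrow> (cmat list \<times> cmat list) set \<Rightarrow> (cmat list \<times> cmat list) set" where
  "G2_orbit p S = {(conj_tuple g A, conj_tuple h A') | g h A A'. g \<in> GL p \<and> h \<in> GL p \<and> (A, A') \<in> S}"


section \<open>Zariski closure in the space of pairs of tuples\<close>

text \<open>Polynomial functions on pairs of \<open>n\<close>-tuples of \<open>p \<times> p\<close> matrices, i.e. the functions
  generated from the constants and the \<open>2 n p\<^sup>2\<close> coordinate functions by sums and products.\<close>

inductive_set poly_functions :: "nat \<Rightarrow> nat \<Rightarrow> (cmat list \<times> cmat list \<Rightarrow> complex) set"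
  for p n :: nat
where
  const: "(\<lambda>_. c) \<in> poly_functions p n"
| coord_fst: "i < n \<Longrightarrow> r < p \<Longrightarrow> s < p \<Longrightarrow> (\<lambda>x. (fst x ! i) $$ (r, s)) \<in> poly_functions p n"
| coord_snd: "i < n \<Longrightarrow> r < p \<Longrightarrow> s < p \<Longrightarrow> (\<lambda>x. (snd x ! i) $$ (r, s)) \<in> poly_functions p n"
| add: "f \<in> poly_functions p n \<Longrightarrow> g \<in> poly_functions p n \<Longrightarrow> (\<lambda>x. f x + g x) \<in> poly_functions p n"
| mult: "f \<in> poly_functions p n \<Longrightarrow> g \<in> poly_functions p n \<Longrightarrow> (\<lambda>x. f x * g x) \<in> poly_functions p n"

definition zariski_closed :: "nat \<Rightarrow> nat \<Rightarrow> (cmat list \<times> cmat list) set \<Rightarrow> bool" where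
  "zariski_closed p n Z \<longleftrightarrow>
    (\<exists>F \<subseteq> poly_functions p n. Z = {x \<in> mat_tuples p n \<times> mat_tuples p n. \<forall>f \<in> F. f x = 0})"

definition zariski_closure ::
  "nat \<Rightarrow> nat \<Rightarrow> (cmat list \<times> cmat list) set \<Rightarrow> (cmat list \<times> cmat list) set" where
  "zariski_closure p n S = zariski_closed p n hull S"


section \<open>Compositions and block upper triangular tuples\<close>

text \<open>A composition \<open>(p\<^sub>1, \<dots>, p\<^sub>k)\<close> is a list, so all indices are shifted to start at \<open>0\<close>;
  accordingly the symmetric group \<open>S\<^sub>k\<close> is the set of permutations of \<open>{..<k}\<close>.\<close>

definition compositions :: "nat \<Rightarrow> nat \<Rightarrow> nat list set" where
  "compositions p k = {\<pi>. length \<pi> = k \<and> (\<forall>q \<in> set \<pi>. 0 < q) \<and> sum_list \<pi> = p}"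

definition block_start :: "nat list \<Rightarrow> nat \<Rightarrow> nat" where
  "block_start \<pi> i = sum_list (take i \<pi>)"

definition mat_block :: "nat list \<Rightarrow> nat \<Rightarrow> nat \<Rightarrow> cmat \<Rightarrow> cmat" where
  "mat_block \<pi> i j X =
    mat (\<pi> ! i) (\<pi> ! j) (\<lambda>(r, s). X $$ (block_start \<pi> i + r, block_start \<pi> j + s))"

definition block_upper_triangular :: "nat list \<Rightarrow> cmat \<Rightarrow> bool" where
  "block_upper_triangular \<pi> X \<longleftrightarrow>
    (\<forall>i < length \<pi>. \<forall>j < i. mat_block \<pi> i j X = 0\<^sub>m (\<pi> ! i) (\<pi> ! j))"

definition V_block :: "nat \<Rightarrow> nat \<Rightarrow> nat list \<Rightarrow> cmat list set" where
  "V_block p n \<pi> = {A \<in> mat_tuples p n. \<forall>X \<in> set A. block_upper_triangular \<pi> X}"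

definition diag_blocks :: "nat list \<Rightarrow> nat \<Rightarrow> cmat list \<Rightarrow> cmat list" where
  "diag_blocks \<pi> i A = map (mat_block \<pi> i i) A"

text \<open>Note that \<^term>\<open>permute_list \<sigma> \<pi>\<close> has \<open>i\<close>-th entry \<^term>\<open>\<pi> ! \<sigma> i\<close>, so it is \<open>\<sigma>(\<pi>)\<close>.\<close>

definition C_pairs ::
  "nat \<Rightarrow> nat \<Rightarrow> nat list \<Rightarrow> (nat \<Rightarrow> nat) \<Rightarrow> (cmat list \<times> cmat list) set" where
  "C_pairs p n \<pi> \<sigma> = {(A, A'). A \<in> V_block p n \<pi> \<and> A' \<in> V_block p n (permute_list \<sigma> \<pi>) \<and>
    (\<forall>i < length \<pi>. diag_blocks (permute_list \<sigma> \<pi>) i A' = diag_blocks \<pi> (\<sigma> i) A)}"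


section \<open>The poset\<close>

text \<open>The union over \<open>k\<close> is disjoint since \<open>k\<close> is the length of the composition. Only the order,
  not the underlying set, depends on \<open>n\<close>.\<close>

definition P_set :: "nat \<Rightarrow> (nat list \<times> (nat \<Rightarrow> nat)) set" where
  "P_set p = (\<Union>k \<in> {1..p}. compositions p k \<times> {\<sigma>. \<sigma> permutes {..<k}})"

definition P_le ::
  "nat \<Rightarrow> nat \<Rightarrow> nat list \<times> (nat \<Rightarrow> nat) \<Rightarrow> nat list \<times> (nat \<Rightarrow> nat) \<Rightarrow> bool" where
  "P_le p n x y \<longleftrightarrow>
    zariski_closure p n (G2_orbit p (C_pairs p n (fst x) (snd x))) \<subseteq>
    zariski_closure p n (G2_orbit p (C_pairs p n (fst y) (snd y)))"

definition P_maximal :: "nat \<Rightarrow> nat \<Rightarrow> nat list \<times> (nat \<Rightarrow> nat) \<Rightarrow> bool" where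
  "P_maximal p n x \<longleftrightarrow> x \<in> P_set p \<and> (\<forall>y \<in> P_set p. P_le p n x y \<longrightarrow> x = y)"

definition partial_reversal :: "nat \<Rightarrow> (nat \<Rightarrow> nat) \<Rightarrow> bool" where
  "partial_reversal k \<sigma> \<longleftrightarrow> (\<exists>l. l + 1 < k \<and> \<sigma> l = \<sigma> (l + 1) + 1)"

end

theory Submission
  imports Defs "Jordan_Normal_Form.Schur_Decomposition"
begin

text \<open>If \<open>\<sigma> l = \<sigma> (l + 1) + 1\<close>, then merging the two blocks concerned gives a larger element: a pair of
  diagonal blocks \<open>[B, X; 0, C]\<close> and \<open>[C, Y; 0, B]\<close> is the limit for \<open>t \<rightarrow> 0\<close> of the conjugate
  matrices \<open>[B, X; t Y, C]\<close> and \<open>[C, Y; t X, B]\<close>.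

  Conversely, let the first matrix of a tuple have distinct eigenvalues \<open>l\<^sub>i\<close>, with spectral projections
  \<open>E\<^sub>i\<close> and \<open>E'\<^sub>i\<close> on the two sides. On \<open>G\<^sup>2 \<cdot> C\<^bsub>\<pi>,\<sigma>\<^esub>\<close> each \<open>i\<close> belongs to one block \<open>\<beta> i\<close>, the corners
  \<open>E\<^sub>i A E\<^sub>j\<close> and \<open>E'\<^sub>i A' E'\<^sub>j\<close> vanish for \<open>\<beta> i > \<beta> j\<close> and \<open>\<sigma>\<inverse> (\<beta> i) > \<sigma>\<inverse> (\<beta> j)\<close> respectively, and for
  \<open>\<beta> i = \<beta> j\<close> the ratio of \<open>E\<^sub>i A\<^sub>1 E\<^sub>j\<close> to \<open>E\<^sub>i A\<^sub>2 E\<^sub>j\<close> equals that of \<open>E'\<^sub>i A'\<^sub>1 E'\<^sub>j\<close> to \<open>E'\<^sub>i A'\<^sub>2 E'\<^sub>j\<close>.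
  These are polynomial relations between the entries and the \<open>l\<^sub>i\<close>, so they persist in the closure.
  Evaluated at one pair of three sparse matrices, they force every merging of blocks to reverse the
  order of the blocks merged, so without partial reversals nothing is merged.\<close>

text \<open>Two obstacles shape the converse. Eigenvalues are not polynomials in the entries, so
  they enter as free variables \<open>l\<close>, which are later eliminated one at a time by
  substituting the first matrix itself for a variable. And \<beta> varies from point to point, so no
  single system of relations holds on the whole orbit, only a disjunction over the finitely many
  possible \<beta>. A disjunction of closed conditions is closed: it becomes the vanishing of a
  product, in which extra factors \<open>l i - l j\<close> absorb the points where eigenvalues
  coincide. The bound n >= 3 counts one matrix that supplies the eigenvalues and two whose corners
  are compared. The two sides are conjugated independently, so the corners of one matrix on the two
  sides can be compared only up to scale, while the ratio between two matrices is intrinsic. In the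
  other direction the limit must be taken along a curve that is polynomial at t = 0, although the
  conjugation that brings its points into the larger set is singular there; hence the curve is
  written without that conjugation, which enters only for t different from 0.\<close>

lemma mat_mult_entry:
  assumes "X \<in> carrier_mat p p" "Z \<in> carrier_mat p p" "r < p" "s < p"
  shows "(X * Z) $$ (r, s) = (\<Sum>u<p. X $$ (r, u) * Z $$ (u, s))"
  using assms by (auto simp: scalar_prod_def lessThan_atLeast0 intro!: sum.cong)

section \<open>Invertible matrices, conjugation of tuples, Zariski closure\<close>

lemma GL_iff:
  "g \<in> GL p \<longleftrightarrow> g \<in> carrier_mat p p \<and> (\<exists>h \<in> carrier_mat p p. g * h = 1\<^sub>m p \<and> h * g = 1\<^sub>m p)"
proof
  assume g: "g \<in> GL p"
  then have gc: "g \<in> carrier_mat p p" by (simp add: GL_def)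
  from g obtain h where h: "g * h = 1\<^sub>m (dim_row g)" "h * g = 1\<^sub>m (dim_row h)"
    by (auto simp: GL_def invertible_mat_def inverts_mat_def)
  have "dim_row h = dim_col h" "dim_col h = p"
    using arg_cong[OF h(1), of dim_col] arg_cong[OF h(2), of dim_col] gc by auto
  then show "g \<in> carrier_mat p p \<and> (\<exists>h \<in> carrier_mat p p. g * h = 1\<^sub>m p \<and> h * g = 1\<^sub>m p)"
    using gc h by (auto intro!: bexI[of _ h])
next
  assume "g \<in> carrier_mat p p \<and> (\<exists>h \<in> carrier_mat p p. g * h = 1\<^sub>m p \<and> h * g = 1\<^sub>m p)"
  then show "g \<in> GL p"
    by (auto simp: GL_def invertible_mat_def inverts_mat_def)
qed

lemma GL_inverse:
  assumes "g \<in> GL p"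
  shows "the (mat_inverse g) \<in> carrier_mat p p"
    "g * the (mat_inverse g) = 1\<^sub>m p" "the (mat_inverse g) * g = 1\<^sub>m p"
proof -
  obtain h where h: "g \<in> carrier_mat p p" "h \<in> carrier_mat p p" "g * h = 1\<^sub>m p" "h * g = 1\<^sub>m p"
    using assms by (auto simp: GL_iff)
  then have "g \<in> Units (ring_mat TYPE(complex) p ())"
    by (auto simp: Units_def ring_mat_def)
  then obtain B where B: "mat_inverse g = Some B"
    using mat_inverse(1)[OF h(1), where b = "()"] by (cases "mat_inverse g") auto
  from mat_inverse(2)[OF h(1) B] show "the (mat_inverse g) \<in> carrier_mat p p"
    "g * the (mat_inverse g) = 1\<^sub>m p" "the (mat_inverse g) * g = 1\<^sub>m p" by (auto simp: B)
qed

lemma GL_mult: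
  assumes "g \<in> GL p" "h \<in> GL p"
  shows "g * h \<in> GL p"
proof -
  obtain g' where g: "g \<in> carrier_mat p p" "g' \<in> carrier_mat p p" "g * g' = 1\<^sub>m p" "g' * g = 1\<^sub>m p"
    using assms(1) by (auto simp: GL_iff)
  obtain h' where h: "h \<in> carrier_mat p p" "h' \<in> carrier_mat p p" "h * h' = 1\<^sub>m p" "h' * h = 1\<^sub>m p"
    using assms(2) by (auto simp: GL_iff)
  have "(g * h) * (h' * g') = g * (h * h') * g'" "(h' * g') * (g * h) = h' * (g' * g) * h"
    using g(1,2) h(1,2) by (simp_all add: assoc_mult_mat[where n\<^sub>1=p and n\<^sub>2=p and n\<^sub>3=p and n\<^sub>4=p])
  then have "(g * h) * (h' * g') = 1\<^sub>m p" "(h' * g') * (g * h) = 1\<^sub>m p"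
    using g h by simp_all
  then show ?thesis using g(1,2) h(1,2) unfolding GL_iff
    by (meson mult_carrier_mat)
qed

lemma mat_inverse_unique:
  fixes g h :: cmat
  assumes "g \<in> carrier_mat p p" "h \<in> carrier_mat p p" "g * h = 1\<^sub>m p" "h * g = 1\<^sub>m p"
  shows "the (mat_inverse g) = h"
proof -
  have "g \<in> GL p" using assms by (auto simp: GL_iff)
  note i = GL_inverse[OF this]
  have "the (mat_inverse g) = the (mat_inverse g) * (g * h)" using assms i by simp
  also have "\<dots> = (the (mat_inverse g) * g) * h" by (rule assoc_mult_mat[OF i(1) assms(1,2), symmetric])
  also have "\<dots> = h" using i assms by simp
  finally show ?thesis .
qed

lemma conj_tuple_mult:
  assumes g: "g \<in> GL p" and h: "h \<in> GL p" and A: "set A \<subseteq> carrier_mat p p"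
  shows "conj_tuple g (conj_tuple h A) = conj_tuple (g * h) A"
proof -
  note gi = GL_inverse[OF g] and hi = GL_inverse[OF h]
  have gc: "g \<in> carrier_mat p p" "h \<in> carrier_mat p p" using g h by (auto simp: GL_iff)
  let ?g = "the (mat_inverse g)" and ?h = "the (mat_inverse h)"
  note ass = assoc_mult_mat[where n\<^sub>1=p and n\<^sub>2=p and n\<^sub>3=p and n\<^sub>4=p]
  have "(g * h) * (?h * ?g) = g * (h * ?h) * ?g" "(?h * ?g) * (g * h) = ?h * (?g * g) * h"
    using gc gi(1) hi(1) by (simp_all add: ass)
  then have "the (mat_inverse (g * h)) = ?h * ?g"
    using gc gi hi by (intro mat_inverse_unique) auto
  then show ?thesis using A gc gi(1) hi(1)
    by (auto simp: conj_tuple_def ass subset_iff)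
qed

lemma conj_tuple_mat_tuples:
  assumes "g \<in> GL p" "A \<in> mat_tuples p n"
  shows "conj_tuple g A \<in> mat_tuples p n"
  using assms GL_inverse[OF assms(1)] unfolding mat_tuples_def conj_tuple_def
  by (auto simp: GL_iff intro!: mult_carrier_mat)

text \<open>Each polynomial vanishing on \<open>S\<close> cuts out a closed set containing
  \<open>S\<close>, and the whole space is closed as the zero set of no polynomials. The inclusion
  of \<open>S\<close> in the space matters: otherwise no closed set contains \<open>S\<close> and
  the hull is \<open>UNIV\<close>.\<close>

lemma zariski_closure_iff:
  assumes "S \<subseteq> mat_tuples p n \<times> mat_tuples p n"
  shows "x \<in> zariski_closure p n S \<longleftrightarrow> x \<in> mat_tuples p n \<times> mat_tuples p n \<and>
    (\<forall>f \<in> poly_functions p n. (\<forall>s \<in> S. f s = 0) \<longrightarrow> f x = 0)" (is "_ \<longleftrightarrow> ?R")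
proof
  assume x: "x \<in> zariski_closure p n S"
  show ?R
  proof
    have "zariski_closed p n (mat_tuples p n \<times> mat_tuples p n)"
      unfolding zariski_closed_def by (rule exI[of _ "{}"]) auto
    with x assms show "x \<in> mat_tuples p n \<times> mat_tuples p n"
      unfolding zariski_closure_def hull_def by blast
    show "\<forall>f \<in> poly_functions p n. (\<forall>s \<in> S. f s = 0) \<longrightarrow> f x = 0"
    proof (intro ballI impI)
      fix f assume f: "f \<in> poly_functions p n" "\<forall>s \<in> S. f s = 0"
      let ?Z = "{x \<in> mat_tuples p n \<times> mat_tuples p n. \<forall>g\<in>{f}. g x = 0}"
      have "zariski_closed p n ?Z" unfolding zariski_closed_def using f(1)
        by (intro exI[of _ "{f}"]) auto
      moreover have "S \<subseteq> ?Z" using assms f(2) by auto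
      ultimately have "x \<in> ?Z" using x unfolding zariski_closure_def hull_def by blast
      then show "f x = 0" by simp
    qed
  qed
next
  assume ?R
  then show "x \<in> zariski_closure p n S"
    unfolding zariski_closure_def hull_def zariski_closed_def by blast
qed

text \<open>A fact about hulls in general: a closed set containing \<open>T\<close> contains the
  hull of \<open>T\<close>, hence \<open>S\<close>, hence the hull of \<open>S\<close>. It reduces
  the order of the poset to orbits lying in closures.\<close>

lemma zariski_closure_le_iff:
  "zariski_closure p n S \<subseteq> zariski_closure p n T \<longleftrightarrow> S \<subseteq> zariski_closure p n T"
  unfolding zariski_closure_def hull_def by blast

section \<open>Blocks of indices\<close>

text \<open>The block that contains row \<open>r\<close>. For \<open>r\<close> beyond the sum of the
  parts no index qualifies and the value is unspecified, so every use carries a bound on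
  \<open>r\<close>.\<close>

definition blk :: "nat list \<Rightarrow> nat \<Rightarrow> nat" where
  "blk \<pi> r = (LEAST i. r < block_start \<pi> (Suc i))"

lemma block_start_Suc: "i < length \<pi> \<Longrightarrow> block_start \<pi> (Suc i) = block_start \<pi> i + \<pi> ! i"
  by (simp add: block_start_def take_Suc_conv_app_nth)

lemma block_start_mono: "i \<le> j \<Longrightarrow> block_start \<pi> i \<le> block_start \<pi> j"
proof -
  assume "i \<le> j"
  then have "take j \<pi> = take i \<pi> @ take (j - i) (drop i \<pi>)"
    by (metis le_add_diff_inverse take_add)
  then show ?thesis by (simp add: block_start_def)
qed

lemma block_start_length: "block_start \<pi> (length \<pi>) = sum_list \<pi>"
  by (simp add: block_start_def)

lemma blk:
  assumes "r < sum_list \<pi>"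
  shows "blk \<pi> r < length \<pi>" "block_start \<pi> (blk \<pi> r) \<le> r"
    "r < block_start \<pi> (blk \<pi> r) + \<pi> ! blk \<pi> r"
proof -
  from assms have ne: "length \<pi> > 0" by (cases \<pi>) auto
  then have ex: "r < block_start \<pi> (Suc (length \<pi> - 1))" using assms by (simp add: block_start_length)
  have le: "blk \<pi> r \<le> length \<pi> - 1" unfolding blk_def by (rule Least_le) (rule ex)
  then show l: "blk \<pi> r < length \<pi>" using ne by linarith
  have "r < block_start \<pi> (Suc (blk \<pi> r))" unfolding blk_def by (rule LeastI) (rule ex)
  then show "r < block_start \<pi> (blk \<pi> r) + \<pi> ! blk \<pi> r" using l by (simp add: block_start_Suc)
  show "block_start \<pi> (blk \<pi> r) \<le> r"
  proof (cases "blk \<pi> r")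
    case 0 then show ?thesis by (simp add: block_start_def)
  next
    case (Suc i)
    then have "\<not> r < block_start \<pi> (Suc i)"
      unfolding blk_def by (metis not_less_Least lessI)
    then show ?thesis by (simp add: Suc)
  qed
qed

lemma blk_eqI:
  assumes "i < length \<pi>" "block_start \<pi> i \<le> r" "r < block_start \<pi> i + \<pi> ! i"
  shows "blk \<pi> r = i"
  unfolding blk_def
proof (rule Least_equality)
  show "r < block_start \<pi> (Suc i)" using assms by (simp add: block_start_Suc)
  fix j assume "r < block_start \<pi> (Suc j)"
  then show "i \<le> j" using assms(2) block_start_mono[of "Suc j" i \<pi>] by (meson leD le_less_trans not_less_eq_eq)
qed

lemma block_start_add_less:
  assumes "i < length \<pi>" "o' < \<pi> ! i"
  shows "block_start \<pi> i + o' < sum_list \<pi>"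
  using block_start_mono[of "Suc i" "length \<pi>" \<pi>] assms
  by (simp add: block_start_Suc block_start_length)

lemma blk_block_start: "i < length \<pi> \<Longrightarrow> o' < \<pi> ! i \<Longrightarrow> blk \<pi> (block_start \<pi> i + o') = i"
  by (rule blk_eqI) auto

lemma card_blk:
  assumes "t < length \<pi>"
  shows "card {r. r < sum_list \<pi> \<and> blk \<pi> r = t} = \<pi> ! t"
proof -
  have "{r. r < sum_list \<pi> \<and> blk \<pi> r = t} = {block_start \<pi> t..<block_start \<pi> t + \<pi> ! t}"
  proof (intro Set.set_eqI iffI)
    fix r assume "r \<in> {r. r < sum_list \<pi> \<and> blk \<pi> r = t}"
    then show "r \<in> {block_start \<pi> t..<block_start \<pi> t + \<pi> ! t}" using blk[of r \<pi>] by auto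
  next
    fix r assume r: "r \<in> {block_start \<pi> t..<block_start \<pi> t + \<pi> ! t}"
    then show "r \<in> {r. r < sum_list \<pi> \<and> blk \<pi> r = t}"
      using blk_eqI[OF assms, of r] block_start_add_less[OF assms, of "r - block_start \<pi> t"] by auto
  qed
  then show ?thesis by simp
qed

lemma block_upper_triangular_iff:
  "block_upper_triangular \<pi> X \<longleftrightarrow>
    (\<forall>r < sum_list \<pi>. \<forall>s < sum_list \<pi>. blk \<pi> s < blk \<pi> r \<longrightarrow> X $$ (r, s) = 0)"
proof (intro iffI allI impI)
  fix r s assume but: "block_upper_triangular \<pi> X" and rs: "r < sum_list \<pi>" "s < sum_list \<pi>" "blk \<pi> s < blk \<pi> r"
  let ?i = "blk \<pi> r" and ?j = "blk \<pi> s"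
  have "mat_block \<pi> ?i ?j X = 0\<^sub>m (\<pi> ! ?i) (\<pi> ! ?j)"
    using but blk[OF rs(1)] rs(3) by (auto simp: block_upper_triangular_def)
  then have "mat_block \<pi> ?i ?j X $$ (r - block_start \<pi> ?i, s - block_start \<pi> ?j) = 0"
    using blk[OF rs(1)] blk[OF rs(2)] by auto
  then show "X $$ (r, s) = 0" using blk[OF rs(1)] blk[OF rs(2)] by (auto simp: mat_block_def less_diff_conv2)
next
  assume R: "\<forall>r < sum_list \<pi>. \<forall>s < sum_list \<pi>. blk \<pi> s < blk \<pi> r \<longrightarrow> X $$ (r, s) = 0"
  show "block_upper_triangular \<pi> X"
    unfolding block_upper_triangular_def
  proof (intro allI impI)
    fix i j assume "i < length \<pi>" "j < i"
    then show "mat_block \<pi> i j X = 0\<^sub>m (\<pi> ! i) (\<pi> ! j)"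
      by (intro eq_matI) (auto simp: mat_block_def blk_block_start block_start_add_less intro!: R[rule_format])
  qed
qed

section \<open>Matched pairs: the incidence condition entry by entry\<close>

definition block_pos :: "nat list \<Rightarrow> (nat \<Rightarrow> nat) \<Rightarrow> nat \<Rightarrow> nat" where
  "block_pos \<pi> \<sigma> r = (let i = blk (permute_list \<sigma> \<pi>) r in
     block_start \<pi> (\<sigma> i) + (r - block_start (permute_list \<sigma> \<pi>) i))"

text \<open>Since \<open>block_pos\<close> sends a row of a \<sigma>(\<pi>)-matrix to the row with
  the same offset in the matched \<pi>-block, equality of diagonal blocks becomes a condition on
  single entries. It concerns one matrix of each tuple at a time, and in this form the pairs can be
  added, multiplied and raised to powers.\<close>

definition matched :: "nat list \<Rightarrow> (nat \<Rightarrow> nat) \<Rightarrow> cmat \<Rightarrow> cmat \<Rightarrow> bool" where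
  "matched \<pi> \<sigma> X X' \<longleftrightarrow> (let p = sum_list \<pi>; \<pi>' = permute_list \<sigma> \<pi> in
     X \<in> carrier_mat p p \<and> X' \<in> carrier_mat p p \<and>
     (\<forall>r < p. \<forall>s < p. blk \<pi> s < blk \<pi> r \<longrightarrow> X $$ (r, s) = 0) \<and>
     (\<forall>r < p. \<forall>s < p. blk \<pi>' s < blk \<pi>' r \<longrightarrow> X' $$ (r, s) = 0) \<and>
     (\<forall>r < p. \<forall>s < p. blk \<pi>' r = blk \<pi>' s \<longrightarrow>
        X' $$ (r, s) = X $$ (block_pos \<pi> \<sigma> r, block_pos \<pi> \<sigma> s)))"

lemma permutes_lessThan:
  "\<sigma> permutes {..<k} \<Longrightarrow> i < k \<Longrightarrow> \<sigma> i < k"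
  using permutes_in_image by fastforce

lemma sum_list_permute:
  assumes "\<sigma> permutes {..<length \<pi>}"
  shows "sum_list (permute_list \<sigma> \<pi>) = sum_list (\<pi> :: nat list)"
  using mset_permute_list[OF assms] by (metis sum_mset_sum_list)

context
  fixes \<pi> :: "nat list" and \<sigma> :: "nat \<Rightarrow> nat"
  assumes \<sigma>: "\<sigma> permutes {..<length \<pi>}"
begin

lemma blk_permute:
  assumes "r < sum_list \<pi>"
  shows "blk (permute_list \<sigma> \<pi>) r < length \<pi>"
    "block_start (permute_list \<sigma> \<pi>) (blk (permute_list \<sigma> \<pi>) r) \<le> r"
    "r < block_start (permute_list \<sigma> \<pi>) (blk (permute_list \<sigma> \<pi>) r) + \<pi> ! \<sigma> (blk (permute_list \<sigma> \<pi>) r)"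
  using blk[of r "permute_list \<sigma> \<pi>"] assms sum_list_permute[OF \<sigma>] permute_list_nth[OF \<sigma>]
  by auto

lemma block_pos:
  assumes "r < sum_list \<pi>"
  shows "block_pos \<pi> \<sigma> r < sum_list \<pi>" "blk \<pi> (block_pos \<pi> \<sigma> r) = \<sigma> (blk (permute_list \<sigma> \<pi>) r)"
proof -
  let ?i = "blk (permute_list \<sigma> \<pi>) r" let ?o = "r - block_start (permute_list \<sigma> \<pi>) ?i"
  note b = blk_permute[OF assms]
  have i: "\<sigma> ?i < length \<pi>" using permutes_lessThan[OF \<sigma> b(1)] .
  have off: "?o < \<pi> ! \<sigma> ?i" using b by simp
  show "block_pos \<pi> \<sigma> r < sum_list \<pi>" "blk \<pi> (block_pos \<pi> \<sigma> r) = \<sigma> (blk (permute_list \<sigma> \<pi>) r)"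
    using block_start_add_less[OF i off] blk_block_start[OF i off] by (simp_all add: block_pos_def Let_def)
qed

lemma block_pos_inj: "inj_on (block_pos \<pi> \<sigma>) {..<sum_list \<pi>}"
proof (rule inj_onI)
  fix r s assume rs: "r \<in> {..<sum_list \<pi>}" "s \<in> {..<sum_list \<pi>}" "block_pos \<pi> \<sigma> r = block_pos \<pi> \<sigma> s"
  then have "\<sigma> (blk (permute_list \<sigma> \<pi>) r) = \<sigma> (blk (permute_list \<sigma> \<pi>) s)"
    using block_pos(2)[of r] block_pos(2)[of s] by simp
  then have e: "blk (permute_list \<sigma> \<pi>) r = blk (permute_list \<sigma> \<pi>) s"
    using permutes_inj[OF \<sigma>] by (simp add: inj_def)
  show "r = s" using rs(3) e blk_permute(2)[of r] blk_permute(2)[of s] rs(1,2)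
    by (simp add: block_pos_def Let_def)
qed

lemma block_pos_bij: "bij_betw (block_pos \<pi> \<sigma>) {..<sum_list \<pi>} {..<sum_list \<pi>}"
proof -
  have "block_pos \<pi> \<sigma> ` {..<sum_list \<pi>} = {..<sum_list \<pi>}"
    using block_pos_inj block_pos(1) by (intro endo_inj_surj) auto
  then show ?thesis using block_pos_inj by (simp add: bij_betw_def)
qed

lemma diag_blocks_eq_iff:
  assumes "A \<in> mat_tuples (sum_list \<pi>) n" "A' \<in> mat_tuples (sum_list \<pi>) n"
  shows "(\<forall>i < length \<pi>. diag_blocks (permute_list \<sigma> \<pi>) i A' = diag_blocks \<pi> (\<sigma> i) A) \<longleftrightarrow>
   (\<forall>m < n. \<forall>r < sum_list \<pi>. \<forall>s < sum_list \<pi>. blk (permute_list \<sigma> \<pi>) r = blk (permute_list \<sigma> \<pi>) s \<longrightarrow>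
      (A' ! m) $$ (r, s) = (A ! m) $$ (block_pos \<pi> \<sigma> r, block_pos \<pi> \<sigma> s))" (is "?L \<longleftrightarrow> ?R")
proof
  assume L: ?L
  show ?R
  proof (intro allI impI)
    fix m r s assume m: "m < n" and r: "r < sum_list \<pi>" and s: "s < sum_list \<pi>"
      and e: "blk (permute_list \<sigma> \<pi>) r = blk (permute_list \<sigma> \<pi>) s"
    let ?i = "blk (permute_list \<sigma> \<pi>) r"
    let ?b = "block_start (permute_list \<sigma> \<pi>) ?i"
    note br = blk_permute[OF r] and bs = blk_permute[OF s, folded e]
    have "diag_blocks (permute_list \<sigma> \<pi>) ?i A' ! m = diag_blocks \<pi> (\<sigma> ?i) A ! m"
      using L br by simp
    then have "mat_block (permute_list \<sigma> \<pi>) ?i ?i (A' ! m) $$ (r - ?b, s - ?b) =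
       mat_block \<pi> (\<sigma> ?i) (\<sigma> ?i) (A ! m) $$ (r - ?b, s - ?b)"
      using assms m by (simp add: diag_blocks_def mat_tuples_def)
    then show "(A' ! m) $$ (r, s) = (A ! m) $$ (block_pos \<pi> \<sigma> r, block_pos \<pi> \<sigma> s)"
      using br bs by (auto simp: mat_block_def block_pos_def Let_def permute_list_nth[OF \<sigma>] e less_diff_conv2)
  qed
next
  assume R: ?R
  show ?L
  proof (intro allI impI)
    fix i assume i: "i < length \<pi>"
    note nth = permute_list_nth[OF \<sigma>]
    show "diag_blocks (permute_list \<sigma> \<pi>) i A' = diag_blocks \<pi> (\<sigma> i) A"
    proof (rule nth_equalityI)
      show "length (diag_blocks (permute_list \<sigma> \<pi>) i A') = length (diag_blocks \<pi> (\<sigma> i) A)"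
        using assms by (simp add: diag_blocks_def mat_tuples_def)
      fix m assume "m < length (diag_blocks (permute_list \<sigma> \<pi>) i A')"
      then have m: "m < n" using assms by (simp add: diag_blocks_def mat_tuples_def)
      have "mat_block (permute_list \<sigma> \<pi>) i i (A' ! m) = mat_block \<pi> (\<sigma> i) (\<sigma> i) (A ! m)"
      proof (rule eq_matI)
        fix r s assume rs: "r < dim_row (mat_block \<pi> (\<sigma> i) (\<sigma> i) (A ! m))" "s < dim_col (mat_block \<pi> (\<sigma> i) (\<sigma> i) (A ! m))"
        then have rs: "r < \<pi> ! \<sigma> i" "s < \<pi> ! \<sigma> i" by (simp_all add: mat_block_def)
        let ?b = "block_start (permute_list \<sigma> \<pi>) i"
        have b: "blk (permute_list \<sigma> \<pi>) (?b + r) = i" "blk (permute_list \<sigma> \<pi>) (?b + s) = i"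
          using rs i nth by (simp_all add: blk_block_start)
        have l: "?b + r < sum_list \<pi>" "?b + s < sum_list \<pi>"
          using rs i nth block_start_add_less[of i "permute_list \<sigma> \<pi>"] by (simp_all add: sum_list_permute[OF \<sigma>])
        show "mat_block (permute_list \<sigma> \<pi>) i i (A' ! m) $$ (r, s) = mat_block \<pi> (\<sigma> i) (\<sigma> i) (A ! m) $$ (r, s)"
          using R[rule_format, OF m l] rs i b nth by (simp add: mat_block_def block_pos_def)
      qed (use i nth in \<open>simp_all add: mat_block_def\<close>)
      then show "diag_blocks (permute_list \<sigma> \<pi>) i A' ! m = diag_blocks \<pi> (\<sigma> i) A ! m"
        using assms m by (simp add: diag_blocks_def mat_tuples_def)
    qed
  qed
qed

lemma C_pairs_iff:
  assumes "sum_list \<pi> = p"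
  shows "(A, A') \<in> C_pairs p n \<pi> \<sigma> \<longleftrightarrow>
    length A = n \<and> length A' = n \<and> (\<forall>m < n. matched \<pi> \<sigma> (A ! m) (A' ! m))"
proof -
  have "(A, A') \<in> C_pairs p n \<pi> \<sigma> \<longleftrightarrow> (A \<in> mat_tuples p n \<and> A' \<in> mat_tuples p n) \<and>
     (\<forall>X \<in> set A. block_upper_triangular \<pi> X) \<and>
     (\<forall>X \<in> set A'. block_upper_triangular (permute_list \<sigma> \<pi>) X) \<and>
     (\<forall>i < length \<pi>. diag_blocks (permute_list \<sigma> \<pi>) i A' = diag_blocks \<pi> (\<sigma> i) A)"
    by (auto simp: C_pairs_def V_block_def)
  also have "\<dots> \<longleftrightarrow> (A \<in> mat_tuples p n \<and> A' \<in> mat_tuples p n) \<and>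
     (\<forall>X \<in> set A. block_upper_triangular \<pi> X) \<and>
     (\<forall>X \<in> set A'. block_upper_triangular (permute_list \<sigma> \<pi>) X) \<and>
     (\<forall>m < n. \<forall>r < p. \<forall>s < p. blk (permute_list \<sigma> \<pi>) r = blk (permute_list \<sigma> \<pi>) s \<longrightarrow>
      (A' ! m) $$ (r, s) = (A ! m) $$ (block_pos \<pi> \<sigma> r, block_pos \<pi> \<sigma> s))"
    using diag_blocks_eq_iff[of A n A'] unfolding assms by blast
  also have "\<dots> \<longleftrightarrow> length A = n \<and> length A' = n \<and> (\<forall>m < n. matched \<pi> \<sigma> (A ! m) (A' ! m))"
    unfolding block_upper_triangular_iff sum_list_permute[OF \<sigma>] matched_def Let_def assms
      mat_tuples_def all_set_conv_all_nth subset_code(1)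
    by auto
  finally show ?thesis .
qed

end

lemma matchedD:
  assumes "matched \<pi> \<sigma> X X'"
  shows "X \<in> carrier_mat (sum_list \<pi>) (sum_list \<pi>)" "X' \<in> carrier_mat (sum_list \<pi>) (sum_list \<pi>)"
    "r < sum_list \<pi> \<Longrightarrow> s < sum_list \<pi> \<Longrightarrow> blk \<pi> s < blk \<pi> r \<Longrightarrow> X $$ (r, s) = 0"
    "r < sum_list \<pi> \<Longrightarrow> s < sum_list \<pi> \<Longrightarrow> blk (permute_list \<sigma> \<pi>) s < blk (permute_list \<sigma> \<pi>) r \<Longrightarrow> X' $$ (r, s) = 0"
    "r < sum_list \<pi> \<Longrightarrow> s < sum_list \<pi> \<Longrightarrow> blk (permute_list \<sigma> \<pi>) r = blk (permute_list \<sigma> \<pi>) s \<Longrightarrow>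
      X' $$ (r, s) = X $$ (block_pos \<pi> \<sigma> r, block_pos \<pi> \<sigma> s)"
  using assms by (auto simp: matched_def Let_def)

lemma G2_orbit_C_pairs_subset:
  "G2_orbit p (C_pairs p n \<pi> \<sigma>) \<subseteq> mat_tuples p n \<times> mat_tuples p n"
  by (auto simp: G2_orbit_def C_pairs_def V_block_def intro!: conj_tuple_mat_tuples)

lemma C_pairs_subset_orbit: "C_pairs p n \<pi> \<sigma> \<subseteq> G2_orbit p (C_pairs p n \<pi> \<sigma>)"
proof
  fix x assume x: "x \<in> C_pairs p n \<pi> \<sigma>"
  obtain A A' where AA: "x = (A, A')" by (cases x)
  have one: "1\<^sub>m p \<in> GL p" by (auto simp: GL_iff intro!: bexI[of _ "1\<^sub>m p"])
  have inv1: "the (mat_inverse (1\<^sub>m p :: cmat)) = 1\<^sub>m p" by (rule mat_inverse_unique[of _ p]) auto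
  have "conj_tuple (1\<^sub>m p) B = B" if "B \<in> mat_tuples p n" for B
    using that by (auto simp: conj_tuple_def inv1 mat_tuples_def intro!: map_idI)
  then have "x = (conj_tuple (1\<^sub>m p) A, conj_tuple (1\<^sub>m p) A')"
    using x AA by (auto simp: C_pairs_def V_block_def)
  then show "x \<in> G2_orbit p (C_pairs p n \<pi> \<sigma>)"
    unfolding G2_orbit_def using one x AA by (intro CollectI) metis
qed

section \<open>Powers of block triangular matrices\<close>

lemma pow_carrier: "M \<in> carrier_mat p p \<Longrightarrow> M ^\<^sub>m N \<in> carrier_mat p p"
  by simp

text \<open>A nonzero entry of the power comes from a path of N nonzero entries from
  \<open>r\<close> to \<open>s\<close>. No step of the path descends in \<open>bl\<close>, and a
  step can stay at the same level only inside block \<open>b\<close>. So either the path meets block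
  \<open>b\<close> or each of its N steps climbs.\<close>

lemma pow_block_support:
  fixes bl :: "nat \<Rightarrow> nat" and M :: cmat
  assumes M: "M \<in> carrier_mat p p"
    and ut: "\<And>r s. r < p \<Longrightarrow> s < p \<Longrightarrow> bl s < bl r \<Longrightarrow> M $$ (r, s) = 0"
    and dg: "\<And>r s. r < p \<Longrightarrow> s < p \<Longrightarrow> bl r = bl s \<Longrightarrow> bl r \<noteq> b \<Longrightarrow> M $$ (r, s) = 0"
    and rs: "r < p" "s < p" "(M ^\<^sub>m N) $$ (r, s) \<noteq> 0"
  shows "bl r \<le> bl s \<and> (bl r \<le> b \<and> b \<le> bl s \<or> bl r + N \<le> bl s)"
  using rs
proof (induction N arbitrary: s)
  case 0
  then show ?case using M by (auto split: if_splits)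
next
  case (Suc N)
  have "(\<Sum>u<p. (M ^\<^sub>m N) $$ (r, u) * M $$ (u, s)) \<noteq> 0"
    using Suc.prems M mat_mult_entry[OF pow_carrier[OF M, of N] M, of r s] by simp
  then obtain u where u: "u < p" "(M ^\<^sub>m N) $$ (r, u) \<noteq> 0" "M $$ (u, s) \<noteq> 0"
    by (metis (no_types, lifting) lessThan_iff mult_eq_0_iff sum.not_neutral_contains_not_neutral)
  note ih = Suc.IH[OF rs(1) u(1,2)]
  have "bl u \<le> bl s" using ut[of u s] u Suc.prems by (meson linorder_not_le)
  moreover have "bl u = bl s \<Longrightarrow> bl u = b" using dg[of u s] u Suc.prems by auto
  ultimately show ?case using ih by (cases "bl u = bl s") auto
qed

lemma pow_strictly_upper_triangular:
  fixes T :: cmat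
  assumes "T \<in> carrier_mat p p" "\<And>r s. r < p \<Longrightarrow> s < p \<Longrightarrow> s \<le> r \<Longrightarrow> T $$ (r, s) = 0"
  shows "T ^\<^sub>m p = 0\<^sub>m p p"
proof (rule eq_matI)
  fix r s assume "r < dim_row (0\<^sub>m p p :: cmat)" "s < dim_col (0\<^sub>m p p :: cmat)"
  then have "r < p" "s < p" by auto
  \<comment> \<open>Singleton blocks, and b = p lies beyond every index: both alternatives would
    need an index of at least p.\<close>
  then show "(T ^\<^sub>m p) $$ (r, s) = 0\<^sub>m p p $$ (r, s)"
    using pow_block_support[of T p "\<lambda>r. r" p r s p] assms by force
qed (use pow_carrier[OF assms(1), of p] in auto)

lemma upper_triangular_mult:
  fixes X Z :: cmat
  assumes "X \<in> carrier_mat p p" "Z \<in> carrier_mat p p" "upper_triangular X" "upper_triangular Z"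
  shows "upper_triangular (X * Z)" "r < p \<Longrightarrow> (X * Z) $$ (r, r) = X $$ (r, r) * Z $$ (r, r)"
proof -
  have X0: "X $$ (r, s) = 0" if "s < r" "r < p" for r s using assms(1,3) that by auto
  have Z0: "Z $$ (r, s) = 0" if "s < r" "r < p" for r s using assms(2,4) that by auto
  have "(X * Z) $$ (r, s) = 0" if "s < r" "r < p" for r s
  proof -
    have "X $$ (r, u) * Z $$ (u, s) = 0" if "u < p" for u
      using X0[of u r] Z0[of s u] \<open>s < r\<close> \<open>r < p\<close> that by (cases "u < r") auto
    then show ?thesis using that by (subst mat_mult_entry[OF assms(1,2)]) (auto intro!: sum.neutral)
  qed
  then show "upper_triangular (X * Z)" using assms(1,2) by (intro upper_triangularI) auto
  assume r: "r < p"
  have "(X * Z) $$ (r, r) = (\<Sum>u<p. X $$ (r, u) * Z $$ (u, r))"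
    using r by (intro mat_mult_entry[OF assms(1,2)])
  also have "\<dots> = (\<Sum>u\<in>{r}. X $$ (r, u) * Z $$ (u, r))"
  proof (rule sum.mono_neutral_right)
    show "\<forall>u\<in>{..<p} - {r}. X $$ (r, u) * Z $$ (u, r) = 0"
      using X0 Z0 r by (metis DiffD1 DiffD2 insertI1 lessThan_iff linorder_neqE_nat mult_zero_left mult_zero_right)
  qed (use r in auto)
  finally show "(X * Z) $$ (r, r) = X $$ (r, r) * Z $$ (r, r)" by simp
qed

lemma upper_triangular_pow:
  fixes T :: cmat
  assumes "T \<in> carrier_mat p p" "upper_triangular T"
  shows "upper_triangular (T ^\<^sub>m N) \<and> (\<forall>r<p. (T ^\<^sub>m N) $$ (r, r) = (T $$ (r, r)) ^ N)"
proof (induction N)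
  case 0
  then show ?case using assms by auto
next
  case (Suc N)
  then show ?case
    using upper_triangular_mult[OF pow_carrier[OF assms(1), of N] assms(1)] assms by (auto simp: mult.commute)
qed

section \<open>Adjoining eigenvalues to the coordinates\<close>

text \<open>Polynomials in the coordinates and in m further variables \<open>l 0\<close>, ...,
  \<open>l (m - 1)\<close>. The variables are a separate argument so that any eigenvalues of the
  first matrix can be put in for them.\<close>

inductive_set eig_functions :: "nat \<Rightarrow> nat \<Rightarrow> nat \<Rightarrow> (cmat list \<times> cmat list \<Rightarrow> (nat \<Rightarrow> complex) \<Rightarrow> complex) set"
  for p n m :: nat
where
  base: "f \<in> poly_functions p n \<Longrightarrow> (\<lambda>x l. f x) \<in> eig_functions p n m"
| eig: "i < m \<Longrightarrow> (\<lambda>x l. l i) \<in> eig_functions p n m"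
| add: "f \<in> eig_functions p n m \<Longrightarrow> g \<in> eig_functions p n m \<Longrightarrow> (\<lambda>x l. f x l + g x l) \<in> eig_functions p n m"
| mult: "f \<in> eig_functions p n m \<Longrightarrow> g \<in> eig_functions p n m \<Longrightarrow> (\<lambda>x l. f x l * g x l) \<in> eig_functions p n m"

lemma eig_functions_const: "(\<lambda>x l. c) \<in> eig_functions p n m"
  by (rule eig_functions.base) (rule poly_functions.const)

lemma eig_functions_diff:
  assumes "f \<in> eig_functions p n m" "g \<in> eig_functions p n m"
  shows "(\<lambda>x l. f x l - g x l) \<in> eig_functions p n m"
  using eig_functions.add[OF assms(1) eig_functions.mult[OF eig_functions_const[of "-1"] assms(2)]]
  by simp

lemma eig_functions_sum:
  assumes "finite I" "\<And>i. i \<in> I \<Longrightarrow> f i \<in> eig_functions p n m"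
  shows "(\<lambda>x l. \<Sum>i\<in>I. f i x l) \<in> eig_functions p n m"
  using assms by (induction I rule: finite_induct) (auto intro: eig_functions_const eig_functions.add)

lemma eig_functions_prod:
  assumes "finite I" "\<And>i. i \<in> I \<Longrightarrow> f i \<in> eig_functions p n m"
  shows "(\<lambda>x l. \<Prod>i\<in>I. f i x l) \<in> eig_functions p n m"
  using assms by (induction I rule: finite_induct) (auto intro: eig_functions_const eig_functions.mult)

lemma eig_functions_at:
  assumes "f \<in> eig_functions p n m"
  shows "(\<lambda>x. f x l) \<in> poly_functions p n"
  using assms by induction (auto intro: poly_functions.intros)

definition eig_mats :: "nat \<Rightarrow> nat \<Rightarrow> nat \<Rightarrow> (cmat list \<times> cmat list \<Rightarrow> (nat \<Rightarrow> complex) \<Rightarrow> cmat) set" where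
  "eig_mats p n m = {M. (\<forall>x l. M x l \<in> carrier_mat p p) \<and>
     (\<forall>r<p. \<forall>s<p. (\<lambda>x l. M x l $$ (r, s)) \<in> eig_functions p n m)}"

lemma eig_matsI:
  assumes "\<And>x l. M x l \<in> carrier_mat p p"
    "\<And>r s. r < p \<Longrightarrow> s < p \<Longrightarrow> (\<lambda>x l. M x l $$ (r, s)) \<in> eig_functions p n m"
  shows "M \<in> eig_mats p n m"
  using assms by (simp add: eig_mats_def)

lemma eig_matsD:
  assumes "M \<in> eig_mats p n m"
  shows "M x l \<in> carrier_mat p p"
    "r < p \<Longrightarrow> s < p \<Longrightarrow> (\<lambda>x l. M x l $$ (r, s)) \<in> eig_functions p n m"
    "dim_row (M x l) = p" "dim_col (M x l) = p"
proof -
  have M: "(\<forall>x l. M x l \<in> carrier_mat p p) \<and>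
     (\<forall>r<p. \<forall>s<p. (\<lambda>x l. M x l $$ (r, s)) \<in> eig_functions p n m)"
    using assms unfolding eig_mats_def by (rule CollectD)
  show "M x l \<in> carrier_mat p p" "dim_row (M x l) = p" "dim_col (M x l) = p"
    using M[THEN conjunct1, rule_format, of x l] by simp_all
  show "r < p \<Longrightarrow> s < p \<Longrightarrow> (\<lambda>x l. M x l $$ (r, s)) \<in> eig_functions p n m"
    using M[THEN conjunct2] by simp
qed

lemma eig_mats_one: "(\<lambda>x l. 1\<^sub>m p) \<in> eig_mats p n m"
  by (rule eig_matsI) (auto intro: eig_functions_const)

lemma eig_mats_add:
  assumes "M \<in> eig_mats p n m" "N \<in> eig_mats p n m"
  shows "(\<lambda>x l. M x l + N x l) \<in> eig_mats p n m"
proof (rule eig_matsI)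
  fix r s assume rs: "r < p" "s < p"
  have "(\<lambda>x l. (M x l + N x l) $$ (r, s)) = (\<lambda>x l. M x l $$ (r, s) + N x l $$ (r, s))"
    using rs by (intro ext) (simp add: eig_matsD(3,4)[OF assms(1)] eig_matsD(3,4)[OF assms(2)])
  then show "(\<lambda>x l. (M x l + N x l) $$ (r, s)) \<in> eig_functions p n m"
    using eig_functions.add[OF eig_matsD(2)[OF assms(1) rs] eig_matsD(2)[OF assms(2) rs]] by (simp only:)
qed (rule add_carrier_mat[OF eig_matsD(1)[OF assms(2)]])

lemma eig_mats_smult:
  assumes "f \<in> eig_functions p n m" "N \<in> eig_mats p n m"
  shows "(\<lambda>x l. f x l \<cdot>\<^sub>m N x l) \<in> eig_mats p n m"
proof (rule eig_matsI)
  fix r s assume rs: "r < p" "s < p"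
  have "(\<lambda>x l. (f x l \<cdot>\<^sub>m N x l) $$ (r, s)) = (\<lambda>x l. f x l * N x l $$ (r, s))"
    using rs by (intro ext) (simp add: eig_matsD(3,4)[OF assms(2)])
  then show "(\<lambda>x l. (f x l \<cdot>\<^sub>m N x l) $$ (r, s)) \<in> eig_functions p n m"
    using eig_functions.mult[OF assms(1) eig_matsD(2)[OF assms(2) rs]] by (simp only:)
qed (rule smult_carrier_mat[OF eig_matsD(1)[OF assms(2)]])

lemma eig_mats_mult:
  assumes "M \<in> eig_mats p n m" "N \<in> eig_mats p n m"
  shows "(\<lambda>x l. M x l * N x l) \<in> eig_mats p n m"
proof (rule eig_matsI)
  fix r s assume rs: "r < p" "s < p"
  have "(\<lambda>x l. (M x l * N x l) $$ (r, s)) = (\<lambda>x l. \<Sum>u<p. M x l $$ (r, u) * N x l $$ (u, s))"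
    by (simp only: mat_mult_entry[OF eig_matsD(1)[OF assms(1)] eig_matsD(1)[OF assms(2)] rs])
  moreover have "(\<lambda>x l. \<Sum>u<p. M x l $$ (r, u) * N x l $$ (u, s)) \<in> eig_functions p n m"
    using rs eig_matsD(2)[OF assms(1)] eig_matsD(2)[OF assms(2)]
    by (intro eig_functions_sum eig_functions.mult) auto
  ultimately show "(\<lambda>x l. (M x l * N x l) $$ (r, s)) \<in> eig_functions p n m" by (simp only:)
qed (rule mult_carrier_mat[OF eig_matsD(1)[OF assms(1)] eig_matsD(1)[OF assms(2)]])

lemma eig_mats_pow:
  assumes "M \<in> eig_mats p n m"
  shows "(\<lambda>x l. M x l ^\<^sub>m N) \<in> eig_mats p n m"
proof (induction N)
  case 0
  have "(\<lambda>x l. M x l ^\<^sub>m 0) = (\<lambda>x l. 1\<^sub>m p)" by (intro ext) (simp add: eig_matsD(3)[OF assms])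
  then show ?case using eig_mats_one by (simp only:)
next
  case (Suc N)
  then show ?case using eig_mats_mult[OF Suc assms] by (simp only: pow_mat.simps)
qed

text \<open>Rebuilding the matrix entry by entry makes the coordinate maps take values in
  \<^term>\<open>carrier_mat p p\<close> everywhere, not only on \<^const>\<open>mat_tuples\<close>.\<close>

definition coord_mat :: "nat \<Rightarrow> cmat list \<Rightarrow> nat \<Rightarrow> cmat" where
  "coord_mat p A i = mat p p (\<lambda>rs. (A ! i) $$ rs)"

lemma coord_mat_eq: "A ! i \<in> carrier_mat p p \<Longrightarrow> coord_mat p A i = A ! i"
  unfolding coord_mat_def by (intro eq_matI) auto

lemma coord_mat_carrier [simp]: "coord_mat p A i \<in> carrier_mat p p"
  by (simp add: coord_mat_def)

lemma eig_mats_coord: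
  assumes "i < n"
  shows "(\<lambda>x l. coord_mat p (fst x) i) \<in> eig_mats p n m"
    "(\<lambda>x l. coord_mat p (snd x) i) \<in> eig_mats p n m"
  using assms by (auto intro!: eig_matsI eig_functions.base poly_functions.intros simp: coord_mat_def)

lemma scalar_mat_conj:
  fixes P Q :: "'a::comm_ring_1 mat"
  assumes "P \<in> carrier_mat p p" "Q \<in> carrier_mat p p" "P * Q = 1\<^sub>m p"
  shows "P * (c \<cdot>\<^sub>m 1\<^sub>m p) * Q = c \<cdot>\<^sub>m 1\<^sub>m p"
  using assms by (simp add: mult_smult_distrib[OF assms(1) one_carrier_mat] mult_smult_assoc_mat[OF assms(1,2)])

text \<open>After triangularisation of the first matrix, the diagonal of \<open>M\<close> carries the values of
  \<open>f\<close> with the eigenvalues substituted for the last variable.\<close>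

definition eig_subst ::
  "nat \<Rightarrow> nat \<Rightarrow> (cmat list \<times> cmat list \<Rightarrow> (nat \<Rightarrow> complex) \<Rightarrow> complex) \<Rightarrow>
    (cmat list \<times> cmat list \<Rightarrow> (nat \<Rightarrow> complex) \<Rightarrow> cmat) \<Rightarrow> bool" where
  "eig_subst p m f M \<longleftrightarrow> (\<forall>x l P U Q. similar_mat_wit (coord_mat p (fst x) 0) U P Q \<longrightarrow> upper_triangular U \<longrightarrow>
    (\<exists>T. T \<in> carrier_mat p p \<and> upper_triangular T \<and> (\<forall>r<p. T $$ (r, r) = f x (l(m := U $$ (r, r)))) \<and>
      M x l = P * T * Q))"

lemma eig_substI:
  assumes "\<And>x l P U Q. P \<in> carrier_mat p p \<Longrightarrow> Q \<in> carrier_mat p p \<Longrightarrow> U \<in> carrier_mat p p \<Longrightarrow>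
      P * Q = 1\<^sub>m p \<Longrightarrow> Q * P = 1\<^sub>m p \<Longrightarrow> coord_mat p (fst x) 0 = P * U * Q \<Longrightarrow> upper_triangular U \<Longrightarrow>
      similar_mat_wit (coord_mat p (fst x) 0) U P Q \<Longrightarrow>
    \<exists>T. T \<in> carrier_mat p p \<and> upper_triangular T \<and> (\<forall>r<p. T $$ (r, r) = f x (l(m := U $$ (r, r)))) \<and>
      M x l = P * T * Q"
  shows "eig_subst p m f M"
  unfolding eig_subst_def
proof (intro allI impI)
  fix x :: "cmat list \<times> cmat list" and l :: "nat \<Rightarrow> complex" and P U Q
  assume *: "similar_mat_wit (coord_mat p (fst x) 0) U P Q" "upper_triangular U"
  then have "P \<in> carrier_mat p p" "Q \<in> carrier_mat p p" "U \<in> carrier_mat p p"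
    "P * Q = 1\<^sub>m p" "Q * P = 1\<^sub>m p" "coord_mat p (fst x) 0 = P * U * Q"
    by (simp_all add: similar_mat_wit_def Let_def coord_mat_def)
  then show "\<exists>T. T \<in> carrier_mat p p \<and> upper_triangular T \<and> (\<forall>r<p. T $$ (r, r) = f x (l(m := U $$ (r, r)))) \<and>
      M x l = P * T * Q"
    using *(2,1) by (rule assms[of P Q U x l])
qed

lemma eig_substD:
  assumes "eig_subst p m f M" "similar_mat_wit (coord_mat p (fst x) 0) U P Q" "upper_triangular U"
  shows "\<exists>T. T \<in> carrier_mat p p \<and> upper_triangular T \<and> (\<forall>r<p. T $$ (r, r) = f x (l(m := U $$ (r, r)))) \<and>
      M x l = P * T * Q"
  using assms(1)[unfolded eig_subst_def, rule_format, OF assms(2,3)] .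

text \<open>A function free of the m-th variable is represented by a scalar matrix, which every
  conjugation fixes.\<close>

lemma eig_subst_scalar:
  assumes "\<And>x l c. g x (l(m := c)) = g x l"
  shows "eig_subst p m g (\<lambda>x l. g x l \<cdot>\<^sub>m 1\<^sub>m p)"
proof (rule eig_substI, goal_cases)
  case (1 x l P U Q)
  have "g x l \<cdot>\<^sub>m 1\<^sub>m p = P * (g x l \<cdot>\<^sub>m 1\<^sub>m p) * Q"
    using 1 by (intro scalar_mat_conj[symmetric])
  then show ?case
    by (intro exI[of _ "g x l \<cdot>\<^sub>m 1\<^sub>m p"]) (auto simp: assms intro!: upper_triangularI)
qed

lemma upper_triangular_add:
  fixes T R :: cmat
  assumes "T \<in> carrier_mat p p" "R \<in> carrier_mat p p" "upper_triangular T" "upper_triangular R"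
  shows "upper_triangular (T + R)"
  using assms by (intro upper_triangularI) (auto simp: upper_triangularD)

lemma eig_subst_add:
  assumes "eig_subst p m f M" "eig_subst p m g N"
  shows "eig_subst p m (\<lambda>x l. f x l + g x l) (\<lambda>x l. M x l + N x l)"
proof (rule eig_substI, goal_cases)
  case (1 x l P U Q)
  obtain T where T: "T \<in> carrier_mat p p" "upper_triangular T"
    "\<forall>r<p. T $$ (r, r) = f x (l(m := U $$ (r, r)))" "M x l = P * T * Q"
    using eig_substD[OF assms(1) 1(8,7), of l] by (elim exE conjE)
  obtain R where R: "R \<in> carrier_mat p p" "upper_triangular R"
    "\<forall>r<p. R $$ (r, r) = g x (l(m := U $$ (r, r)))" "N x l = P * R * Q"
    using eig_substD[OF assms(2) 1(8,7), of l] by (elim exE conjE)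
  have "M x l + N x l = P * (T + R) * Q"
    using 1(1,2) T(1) R(1) unfolding T(4) R(4)
    by (simp add: mult_add_distrib_mat[OF 1(1) T(1) R(1)] add_mult_distrib_mat[where nr=p and n=p and nc=p])
  then show ?case
    using T(1,3) R(1,3) upper_triangular_add[OF T(1) R(1) T(2) R(2)] by (intro exI[of _ "T + R"]) simp
qed

lemma eig_subst_mult:
  assumes "eig_subst p m f M" "eig_subst p m g N"
  shows "eig_subst p m (\<lambda>x l. f x l * g x l) (\<lambda>x l. M x l * N x l)"
proof (rule eig_substI, goal_cases)
  case (1 x l P U Q)
  obtain T where T: "T \<in> carrier_mat p p" "upper_triangular T"
    "\<forall>r<p. T $$ (r, r) = f x (l(m := U $$ (r, r)))" "M x l = P * T * Q"
    using eig_substD[OF assms(1) 1(8,7), of l] by (elim exE conjE)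
  obtain R where R: "R \<in> carrier_mat p p" "upper_triangular R"
    "\<forall>r<p. R $$ (r, r) = g x (l(m := U $$ (r, r)))" "N x l = P * R * Q"
    using eig_substD[OF assms(2) 1(8,7), of l] by (elim exE conjE)
  note ass = assoc_mult_mat[where n\<^sub>1=p and n\<^sub>2=p and n\<^sub>3=p and n\<^sub>4=p]
  have "M x l * N x l = P * T * (Q * P) * R * Q"
    using 1(1,2) T(1) R(1) unfolding T(4) R(4) by (simp add: ass)
  also have "\<dots> = P * (T * R) * Q" using 1(1,2,5) T(1) R(1) by (simp add: ass)
  finally show ?case
    using T(1,3) R(1,3) upper_triangular_mult[OF T(1) R(1) T(2) R(2)] by (intro exI[of _ "T * R"]) simp
qed

text \<open>Sending the last variable to the first matrix and everything else to scalar matrices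
  respects sums and products, so \<open>M\<close> is built along the generation of \<open>f\<close>.
  Triangularisation turns \<open>M\<close> into a triangular matrix whose diagonal is computed by
  the same sums and products.\<close>

lemma eig_functions_subst_mat:
  assumes "f \<in> eig_functions p n (Suc m)" "0 < n"
  shows "\<exists>M. M \<in> eig_mats p n m \<and> eig_subst p m f M"
  using assms(1)
proof induction
  case (base f)
  then show ?case
    using eig_subst_scalar[of "\<lambda>x l. f x" m p] eig_mats_smult[OF eig_functions.base[OF base] eig_mats_one]
    by (intro exI[of _ "\<lambda>x l. f x \<cdot>\<^sub>m 1\<^sub>m p"] conjI) simp_all
next
  case (eig i)
  show ?case
  proof (cases "i = m")
    case True
    have "eig_subst p m (\<lambda>x l. l i) (\<lambda>x l. coord_mat p (fst x) 0)"
      by (rule eig_substI) (use True in auto)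
    then show ?thesis using eig_mats_coord(1)[OF assms(2)] by (intro exI conjI)
  next
    case False
    then have "eig_subst p m (\<lambda>x l. l i) (\<lambda>x l. l i \<cdot>\<^sub>m 1\<^sub>m p)"
      using eig_subst_scalar[of "\<lambda>x l. l i" m p] by simp
    moreover have "(\<lambda>x l. l i \<cdot>\<^sub>m 1\<^sub>m p) \<in> eig_mats p n m"
      using eig False by (intro eig_mats_smult eig_mats_one eig_functions.eig) simp
    ultimately show ?thesis by (intro exI conjI)
  qed
next
  case (add f g)
  from add.IH obtain M N where "M \<in> eig_mats p n m" "eig_subst p m f M" "N \<in> eig_mats p n m" "eig_subst p m g N"
    by (elim exE conjE)
  then show ?case by (intro exI[of _ "\<lambda>x l. M x l + N x l"] conjI eig_mats_add eig_subst_add)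
next
  case (mult f g)
  from mult.IH obtain M N where "M \<in> eig_mats p n m" "eig_subst p m f M" "N \<in> eig_mats p n m" "eig_subst p m g N"
    by (elim exE conjE)
  then show ?case by (intro exI[of _ "\<lambda>x l. M x l * N x l"] conjI eig_mats_mult eig_subst_mult)
qed

lemma schur_complex:
  fixes Y :: cmat
  assumes "Y \<in> carrier_mat p p"
  shows "\<exists>U P Q. similar_mat_wit Y U P Q \<and> upper_triangular U \<and> (\<forall>r<p. eigenvalue Y (U $$ (r, r)))"
proof -
  obtain es where es: "char_poly Y = (\<Prod>e \<leftarrow> es. [:- e, 1:])"
    using char_poly_factorized[OF assms] by blast
  obtain U where U: "U \<in> carrier_mat p p" "upper_triangular U" "similar_mat Y U"
    using schur_decomposition_exists[OF assms es] by blast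
  then obtain P Q where PQ: "similar_mat_wit Y U P Q" unfolding similar_mat_def by blast
  have e: "eigenvalue Y (U $$ (r, r))" if "r < p" for r
  proof -
    have "poly (char_poly U) (U $$ (r, r)) = 0"
      unfolding char_poly_upper_triangular[OF U(1,2)]
      using that U(1) by (auto simp: poly_prod_list prod_list_zero_iff diag_mat_def)
    then show ?thesis
      using eigenvalue_root_char_poly[OF assms] char_poly_similar[OF U(3)] by simp
  qed
  show ?thesis using PQ U(2) e by blast
qed

text \<open>Induction on \<open>m\<close>: substituting the first matrix for the last variable of \<open>f\<close> gives a matrix
  whose \<open>p\<close>-th power vanishes on \<open>S\<close>, hence also at \<open>a\<close>; so the eigenvalues of that matrix at \<open>a\<close>,
  which are values of \<open>f\<close>, are zero.\<close>

lemma closure_eig_functions: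
  assumes n: "0 < n" and S: "S \<subseteq> mat_tuples p n \<times> mat_tuples p n" and a: "a \<in> zariski_closure p n S"
    and Y: "upper_triangular (coord_mat p (fst a) 0)"
  shows "f \<in> eig_functions p n m \<Longrightarrow>
    (\<And>s l. s \<in> S \<Longrightarrow> (\<And>i. i < m \<Longrightarrow> eigenvalue (coord_mat p (fst s) 0) (l i)) \<Longrightarrow> f s l = 0) \<Longrightarrow>
    (\<And>i. i < m \<Longrightarrow> \<exists>r<p. l0 i = coord_mat p (fst a) 0 $$ (r, r)) \<Longrightarrow> f a l0 = 0"
proof (induction m arbitrary: f)
  case 0
  have c: "\<forall>f \<in> poly_functions p n. (\<forall>s \<in> S. f s = 0) \<longrightarrow> f a = 0"
    using a unfolding zariski_closure_iff[OF S] by (rule conjunct2)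
  show ?case
    by (rule c[rule_format, OF eig_functions_at[OF 0(1), of l0]], rule 0(2)) simp_all
next
  case (Suc m)
  obtain M where M: "M \<in> eig_mats p n m" "eig_subst p m f M"
    using eig_functions_subst_mat[OF Suc.prems(1) n] by (elim exE conjE)
  obtain r where r: "r < p" "l0 m = coord_mat p (fst a) 0 $$ (r, r)" using Suc.prems(3)[of m] by auto
  have "(M a l0 ^\<^sub>m p) $$ (r, r) = 0"
  proof (rule Suc.IH)
    show "(\<lambda>x l. (M x l ^\<^sub>m p) $$ (r, r)) \<in> eig_functions p n m"
      using eig_matsD(2)[OF eig_mats_pow[OF M(1)] r(1) r(1)] .
    show "\<exists>r<p. l0 i = coord_mat p (fst a) 0 $$ (r, r)" if "i < m" for i
      using Suc.prems(3)[of i] that by simp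
    fix s l assume s: "s \<in> S" and l: "\<And>i. i < m \<Longrightarrow> eigenvalue (coord_mat p (fst s) 0) (l i)"
    obtain U P Q where U: "similar_mat_wit (coord_mat p (fst s) 0) U P Q" "upper_triangular U"
      "\<forall>r<p. eigenvalue (coord_mat p (fst s) 0) (U $$ (r, r))"
      using schur_complex[OF coord_mat_carrier[of p "fst s" 0]] by (elim exE conjE)
    obtain T where T: "T \<in> carrier_mat p p" "upper_triangular T"
      "\<forall>r<p. T $$ (r, r) = f s (l(m := U $$ (r, r)))" "M s l = P * T * Q"
      using eig_substD[OF M(2) U(1,2), of l] by (elim exE conjE)
    \<comment> \<open>Each diagonal entry of \<open>U\<close> is an eigenvalue, so after the update
      all \<open>Suc m\<close> variables are eigenvalues and the hypothesis on \<open>S\<close>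
      applies. Repeated eigenvalues are allowed, which is what makes the induction go
      through.\<close>
    have "T $$ (r, r) = 0" if "r < p" for r
      unfolding T(3)[rule_format, OF that] by (rule Suc.prems(2)[OF s]) (use l U(3)[rule_format, OF that] in \<open>auto simp: less_Suc_eq\<close>)
    then have "T ^\<^sub>m p = 0\<^sub>m p p" using T(1,2)
      by (intro pow_strictly_upper_triangular) (auto simp: le_less)
    moreover have "similar_mat_wit (M s l) T P Q"
      using similar_mat_witD2[OF coord_mat_carrier U(1)] T(1,4) eig_matsD(1)[OF M(1), of s l]
      by (intro similar_mat_witI) simp_all
    ultimately have sw: "similar_mat_wit (M s l ^\<^sub>m p) (0\<^sub>m p p) P Q"
      using similar_mat_wit_pow[of "M s l" T P Q p] by simp
    note D = similar_mat_witD2[OF eig_matsD(1)[OF eig_mats_pow[OF M(1), of p], of s l] sw]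
    show "(M s l ^\<^sub>m p) $$ (r, r) = 0" unfolding D(3) using D(6,7) r(1) by simp
  qed
  \<comment> \<open>At \<open>a\<close> the first matrix is already triangular, so the trivial
    conjugation serves. The r-th diagonal entry of \<open>T\<close> is then \<open>f a l0\<close>,
    and that of the power is \<open>f a l0 ^ p\<close>.\<close>
  moreover have w: "similar_mat_wit (coord_mat p (fst a) 0) (coord_mat p (fst a) 0) (1\<^sub>m p) (1\<^sub>m p)"
    by (simp add: similar_mat_wit_def Let_def coord_mat_def)
  obtain T where T: "T \<in> carrier_mat p p" "upper_triangular T"
    "\<forall>r<p. T $$ (r, r) = f a (l0(m := coord_mat p (fst a) 0 $$ (r, r)))" "M a l0 = 1\<^sub>m p * T * 1\<^sub>m p"
    using eig_substD[OF M(2) w Y, of l0] by (elim exE conjE)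
  ultimately have "T $$ (r, r) = 0" using upper_triangular_pow[OF T(1,2), of p] r(1) by simp
  then show ?case using T(3)[rule_format, OF r(1)] by (simp flip: r(2))
qed

section \<open>The algebra of matched pairs\<close>

lemma matched_one:
  assumes "\<sigma> permutes {..<length \<pi>}"
  shows "matched \<pi> \<sigma> (1\<^sub>m (sum_list \<pi>)) (1\<^sub>m (sum_list \<pi>))"
  using block_pos(1)[OF assms] inj_on_eq_iff[OF block_pos_inj[OF assms]]
  by (auto simp: matched_def Let_def)

lemma matched_add:
  assumes "\<sigma> permutes {..<length \<pi>}" "matched \<pi> \<sigma> X X'" "matched \<pi> \<sigma> Z Z'"
  shows "matched \<pi> \<sigma> (X + Z) (X' + Z')"
  using assms block_pos(1)[OF assms(1)] by (auto simp: matched_def Let_def)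

lemma matched_smult:
  assumes "\<sigma> permutes {..<length \<pi>}" "matched \<pi> \<sigma> X X'"
  shows "matched \<pi> \<sigma> (c \<cdot>\<^sub>m X) (c \<cdot>\<^sub>m X')"
  using assms block_pos(1)[OF assms(1)] by (auto simp: matched_def Let_def)

lemma block_triangular_mult_entry:
  fixes bl :: "nat \<Rightarrow> nat" and X Z :: cmat
  assumes "X \<in> carrier_mat p p" "Z \<in> carrier_mat p p"
    "\<And>r s. r < p \<Longrightarrow> s < p \<Longrightarrow> bl s < bl r \<Longrightarrow> X $$ (r, s) = 0"
    "\<And>r s. r < p \<Longrightarrow> s < p \<Longrightarrow> bl s < bl r \<Longrightarrow> Z $$ (r, s) = 0"
    "r < p" "s < p"
  shows "(X * Z) $$ (r, s) = (\<Sum>u | u < p \<and> bl r \<le> bl u \<and> bl u \<le> bl s. X $$ (r, u) * Z $$ (u, s))"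
proof -
  have "(X * Z) $$ (r, s) = (\<Sum>u<p. X $$ (r, u) * Z $$ (u, s))"
    by (rule mat_mult_entry[OF assms(1,2,5,6)])
  also have "\<dots> = (\<Sum>u | u < p \<and> bl r \<le> bl u \<and> bl u \<le> bl s. X $$ (r, u) * Z $$ (u, s))"
  proof (rule sum.mono_neutral_right)
    show "\<forall>u\<in>{..<p} - {u. u < p \<and> bl r \<le> bl u \<and> bl u \<le> bl s}. X $$ (r, u) * Z $$ (u, s) = 0"
    proof
      fix u assume u: "u \<in> {..<p} - {u. u < p \<and> bl r \<le> bl u \<and> bl u \<le> bl s}"
      then consider "bl u < bl r" | "bl s < bl u" by fastforce
      then show "X $$ (r, u) * Z $$ (u, s) = 0"
        using u assms(3)[OF assms(5), of u] assms(4)[OF _ assms(6), of u] by cases auto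
    qed
  qed auto
  finally show ?thesis .
qed

text \<open>For block triangular factors, only intermediate indices from the same block contribute
  to a diagonal block of the product. Diagonal blocks therefore multiply among themselves, and
  \<open>block_pos\<close> carries the sum on one side to the sum on the other.\<close>

lemma matched_mult:
  assumes \<sigma>: "\<sigma> permutes {..<length \<pi>}" and X: "matched \<pi> \<sigma> X X'" and Z: "matched \<pi> \<sigma> Z Z'"
  shows "matched \<pi> \<sigma> (X * Z) (X' * Z')"
proof -
  let ?p = "sum_list \<pi>" and ?bl = "blk \<pi>" and ?bl' = "blk (permute_list \<sigma> \<pi>)" and ?t = "block_pos \<pi> \<sigma>"
  note X = matchedD[OF X] and Z = matchedD[OF Z]
  note e = block_triangular_mult_entry[OF X(1) Z(1), of "?bl", OF X(3) Z(3)]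
  note e' = block_triangular_mult_entry[OF X(2) Z(2), of "?bl'", OF X(4) Z(4)]
  have "(X * Z) $$ (r, s) = 0" if "r < ?p" "s < ?p" "?bl s < ?bl r" for r s
    using that by (subst e) (auto intro!: sum.neutral)
  moreover have "(X' * Z') $$ (r, s) = 0" if "r < ?p" "s < ?p" "?bl' s < ?bl' r" for r s
    using that by (subst e') (auto intro!: sum.neutral)
  moreover have "(X' * Z') $$ (r, s) = (X * Z) $$ (?t r, ?t s)"
    if rs: "r < ?p" "s < ?p" "?bl' r = ?bl' s" for r s
  proof -
    have t: "?t r < ?p" "?t s < ?p" "?bl (?t r) = \<sigma> (?bl' s)" "?bl (?t s) = \<sigma> (?bl' s)"
      using block_pos[OF \<sigma>] rs by auto
    have "(X * Z) $$ (?t r, ?t s) = (\<Sum>u | u < ?p \<and> ?bl u = \<sigma> (?bl' s). X $$ (?t r, u) * Z $$ (u, ?t s))"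
      using t by (subst e) (auto intro!: sum.cong)
    also have "\<dots> = (\<Sum>u | u < ?p \<and> ?bl' u = ?bl' s. X $$ (?t r, ?t u) * Z $$ (?t u, ?t s))"
    proof (rule sum.reindex_bij_betw[symmetric, where h = ?t])
      have "?t ` {u. u < ?p \<and> ?bl' u = ?bl' s} = {u. u < ?p \<and> ?bl u = \<sigma> (?bl' s)}"
      proof (intro equalityI subsetI)
        fix u assume u: "u \<in> {u. u < ?p \<and> ?bl u = \<sigma> (?bl' s)}"
        then have "u \<in> ?t ` {..<?p}" using block_pos_bij[OF \<sigma>] by (simp add: bij_betw_def)
        then obtain w where w: "w < ?p" "u = ?t w" by blast
        then have "\<sigma> (?bl' w) = \<sigma> (?bl' s)" using u block_pos(2)[OF \<sigma> w(1)] by simp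
        then have "?bl' w = ?bl' s" using permutes_inj[OF \<sigma>] by (simp add: inj_def)
        then show "u \<in> ?t ` {u. u < ?p \<and> ?bl' u = ?bl' s}" using w by auto
      qed (use block_pos[OF \<sigma>] in auto)
      then show "bij_betw ?t {u. u < ?p \<and> ?bl' u = ?bl' s} {u. u < ?p \<and> ?bl u = \<sigma> (?bl' s)}"
        using block_pos_inj[OF \<sigma>] by (auto simp: bij_betw_def intro: inj_on_subset)
    qed
    also have "\<dots> = (\<Sum>u | u < ?p \<and> ?bl' u = ?bl' s. X' $$ (r, u) * Z' $$ (u, s))"
      using rs X(5) Z(5) by (intro sum.cong) auto
    also have "\<dots> = (X' * Z') $$ (r, s)" using rs by (subst e') (auto intro!: sum.cong)
    finally show ?thesis by simp
  qed
  ultimately show ?thesis using X(1,2) Z(1,2) by (simp add: matched_def Let_def)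
qed

lemma matched_pow:
  assumes \<sigma>: "\<sigma> permutes {..<length \<pi>}" and X: "matched \<pi> \<sigma> X X'"
  shows "matched \<pi> \<sigma> (X ^\<^sub>m N) (X' ^\<^sub>m N)"
proof (induction N)
  case 0
  then show ?case using matched_one[OF \<sigma>] matchedD(1,2)[OF X] by simp
next
  case (Suc N)
  then show ?case using matched_mult[OF \<sigma> Suc X] by simp
qed

section \<open>Spectral projections\<close>

text \<open>For \<open>js = others p i\<close> this is the numerator of a Lagrange interpolation
  polynomial evaluated at \<open>Y\<close>. If the \<open>l i\<close> are distinct eigenvalues it is
  a nonzero multiple of the i-th spectral projection; leaving out the denominator keeps it
  polynomial in \<open>l\<close>.\<close>

definition eig_prod :: "nat \<Rightarrow> cmat \<Rightarrow> (nat \<Rightarrow> complex) \<Rightarrow> nat list \<Rightarrow> cmat" where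
  "eig_prod p Y l js = foldr (\<lambda>j M. (Y + (- l j) \<cdot>\<^sub>m 1\<^sub>m p) * M) js (1\<^sub>m p)"

lemma eig_prod_simps:
  "eig_prod p Y l [] = 1\<^sub>m p"
  "eig_prod p Y l (j # js) = (Y + (- l j) \<cdot>\<^sub>m 1\<^sub>m p) * eig_prod p Y l js"
  by (simp_all add: eig_prod_def)

lemma eig_prod_carrier [simp]:
  "Y \<in> carrier_mat p p \<Longrightarrow> eig_prod p Y l js \<in> carrier_mat p p"
  by (induction js) (auto simp: eig_prod_simps intro!: mult_carrier_mat)

lemma matched_eig_prod:
  assumes \<sigma>: "\<sigma> permutes {..<length \<pi>}" and Y: "matched \<pi> \<sigma> Y Y'"
  shows "matched \<pi> \<sigma> (eig_prod (sum_list \<pi>) Y l js) (eig_prod (sum_list \<pi>) Y' l js)"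
  by (induction js) (simp_all add: eig_prod_simps \<sigma> Y matched_one matched_mult matched_add matched_smult)

abbreviation others :: "nat \<Rightarrow> nat \<Rightarrow> nat list" where
  "others p i \<equiv> filter (\<lambda>j. j \<noteq> i) [0..<p]"

text \<open>The columns of \<open>V\<close> are eigenvectors. Every product of factors
  \<open>Y - l j\<close> acts on them by scalars, and this very fact also yields their
  independence.\<close>

lemma diagonalization:
  fixes Y :: cmat
  assumes Y: "Y \<in> carrier_mat p p" and ev: "\<And>i. i < p \<Longrightarrow> eigenvalue Y (l i)" and inj: "inj_on l {..<p}"
  shows "\<exists>V W. V \<in> carrier_mat p p \<and> W \<in> carrier_mat p p \<and> V * W = 1\<^sub>m p \<and> W * V = 1\<^sub>m p \<and>
    (\<forall>js. eig_prod p Y l js = V * mat_diag p (\<lambda>u. \<Prod>j\<leftarrow>js. l u - l j) * W)"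
proof -
  have "\<exists>v. \<forall>i<p. eigenvector Y (v i) (l i)"
    using ev unfolding eigenvalue_def by metis
  then obtain v where v: "\<And>i. i < p \<Longrightarrow> eigenvector Y (v i) (l i)" by blast
  have vc: "v i \<in> carrier_vec p" "v i \<noteq> 0\<^sub>v p" "Y *\<^sub>v v i = l i \<cdot>\<^sub>v v i" if "i < p" for i
    using v[OF that] Y by (auto simp: eigenvector_def)
  define V where "V = mat p p (\<lambda>(r, u). v u $ r)"
  have V: "V \<in> carrier_mat p p" by (simp add: V_def)
  have YV: "(Y * V) $$ (r, u) = l u * V $$ (r, u)" if "r < p" "u < p" for r u
  proof -
    have "(Y * V) $$ (r, u) = (Y *\<^sub>v v u) $ r"
      using that Y vc(1)[of u] by (auto simp: V_def scalar_prod_def)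
    then show ?thesis using vc[of u] that by (simp add: V_def)
  qed
  have step: "(Y + (- l j) \<cdot>\<^sub>m 1\<^sub>m p) * V = V * mat_diag p (\<lambda>u. l u - l j)" for j
  proof (rule eq_matI)
    fix r u assume "r < dim_row (V * mat_diag p (\<lambda>u. l u - l j))" "u < dim_col (V * mat_diag p (\<lambda>u. l u - l j))"
    then have ru: "r < p" "u < p" using V by (simp_all add: mat_diag_def)
    have "(Y + (- l j) \<cdot>\<^sub>m 1\<^sub>m p) * V = Y * V + (- l j) \<cdot>\<^sub>m V"
      using Y V by (simp add: add_mult_distrib_mat[where nr=p and n=p and nc=p] mult_smult_assoc_mat[where nr=p and n=p and nc=p])
    then have "((Y + (- l j) \<cdot>\<^sub>m 1\<^sub>m p) * V) $$ (r, u) = (Y * V) $$ (r, u) + (- l j) * V $$ (r, u)"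
      using ru V Y by (simp del: index_mult_mat(1))
    then show "((Y + (- l j) \<cdot>\<^sub>m 1\<^sub>m p) * V) $$ (r, u) = (V * mat_diag p (\<lambda>u. l u - l j)) $$ (r, u)"
      using ru V unfolding YV[OF ru] mat_diag_mult_right[OF V] by (simp add: algebra_simps)
  qed (use V Y in \<open>simp_all add: mat_diag_def\<close>)
  note ass = assoc_mult_mat[where n\<^sub>1=p and n\<^sub>2=p and n\<^sub>3=p and n\<^sub>4=p]
  have EV: "eig_prod p Y l js * V = V * mat_diag p (\<lambda>u. \<Prod>j\<leftarrow>js. l u - l j)" for js
  proof (induction js)
    case Nil
    then show ?case using V by (simp add: eig_prod_simps)
  next
    case (Cons j js)
    have "eig_prod p Y l (j # js) * V = (Y + (- l j) \<cdot>\<^sub>m 1\<^sub>m p) * (eig_prod p Y l js * V)"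
      using Y V by (simp add: eig_prod_simps ass)
    also have "\<dots> = ((Y + (- l j) \<cdot>\<^sub>m 1\<^sub>m p) * V) * mat_diag p (\<lambda>u. \<Prod>j\<leftarrow>js. l u - l j)"
      unfolding Cons using Y V by (simp add: ass)
    also have "\<dots> = V * (mat_diag p (\<lambda>u. l u - l j) * mat_diag p (\<lambda>u. \<Prod>j\<leftarrow>js. l u - l j))"
      unfolding step using V by (simp add: ass del: mat_diag_diag)
    finally show ?case by simp
  qed
  have "det V \<noteq> 0"
  proof
    assume "det V = 0"
    then obtain c where c: "c \<in> carrier_vec p" "c \<noteq> 0\<^sub>v p" "V *\<^sub>v c = 0\<^sub>v p"
      using det_0_iff_vec_prod_zero_field[OF V] by blast
    then obtain i where i: "i < p" "c $ i \<noteq> 0"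
      by (metis carrier_vecD eq_vecI index_zero_vec(1) index_zero_vec(2))
    \<comment> \<open>The product over \<open>others p i\<close> annihilates all eigenvectors but
      the i-th. Applied to the relation \<open>V *\<^sub>v c = 0\<^sub>v p\<close> with
      \<open>c $ i\<close> nonzero, it leaves a nonzero multiple of \<open>v i\<close>, which would
      have to vanish.\<close>
    let ?m = "\<lambda>u. \<Prod>j\<leftarrow>others p i. l u - l j"
    have m0: "?m u = 0" if "u < p" "u \<noteq> i" for u
      using that by (auto simp: prod_list_zero_iff)
    have mi: "?m i \<noteq> 0" using i(1) inj by (auto simp: prod_list_zero_iff inj_on_def)
    have "(V * mat_diag p ?m) *\<^sub>v c = eig_prod p Y l (others p i) *\<^sub>v (V *\<^sub>v c)"
      using EV[of "others p i"] Y V c(1) by (metis assoc_mult_mat_vec eig_prod_carrier)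
    also have "\<dots> = 0\<^sub>v p" unfolding c(3)
      by (rule eq_vecI) (use eig_prod_carrier[OF Y, of l "others p i"] in auto)
    finally have z: "(V * mat_diag p ?m) *\<^sub>v c = 0\<^sub>v p" .
    have "V $$ (r, i) = 0" if r: "r < p" for r
    proof -
      have "((V * mat_diag p ?m) *\<^sub>v c) $ r = (\<Sum>u<p. V $$ (r, u) * ?m u * c $ u)"
        using r V c(1) by (auto simp: mat_diag_mult_right[OF V] scalar_prod_def lessThan_atLeast0)
      also have "\<dots> = (\<Sum>u\<in>{i}. V $$ (r, u) * ?m u * c $ u)"
        by (rule sum.mono_neutral_right) (use i m0 in auto)
      finally show ?thesis using z r i mi by simp
    qed
    then have "v i = 0\<^sub>v p" using vc(1)[OF i(1)] i(1) by (intro eq_vecI) (auto simp: V_def)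
    then show False using vc(2)[OF i(1)] by simp
  qed
  then have "V \<in> Units (ring_mat TYPE(complex) p ())" by (rule det_non_zero_imp_unit[OF V])
  then obtain W where W: "W \<in> carrier_mat p p" "V * W = 1\<^sub>m p" "W * V = 1\<^sub>m p"
    by (auto simp: Units_def ring_mat_def)
  have "eig_prod p Y l js = V * mat_diag p (\<lambda>u. \<Prod>j\<leftarrow>js. l u - l j) * W" for js
  proof -
    have "eig_prod p Y l js = eig_prod p Y l js * (V * W)" using W(2) right_mult_one_mat[OF eig_prod_carrier[OF Y, of l js]] by simp
    also have "\<dots> = eig_prod p Y l js * V * W" using V W(1) Y by (simp add: ass)
    finally show ?thesis unfolding EV .
  qed
  then show ?thesis using V W by blast
qed

text \<open>The i-th spectral projection is block triangular, idempotent and of rank one. Its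
  diagonal blocks are then idempotent of rank at most one, so their traces are 0 or 1. The traces
  add up to 1, hence exactly one block has trace 1, which is \<beta> i, and the other diagonal
  blocks vanish.\<close>

lemma spectral_blocks:
  fixes Y :: cmat
  assumes p: "p = sum_list \<pi>" and Y: "Y \<in> carrier_mat p p"
    and ut: "\<And>js r s. r < p \<Longrightarrow> s < p \<Longrightarrow> blk \<pi> s < blk \<pi> r \<Longrightarrow> eig_prod p Y l js $$ (r, s) = 0"
    and ev: "\<And>i. i < p \<Longrightarrow> eigenvalue Y (l i)" and inj: "inj_on l {..<p}"
  shows "\<exists>\<beta>. (\<forall>i<p. \<beta> i < length \<pi>) \<and> (\<forall>t<length \<pi>. card {i. i < p \<and> \<beta> i = t} = \<pi> ! t) \<and>
    (\<forall>i<p. (\<forall>r<p. \<forall>s<p. blk \<pi> r = blk \<pi> s \<longrightarrow> blk \<pi> r \<noteq> \<beta> i \<longrightarrow> eig_prod p Y l (others p i) $$ (r, s) = 0) \<and>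
      (\<exists>x y. \<forall>r<p. \<forall>s<p. eig_prod p Y l (others p i) $$ (r, s) = x r * y s))"
proof -
  obtain V W where V: "V \<in> carrier_mat p p" and W: "W \<in> carrier_mat p p" and VW: "V * W = 1\<^sub>m p" "W * V = 1\<^sub>m p"
    and E: "\<And>js. eig_prod p Y l js = V * mat_diag p (\<lambda>u. \<Prod>j\<leftarrow>js. l u - l j) * W"
    using diagonalization[OF Y ev inj] by blast
  define c where "c i = (\<Prod>j\<leftarrow>others p i. l i - l j)" for i
  have c: "c i \<noteq> 0" if "i < p" for i
    using that inj by (auto simp: c_def prod_list_zero_iff inj_on_def)
  have G: "eig_prod p Y l (others p i) $$ (r, s) = c i * (V $$ (r, i) * W $$ (i, s))"
    if "i < p" "r < p" "s < p" for i r s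
  proof -
    let ?m = "\<lambda>u. \<Prod>j\<leftarrow>others p i. l u - l j"
    have m0: "?m u = 0" if "u < p" "u \<noteq> i" for u
      using that by (auto simp: prod_list_zero_iff)
    have "eig_prod p Y l (others p i) $$ (r, s) = (\<Sum>u<p. V $$ (r, u) * ?m u * W $$ (u, s))"
      unfolding E using that V W
      by (subst mat_mult_entry[of _ p]) (auto simp: mat_diag_mult_right[OF V])
    also have "\<dots> = (\<Sum>u\<in>{i}. V $$ (r, u) * ?m u * W $$ (u, s))"
      by (rule sum.mono_neutral_right) (use that m0 in auto)
    finally show ?thesis by (simp add: c_def)
  qed
  \<comment> \<open>The trace of the t-th diagonal block of the projection
    \<open>V e\<^sub>i e\<^sub>i\<^sup>T W\<close>.\<close>
  define tr where "tr t i = (\<Sum>r | r < p \<and> blk \<pi> r = t. V $$ (r, i) * W $$ (i, r))" for t i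
  have P0: "V $$ (r, i) * W $$ (i, s) = 0" if "i < p" "r < p" "s < p" "blk \<pi> s < blk \<pi> r" for i r s
    using ut[OF that(2-4), of "others p i"] G[OF that(1-3)] c[OF that(1)] by simp
  have WV: "(\<Sum>r<p. W $$ (i, r) * V $$ (r, i)) = 1" if "i < p" for i
    using mat_mult_entry[OF W V that that] VW that by simp
  have VW1: "(\<Sum>i<p. V $$ (r, i) * W $$ (i, r)) = 1" if "r < p" for r
    using mat_mult_entry[OF V W that that] VW that by simp
  have sum1: "(\<Sum>t<length \<pi>. tr t i) = 1" if i: "i < p" for i
  proof -
    have "(\<Sum>t<length \<pi>. tr t i) = (\<Sum>t<length \<pi>. \<Sum>r | r \<in> {..<p} \<and> blk \<pi> r = t. V $$ (r, i) * W $$ (i, r))"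
      unfolding tr_def by (intro sum.cong) auto
    also have "\<dots> = (\<Sum>r<p. V $$ (r, i) * W $$ (i, r))"
      by (rule sum.group) (use blk(1) p in auto)
    finally show ?thesis using WV[OF i] by (simp add: mult.commute)
  qed
  \<comment> \<open>By triangularity, squaring the projection squares its diagonal block. The block
    has rank one, so its square is \<open>tr t i\<close> times itself; it also equals itself, and so
    vanishes unless the trace is 1.\<close>
  have D0: "V $$ (r, i) * W $$ (i, s) = 0"
    if i: "i < p" and rs: "r < p" "s < p" and t: "blk \<pi> r = t" "blk \<pi> s = t" and tr: "tr t i \<noteq> 1" for i r s t
  proof -
    have "V $$ (r, i) * W $$ (i, s) = (\<Sum>u<p. (V $$ (r, i) * W $$ (i, u)) * (V $$ (u, i) * W $$ (i, s)))"
    proof -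
      have "(\<Sum>u<p. (V $$ (r, i) * W $$ (i, u)) * (V $$ (u, i) * W $$ (i, s))) =
          V $$ (r, i) * (\<Sum>u<p. W $$ (i, u) * V $$ (u, i)) * W $$ (i, s)"
        by (simp add: sum_distrib_left sum_distrib_right mult_ac)
      then show ?thesis using WV[OF i] by simp
    qed
    also have "\<dots> = (\<Sum>u | u < p \<and> blk \<pi> u = t. (V $$ (r, i) * W $$ (i, u)) * (V $$ (u, i) * W $$ (i, s)))"
    proof (rule sum.mono_neutral_right)
      show "\<forall>u\<in>{..<p} - {u. u < p \<and> blk \<pi> u = t}. (V $$ (r, i) * W $$ (i, u)) * (V $$ (u, i) * W $$ (i, s)) = 0"
      proof
        fix u assume u: "u \<in> {..<p} - {u. u < p \<and> blk \<pi> u = t}"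
        then consider "blk \<pi> u < blk \<pi> r" | "blk \<pi> s < blk \<pi> u" using t by fastforce
        then show "(V $$ (r, i) * W $$ (i, u)) * (V $$ (u, i) * W $$ (i, s)) = 0"
          using P0[OF i rs(1), of u] P0[OF i _ rs(2), of u] u by cases auto
      qed
    qed auto
    also have "\<dots> = tr t i * (V $$ (r, i) * W $$ (i, s))"
      unfolding tr_def sum_distrib_right by (intro sum.cong) auto
    finally have "(1 - tr t i) * (V $$ (r, i) * W $$ (i, s)) = 0" by (simp add: algebra_simps)
    then show ?thesis using tr by simp
  qed
  have tr01: "tr t i = 0 \<or> tr t i = 1" if "i < p" for t i
  proof (cases "tr t i = 1")
    case False
    then have "V $$ (r, i) * W $$ (i, r) = 0" if "r < p" "blk \<pi> r = t" for r
      using D0[OF \<open>i < p\<close> that(1,1) that(2,2)] by simp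
    then have "tr t i = 0" unfolding tr_def by (intro sum.neutral) blast
    then show ?thesis ..
  qed auto
  have card1: "card {t. t < length \<pi> \<and> tr t i = 1} = 1" if "i < p" for i
  proof -
    have "(\<Sum>t<length \<pi>. tr t i) = (\<Sum>t | t < length \<pi> \<and> tr t i = 1. 1)"
      using tr01[OF that] by (intro sum.mono_neutral_cong_right) auto
    then have "of_nat (card {t. t < length \<pi> \<and> tr t i = 1}) = (1 :: complex)" using sum1[OF that] by simp
    then show ?thesis by (metis of_nat_1 of_nat_eq_iff)
  qed
  then have "\<exists>t. {t. t < length \<pi> \<and> tr t i = 1} = {t}" if "i < p" for i
    using that card_1_singletonE by metis
  then obtain \<beta> where \<beta>: "\<And>i. i < p \<Longrightarrow> {t. t < length \<pi> \<and> tr t i = 1} = {\<beta> i}" by metis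
  have \<beta>l: "\<beta> i < length \<pi>" if "i < p" for i using \<beta>[OF that] by blast
  have \<beta>t: "tr t i = (if t = \<beta> i then 1 else 0)" if "i < p" "t < length \<pi>" for i t
    using \<beta>[OF that(1)] tr01[OF that(1), of t] that(2) by auto
  \<comment> \<open>The projections sum to the identity because \<open>V * W\<close> is the
    identity. Taking the trace over block t gives the number of i with \<beta> i = t on one side and
    the size of the block on the other.\<close>
  have "card {i. i < p \<and> \<beta> i = t} = \<pi> ! t" if t: "t < length \<pi>" for t
  proof -
    have "of_nat (card {i. i < p \<and> \<beta> i = t}) = (\<Sum>i | i < p \<and> \<beta> i = t. (1::complex))" by simp
    also have "\<dots> = (\<Sum>i<p. tr t i)"
      using \<beta>t[OF _ t] by (intro sum.mono_neutral_cong_left) auto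
    also have "\<dots> = (\<Sum>r | r < p \<and> blk \<pi> r = t. \<Sum>i<p. V $$ (r, i) * W $$ (i, r))"
      unfolding tr_def by (rule sum.swap)
    also have "\<dots> = (\<Sum>r | r < p \<and> blk \<pi> r = t. 1)"
      using VW1 by (intro sum.cong refl) blast
    also have "\<dots> = of_nat (\<pi> ! t)" using card_blk[OF t] p by simp
    finally show ?thesis using of_nat_eq_iff by blast
  qed
  moreover have "eig_prod p Y l (others p i) $$ (r, s) = 0"
    if i: "i < p" and rs: "r < p" "s < p" "blk \<pi> r = blk \<pi> s" "blk \<pi> r \<noteq> \<beta> i" for i r s
  proof -
    have "tr (blk \<pi> s) i \<noteq> 1" using \<beta>t[OF i, of "blk \<pi> s"] rs blk(1)[of s \<pi>] p by auto
    then show ?thesis using D0[OF i rs(1,2,3) refl] G[OF i rs(1,2)] by simp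
  qed
  moreover have "\<exists>x y. \<forall>r<p. \<forall>s<p. eig_prod p Y l (others p i) $$ (r, s) = x r * y s" if "i < p" for i
    using G[OF that] by (intro exI[of _ "\<lambda>r. c i * V $$ (r, i)"] exI[of _ "\<lambda>s. W $$ (i, s)"]) simp
  ultimately show ?thesis using \<beta>l by (intro exI[of _ \<beta>]) blast
qed


text \<open>Still a nonzero multiple of the spectral projection when the \<open>l i\<close> are the
  distinct eigenvalues. The power is taken because it reveals the support from the diagonal blocks
  alone, and on the second side nothing but the diagonal blocks is known.\<close>

definition spec_pow :: "nat \<Rightarrow> cmat \<Rightarrow> (nat \<Rightarrow> complex) \<Rightarrow> nat \<Rightarrow> cmat" where
  "spec_pow p Y l i = eig_prod p Y l (others p i) ^\<^sub>m p"

definition corner :: "nat \<Rightarrow> cmat \<Rightarrow> (nat \<Rightarrow> complex) \<Rightarrow> cmat \<Rightarrow> nat \<Rightarrow> nat \<Rightarrow> cmat" where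
  "corner p Y l X i j = spec_pow p Y l i * X * spec_pow p Y l j"

lemma spec_pow_carrier [simp]: "Y \<in> carrier_mat p p \<Longrightarrow> spec_pow p Y l i \<in> carrier_mat p p"
  by (simp add: spec_pow_def)

lemma corner_carrier [simp]: "Y \<in> carrier_mat p p \<Longrightarrow> X \<in> carrier_mat p p \<Longrightarrow> corner p Y l X i j \<in> carrier_mat p p"
  unfolding corner_def by (intro mult_carrier_mat[where n = p] spec_pow_carrier)

lemma triple_entry:
  assumes "H \<in> carrier_mat p p" "X \<in> carrier_mat p p" "K \<in> carrier_mat p p" "r < p" "s < p"
  shows "(H * X * K) $$ (r, s) = (\<Sum>v<p. \<Sum>u<p. H $$ (r, u) * X $$ (u, v) * K $$ (v, s))"
proof -
  have "(H * X * K) $$ (r, s) = (\<Sum>v<p. (H * X) $$ (r, v) * K $$ (v, s))"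
    using assms by (intro mat_mult_entry) auto
  also have "\<dots> = (\<Sum>v<p. \<Sum>u<p. H $$ (r, u) * X $$ (u, v) * K $$ (v, s))"
    using mat_mult_entry[OF assms(1,2,4)] by (intro sum.cong refl) (simp add: sum_distrib_right)
  finally show ?thesis .
qed

lemma corner_entry:
  assumes "Y \<in> carrier_mat p p" "X \<in> carrier_mat p p" "r < p" "s < p"
  shows "corner p Y l X i j $$ (r, s) =
    (\<Sum>v<p. \<Sum>u<p. spec_pow p Y l i $$ (r, u) * X $$ (u, v) * spec_pow p Y l j $$ (v, s))"
  unfolding corner_def using assms by (intro triple_entry) auto

lemma rank_one_pow:
  fixes M :: cmat
  assumes M: "M \<in> carrier_mat p p" and xy: "\<forall>r<p. \<forall>s<p. M $$ (r, s) = x r * y s"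
  shows "\<exists>x. \<forall>r<p. \<forall>s<p. (M ^\<^sub>m Suc k) $$ (r, s) = x r * y s"
proof (intro exI allI impI)
  fix r s assume "r < p" "s < p"
  then show "(M ^\<^sub>m Suc k) $$ (r, s) = (\<Sum>u<p. (M ^\<^sub>m k) $$ (r, u) * x u) * y s"
    using mat_mult_entry[OF pow_carrier[OF M, of k] M] xy by (simp add: sum_distrib_right mult.assoc)
qed

text \<open>The diagonal blocks \<open>b \<noteq> \<beta> i\<close> of \<^term>\<open>eig_prod p Y l (others p i)\<close> vanish, so its high power is
  supported in rows up to, and columns from, the block \<open>\<beta> i\<close>.\<close>

lemma C_pairs_corners:
  assumes \<sigma>: "\<sigma> permutes {..<length \<pi>}" and p: "p = sum_list \<pi>" "length \<pi> \<le> p" "0 < p"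
    and matched: "\<forall>m<n. matched \<pi> \<sigma> (A m) (A' m)" and n: "0 < n"
    and eigen: "\<forall>i<p. eigenvalue (A 0) (l i)" and inj: "inj_on l {..<p}"
  shows "\<exists>\<beta>. (\<forall>i<p. \<beta> i < length \<pi>) \<and> (\<forall>t<length \<pi>. card {i. i < p \<and> \<beta> i = t} = \<pi> ! t) \<and>
    (\<forall>i<p. \<forall>j<p. \<beta> j < \<beta> i \<longrightarrow> (\<forall>m<n. corner p (A 0) l (A m) i j = 0\<^sub>m p p)) \<and>
    (\<forall>i<p. \<forall>j<p. inv_into UNIV \<sigma> (\<beta> j) < inv_into UNIV \<sigma> (\<beta> i) \<longrightarrow> (\<forall>m<n. corner p (A' 0) l (A' m) i j = 0\<^sub>m p p)) \<and>
    (\<forall>i<p. \<forall>j<p. \<beta> i = \<beta> j \<longrightarrow> (\<exists>\<kappa> a a'. \<forall>m<n. \<forall>r<p. \<forall>s<p.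
       corner p (A 0) l (A m) i j $$ (r, s) = \<kappa> m * a r s \<and>
       corner p (A' 0) l (corner p (A' 0) l (A' m) i j) i j $$ (r, s) = \<kappa> m * a' r s))"
proof -
  let ?bl = "blk \<pi>" and ?bl' = "blk (permute_list \<sigma> \<pi>)" and ?t = "block_pos \<pi> \<sigma>"
  let ?Y = "A 0" and ?Y' = "A' 0"
  note AA = matched[rule_format] and ev = eigen[rule_format]
  note A = matchedD[OF AA, folded p(1)]
  note mG = matched_eig_prod[OF \<sigma> AA[OF n], of l, folded p(1)]
  note G = matchedD[OF mG, folded p(1)]
  have mH: "matched \<pi> \<sigma> (spec_pow p ?Y l i) (spec_pow p ?Y' l i)" for i
    unfolding spec_pow_def by (rule matched_pow[OF \<sigma> mG])
  \<comment> \<open>There are at most p blocks, so a p-th power leaves no room for the alternative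
    in which every step climbs.\<close>
  have bl: "?bl r < p" "?bl' r < p" if "r < p" for r
    using blk(1)[of r \<pi>] blk_permute(1)[OF \<sigma>, of r] that p by auto
  have "\<exists>\<beta>. (\<forall>i<p. \<beta> i < length \<pi>) \<and> (\<forall>t<length \<pi>. card {i. i < p \<and> \<beta> i = t} = \<pi> ! t) \<and>
    (\<forall>i<p. (\<forall>r<p. \<forall>s<p. ?bl r = ?bl s \<longrightarrow> ?bl r \<noteq> \<beta> i \<longrightarrow> eig_prod p ?Y l (others p i) $$ (r, s) = 0) \<and>
      (\<exists>x y. \<forall>r<p. \<forall>s<p. eig_prod p ?Y l (others p i) $$ (r, s) = x r * y s))"
    by (rule spectral_blocks[OF p(1) A(1)[OF n]]) (use G(3) ev inj in auto)
  then obtain \<beta> where B: "(\<forall>i<p. \<beta> i < length \<pi>) \<and> (\<forall>t<length \<pi>. card {i. i < p \<and> \<beta> i = t} = \<pi> ! t) \<and>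
    (\<forall>i<p. (\<forall>r<p. \<forall>s<p. ?bl r = ?bl s \<longrightarrow> ?bl r \<noteq> \<beta> i \<longrightarrow> eig_prod p ?Y l (others p i) $$ (r, s) = 0) \<and>
      (\<exists>x y. \<forall>r<p. \<forall>s<p. eig_prod p ?Y l (others p i) $$ (r, s) = x r * y s))"
    by (elim exE)
  note \<beta> = B[THEN conjunct1] B[THEN conjunct2, THEN conjunct1]
  have \<beta>G: "eig_prod p ?Y l (others p i) $$ (r, s) = 0"
    if "i < p" "r < p" "s < p" "?bl r = ?bl s" "?bl r \<noteq> \<beta> i" for i r s
    using B[THEN conjunct2, THEN conjunct2] that by simp
  have rank: "\<exists>x y. \<forall>r<p. \<forall>s<p. eig_prod p ?Y l (others p i) $$ (r, s) = x r * y s" if "i < p" for i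
    using B[THEN conjunct2, THEN conjunct2] that by simp
  have t: "?t r < p" "?bl (?t r) = \<sigma> (?bl' r)" if "r < p" for r
    using block_pos[OF \<sigma>] that p by auto
  have H: "?bl r \<le> \<beta> i \<and> \<beta> i \<le> ?bl s"
    if "i < p" "r < p" "s < p" "spec_pow p ?Y l i $$ (r, s) \<noteq> 0" for i r s
  proof -
    have "?bl r \<le> ?bl s \<and> (?bl r \<le> \<beta> i \<and> \<beta> i \<le> ?bl s \<or> ?bl r + p \<le> ?bl s)"
      by (rule pow_block_support[OF G(1) G(3) \<beta>G[OF that(1)] that(2,3) that(4)[unfolded spec_pow_def]])
    then show ?thesis using bl(1)[OF that(3)] by linarith
  qed
  \<comment> \<open>The diagonal blocks on the second side are copies of those on the first, so all
    of them vanish except the one at the position of \<beta> i in \<sigma>(\<pi>).\<close>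
  have \<beta>G': "eig_prod p ?Y' l (others p i) $$ (r, s) = 0"
    if "i < p" "r < p" "s < p" "?bl' r = ?bl' s" "?bl' r \<noteq> inv_into UNIV \<sigma> (\<beta> i)" for i r s
  proof -
    have "\<sigma> (?bl' r) \<noteq> \<beta> i" using that(5) permutes_inverses(2)[OF \<sigma>, of "?bl' r"] by auto
    then have "eig_prod p ?Y l (others p i) $$ (?t r, ?t s) = 0"
      using t[OF that(2)] t[OF that(3)] that(4) by (intro \<beta>G[OF that(1)]) auto
    then show ?thesis unfolding G(5)[OF that(2,3,4)] .
  qed
  have H': "?bl' r \<le> inv_into UNIV \<sigma> (\<beta> i) \<and> inv_into UNIV \<sigma> (\<beta> i) \<le> ?bl' s"
    if "i < p" "r < p" "s < p" "spec_pow p ?Y' l i $$ (r, s) \<noteq> 0" for i r s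
  proof -
    have "?bl' r \<le> ?bl' s \<and> (?bl' r \<le> inv_into UNIV \<sigma> (\<beta> i) \<and> inv_into UNIV \<sigma> (\<beta> i) \<le> ?bl' s \<or> ?bl' r + p \<le> ?bl' s)"
      by (rule pow_block_support[OF G(2) G(4) \<beta>G'[OF that(1)] that(2,3) that(4)[unfolded spec_pow_def]])
    then show ?thesis using bl(2)[OF that(3)] by linarith
  qed
  have "corner p ?Y l (A m) i j = 0\<^sub>m p p" if ij: "i < p" "j < p" "\<beta> j < \<beta> i" and m: "m < n" for i j m
  proof (rule eq_matI)
    fix r s assume "r < dim_row (0\<^sub>m p p :: cmat)" "s < dim_col (0\<^sub>m p p :: cmat)"
    then have rs: "r < p" "s < p" by auto
    have "spec_pow p ?Y l i $$ (r, u) * A m $$ (u, v) * spec_pow p ?Y l j $$ (v, s) = 0" if "u < p" "v < p" for u v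
      using H[OF ij(1) rs(1) that(1)] H[OF ij(2) that(2) rs(2)] A(3)[OF m that] ij(3) by fastforce
    then show "corner p ?Y l (A m) i j $$ (r, s) = 0\<^sub>m p p $$ (r, s)"
      using rs unfolding corner_entry[OF A(1)[OF n] A(1)[OF m] rs] by (auto intro!: sum.neutral)
  qed (use corner_carrier[OF A(1)[OF n] A(1)[OF m], of l i j] in auto)
  moreover have "corner p ?Y' l (A' m) i j = 0\<^sub>m p p"
    if ij: "i < p" "j < p" "inv_into UNIV \<sigma> (\<beta> j) < inv_into UNIV \<sigma> (\<beta> i)" and m: "m < n" for i j m
  proof (rule eq_matI)
    fix r s assume "r < dim_row (0\<^sub>m p p :: cmat)" "s < dim_col (0\<^sub>m p p :: cmat)"
    then have rs: "r < p" "s < p" by auto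
    have "spec_pow p ?Y' l i $$ (r, u) * A' m $$ (u, v) * spec_pow p ?Y' l j $$ (v, s) = 0" if "u < p" "v < p" for u v
      using H'[OF ij(1) rs(1) that(1)] H'[OF ij(2) that(2) rs(2)] A(4)[OF m that] ij(3) by fastforce
    then show "corner p ?Y' l (A' m) i j $$ (r, s) = 0\<^sub>m p p $$ (r, s)"
      using rs unfolding corner_entry[OF A(2)[OF n] A(2)[OF m] rs] by (auto intro!: sum.neutral)
  qed (use corner_carrier[OF A(2)[OF n] A(2)[OF m], of l i j] in auto)
  moreover have "\<exists>\<kappa> a a'. \<forall>m<n. \<forall>r<p. \<forall>s<p.
       corner p ?Y l (A m) i j $$ (r, s) = \<kappa> m * a r s \<and>
       corner p ?Y' l (corner p ?Y' l (A' m) i j) i j $$ (r, s) = \<kappa> m * a' r s"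
    if ij: "i < p" "j < p" "\<beta> i = \<beta> j" for i j
  proof -
    have pS: "Suc (p - 1) = p" using p(3) by simp
    obtain x0 y where xy0: "\<forall>r<p. \<forall>s<p. eig_prod p ?Y l (others p i) $$ (r, s) = x0 r * y s"
      using rank[OF ij(1)] by blast
    obtain x where xy: "\<forall>r<p. \<forall>s<p. spec_pow p ?Y l i $$ (r, s) = x r * y s"
      using rank_one_pow[OF G(1) xy0, of "p - 1"] unfolding pS spec_pow_def by blast
    obtain z0 w where zw0: "\<forall>r<p. \<forall>s<p. eig_prod p ?Y l (others p j) $$ (r, s) = z0 r * w s"
      using rank[OF ij(2)] by blast
    obtain z where zw: "\<forall>r<p. \<forall>s<p. spec_pow p ?Y l j $$ (r, s) = z r * w s"
      using rank_one_pow[OF G(1) zw0, of "p - 1"] unfolding pS spec_pow_def by blast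
    \<comment> \<open>With the two powers written as \<open>x y\<^sup>T\<close> and
      \<open>z w\<^sup>T\<close>, the corner of \<open>A m\<close> is the scalar
      \<open>y\<^sup>T A\<^sub>m z\<close> times \<open>x w\<^sup>T\<close>, and the second factor
      does not depend on m.\<close>
    define \<kappa> where "\<kappa> m = (\<Sum>v<p. \<Sum>u<p. y u * A m $$ (u, v) * z v)" for m
    define a where "a r s = x r * w s" for r s
    \<comment> \<open>The inner corner on the second side vanishes below the diagonal blocks, its
      entries above them are killed by the outer powers since \<beta> i = \<beta> j, and its
      diagonal blocks are copied from the first side. What remains is \<kappa> m times a matrix
      independent of m.\<close>
    define a' where "a' r s = (\<Sum>v<p. \<Sum>u<p. spec_pow p ?Y' l i $$ (r, u) *
      (if ?bl' u = ?bl' v then a (?t u) (?t v) else 0) * spec_pow p ?Y' l j $$ (v, s))" for r s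
    have 1: "corner p ?Y l (A m) i j $$ (r, s) = \<kappa> m * a r s" if m: "m < n" and rs: "r < p" "s < p" for m r s
      unfolding corner_entry[OF A(1)[OF n] A(1)[OF m] rs] \<kappa>_def a_def sum_distrib_right
      by (intro sum.cong refl) (use xy zw rs in simp)
    have 2: "corner p ?Y' l (corner p ?Y' l (A' m) i j) i j $$ (r, s) = \<kappa> m * a' r s"
      if m: "m < n" and rs: "r < p" "s < p" for m r s
    proof -
      let ?K = "corner p ?Y' l (A' m) i j"
      have K: "matched \<pi> \<sigma> (corner p ?Y l (A m) i j) ?K"
        unfolding corner_def by (intro matched_mult \<sigma> mH AA m)
      have "spec_pow p ?Y' l i $$ (r, u) * ?K $$ (u, v) * spec_pow p ?Y' l j $$ (v, s) =
        \<kappa> m * (spec_pow p ?Y' l i $$ (r, u) * (if ?bl' u = ?bl' v then a (?t u) (?t v) else 0) * spec_pow p ?Y' l j $$ (v, s))"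
        if uv: "u < p" "v < p" for u v
      proof (cases "?bl' u = ?bl' v")
        case True
        have "?K $$ (u, v) = \<kappa> m * a (?t u) (?t v)"
          using matchedD(5)[OF K, folded p(1), OF uv True] 1[OF m t(1)[OF uv(1)] t(1)[OF uv(2)]] by simp
        then show ?thesis using True by simp
      next
        case False
        then consider "?bl' v < ?bl' u" | "?bl' u < ?bl' v" by linarith
        then have "spec_pow p ?Y' l i $$ (r, u) * ?K $$ (u, v) * spec_pow p ?Y' l j $$ (v, s) = 0"
        proof cases
          case 1
          then show ?thesis using matchedD(4)[OF K, folded p(1), OF uv] by simp
        next
          case 2
          then show ?thesis using H'[OF ij(1) rs(1) uv(1)] H'[OF ij(2) uv(2) rs(2)] ij(3) by fastforce
        qed
        then show ?thesis using False by simp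
      qed
      then show ?thesis
        unfolding corner_entry[OF A(2)[OF n] corner_carrier[OF A(2)[OF n] A(2)[OF m]] rs] a'_def sum_distrib_left
        by (intro sum.cong refl) simp
    qed
    show ?thesis using 1 2 by blast
  qed
  ultimately show ?thesis using \<beta> by (intro exI[of _ \<beta>]) blast
qed

section \<open>Closed conditions on an orbit closure\<close>

lemma conj_mult:
  fixes g :: cmat
  assumes "g \<in> carrier_mat p p" "h \<in> carrier_mat p p" "h * g = 1\<^sub>m p" "X \<in> carrier_mat p p" "Z \<in> carrier_mat p p"
  shows "(g * X * h) * (g * Z * h) = g * (X * Z) * h"
proof -
  note ass = assoc_mult_mat[where n\<^sub>1=p and n\<^sub>2=p and n\<^sub>3=p and n\<^sub>4=p]
  have "(g * X * h) * (g * Z * h) = g * X * (h * g) * Z * h" using assms(1,2,4,5) by (simp add: ass)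
  also have "\<dots> = g * (X * Z) * h" using assms by (simp add: ass)
  finally show ?thesis .
qed

lemma conj_pow:
  fixes g :: cmat
  assumes "g \<in> carrier_mat p p" "h \<in> carrier_mat p p" "g * h = 1\<^sub>m p" "h * g = 1\<^sub>m p" "X \<in> carrier_mat p p"
  shows "(g * X * h) ^\<^sub>m N = g * X ^\<^sub>m N * h"
proof (induction N)
  case 0
  then show ?case using assms by simp
next
  case (Suc N)
  then show ?case using conj_mult[OF assms(1,2,4) pow_carrier[OF assms(5), of N] assms(5)] by simp
qed

lemma conj_eig_prod:
  fixes g :: cmat
  assumes g: "g \<in> carrier_mat p p" "h \<in> carrier_mat p p" "g * h = 1\<^sub>m p" "h * g = 1\<^sub>m p" and Y: "Y \<in> carrier_mat p p"
  shows "eig_prod p (g * Y * h) l js = g * eig_prod p Y l js * h"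
proof (induction js)
  case Nil
  then show ?case using g by (simp add: eig_prod_simps)
next
  case (Cons j js)
  let ?c = "(- l j) \<cdot>\<^sub>m 1\<^sub>m p"
  have "g * Y * h + ?c = g * Y * h + g * ?c * h" using scalar_mat_conj[OF g(1,2,3)] by simp
  also have "\<dots> = g * (Y + ?c) * h"
    using g(1,2) Y by (simp add: mult_add_distrib_mat[where nr=p and n=p and nc=p] add_mult_distrib_mat[where nr=p and n=p and nc=p])
  finally have "g * Y * h + ?c = g * (Y + ?c) * h" .
  then show ?case
    using conj_mult[OF g(1,2,4), of "Y + ?c" "eig_prod p Y l js"] Y by (simp only: eig_prod_simps Cons) simp
qed

lemma conj_corner:
  fixes g :: cmat
  assumes g: "g \<in> carrier_mat p p" "h \<in> carrier_mat p p" "g * h = 1\<^sub>m p" "h * g = 1\<^sub>m p"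
    and Y: "Y \<in> carrier_mat p p" and X: "X \<in> carrier_mat p p"
  shows "corner p (g * Y * h) l (g * X * h) i j = g * corner p Y l X i j * h"
proof -
  have "spec_pow p (g * Y * h) l i = g * spec_pow p Y l i * h" for i
    unfolding spec_pow_def conj_eig_prod[OF assms(1-5)] using conj_pow[OF g] Y by simp
  moreover have "spec_pow p Y l i \<in> carrier_mat p p" for i using Y by simp
  ultimately show ?thesis unfolding corner_def
    using conj_mult[OF g(1,2,4), of "spec_pow p Y l i" X]
      conj_mult[OF g(1,2,4), of "spec_pow p Y l i * X" "spec_pow p Y l j"] X
    by (simp add: mult_carrier_mat[where n = p])
qed

section \<open>Polynomial relations between the corners\<close>

definition corner1 where
  "corner1 p m i j x l = corner p (coord_mat p (fst x) 0) l (coord_mat p (fst x) m) i j"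

definition corner2 where
  "corner2 p m i j x l = corner p (coord_mat p (snd x) 0) l (coord_mat p (snd x) m) i j"

text \<open>On the second side only the diagonal blocks are known. Cutting out the corner twice makes the
  result depend on the inner corner only through its diagonal block.\<close>

definition corner22 where
  "corner22 p m i j x l = corner p (coord_mat p (snd x) 0) l (corner2 p m i j x l) i j"

lemma corner_dims:
  "dim_row (corner1 p m i j x l) = p" "dim_col (corner1 p m i j x l) = p"
  "dim_row (corner2 p m i j x l) = p" "dim_col (corner2 p m i j x l) = p"
  using corner_carrier[OF coord_mat_carrier[of p "fst x" 0] coord_mat_carrier[of p "fst x" m], of l i j]
    corner_carrier[OF coord_mat_carrier[of p "snd x" 0] coord_mat_carrier[of p "snd x" m], of l i j]
  unfolding corner1_def corner2_def by (simp_all only: carrier_matD)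

text \<open>The equality of ratios is cross-multiplied, so that it is polynomial and makes sense for
  vanishing corners. Every entry of one side is paired with every entry of the other, since the
  independent conjugations leave no correspondence between positions. Here \<rho> stands for the
  inverse of \<sigma>: it gives the place of a block in \<sigma>(\<pi>).\<close>

definition corner_relations where
  "corner_relations p \<rho> \<beta> x l \<longleftrightarrow>
    (\<forall>i<p. \<forall>j<p. \<beta> j < \<beta> i \<longrightarrow> corner1 p 1 i j x l = 0\<^sub>m p p) \<and>
    (\<forall>i<p. \<forall>j<p. \<rho> (\<beta> j) < \<rho> (\<beta> i) \<longrightarrow> corner2 p 1 i j x l = 0\<^sub>m p p) \<and>
    (\<forall>i<p. \<forall>j<p. \<beta> i = \<beta> j \<longrightarrow> (\<forall>r<p. \<forall>s<p. \<forall>r'<p. \<forall>s'<p.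
       corner1 p 1 i j x l $$ (r, s) * corner22 p 2 i j x l $$ (r', s') =
       corner1 p 2 i j x l $$ (r, s) * corner22 p 1 i j x l $$ (r', s')))"

definition block_type where
  "block_type p \<pi> \<beta> \<longleftrightarrow> (\<forall>i<p. \<beta> i < length \<pi>) \<and> (\<forall>t<length \<pi>. card {i. i < p \<and> \<beta> i = t} = \<pi> ! t)"

text \<open>Corners are equivariant under conjugation. As conjugation is linear, both the vanishing
  of a corner and the common scalar \<kappa> m survive it, while the eigenvalues do not
  change.\<close>

lemma orbit_corner_relations:
  assumes \<sigma>: "\<sigma> permutes {..<length \<pi>}" and p: "p = sum_list \<pi>" "length \<pi> \<le> p" "0 < p" and n: "3 \<le> n"
    and x: "x \<in> G2_orbit p (C_pairs p n \<pi> \<sigma>)"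
    and ev: "\<forall>i<p. eigenvalue (coord_mat p (fst x) 0) (l i)" and inj: "inj_on l {..<p}"
  shows "\<exists>\<beta>. block_type p \<pi> \<beta> \<and> corner_relations p (inv_into UNIV \<sigma>) \<beta> x l"
proof -
  obtain g h A A' where g: "g \<in> GL p" and h: "h \<in> GL p" and AA: "(A, A') \<in> C_pairs p n \<pi> \<sigma>"
    and xeq: "x = (conj_tuple g A, conj_tuple h A')"
    using x by (auto simp: G2_orbit_def)
  have len: "length A = n" "length A' = n" and m: "\<forall>m<n. matched \<pi> \<sigma> (A ! m) (A' ! m)"
    using AA C_pairs_iff[OF \<sigma> p(1)[symmetric]] by auto
  note car = matchedD(1,2)[OF m[rule_format], folded p(1)]
  let ?g = "the (mat_inverse g)" and ?h = "the (mat_inverse h)"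
  have gc: "g \<in> carrier_mat p p" "h \<in> carrier_mat p p" using g h by (auto simp: GL_iff)
  note gi = GL_inverse[OF g] and hi = GL_inverse[OF h]
  have c1: "coord_mat p (fst x) i = g * A ! i * ?g" if "i < n" for i
    using coord_mat_eq[of "conj_tuple g A" i p] that len gc gi(1) car[OF that]
    by (simp add: xeq conj_tuple_def mult_carrier_mat[where n = p])
  have c2: "coord_mat p (snd x) i = h * A' ! i * ?h" if "i < n" for i
    using coord_mat_eq[of "conj_tuple h A'" i p] that len gc hi(1) car[OF that]
    by (simp add: xeq conj_tuple_def mult_carrier_mat[where n = p])
  have n0: "0 < n" "1 < n" "2 < n" using n by auto
  have ev0: "\<forall>i<p. eigenvalue (A ! 0) (l i)"
  proof (intro allI impI)
    fix i assume that: "i < p"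
    have "similar_mat (coord_mat p (fst x) 0) (A ! 0)"
      unfolding similar_mat_def c1[OF n0(1)]
      using gc gi car[OF n0(1)] by (intro exI[of _ g] exI[of _ ?g] similar_mat_witI[of _ _ p]) auto
    then have "char_poly (coord_mat p (fst x) 0) = char_poly (A ! 0)" by (rule char_poly_similar)
    then show "eigenvalue (A ! 0) (l i)"
      using ev[rule_format, OF that] eigenvalue_root_char_poly[OF car(1)[OF n0(1)]] eigenvalue_root_char_poly[OF coord_mat_carrier]
      by metis
  qed
  let ?\<rho> = "inv_into UNIV \<sigma>"
  obtain \<beta> where \<beta>: "(\<forall>i<p. \<beta> i < length \<pi>) \<and> (\<forall>t<length \<pi>. card {i. i < p \<and> \<beta> i = t} = \<pi> ! t) \<and>
    (\<forall>i<p. \<forall>j<p. \<beta> j < \<beta> i \<longrightarrow> (\<forall>m<n. corner p (A ! 0) l (A ! m) i j = 0\<^sub>m p p)) \<and>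
    (\<forall>i<p. \<forall>j<p. ?\<rho> (\<beta> j) < ?\<rho> (\<beta> i) \<longrightarrow> (\<forall>m<n. corner p (A' ! 0) l (A' ! m) i j = 0\<^sub>m p p)) \<and>
    (\<forall>i<p. \<forall>j<p. \<beta> i = \<beta> j \<longrightarrow> (\<exists>\<kappa> a a'. \<forall>m<n. \<forall>r<p. \<forall>s<p.
       corner p (A ! 0) l (A ! m) i j $$ (r, s) = \<kappa> m * a r s \<and>
       corner p (A' ! 0) l (corner p (A' ! 0) l (A' ! m) i j) i j $$ (r, s) = \<kappa> m * a' r s))"
    using C_pairs_corners[where A = "(!) A" and A' = "(!) A'", OF \<sigma> p m n0(1) ev0 inj] by (elim exE)
  note \<beta>1 = \<beta>[THEN conjunct2, THEN conjunct2, THEN conjunct1, rule_format]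
  note \<beta>2 = \<beta>[THEN conjunct2, THEN conjunct2, THEN conjunct2, THEN conjunct1, rule_format]
  note \<beta>3 = \<beta>[THEN conjunct2, THEN conjunct2, THEN conjunct2, THEN conjunct2, rule_format]
  have k1: "corner1 p m i j x l = g * corner p (A ! 0) l (A ! m) i j * ?g" if "m < n" for m i j
    unfolding corner1_def c1[OF n0(1)] c1[OF that]
    by (rule conj_corner[OF gc(1) gi car(1)[OF n0(1)] car(1)[OF that]])
  have k2: "corner2 p m i j x l = h * corner p (A' ! 0) l (A' ! m) i j * ?h" if "m < n" for m i j
    unfolding corner2_def c2[OF n0(1)] c2[OF that]
    by (rule conj_corner[OF gc(2) hi car(2)[OF n0(1)] car(2)[OF that]])
  have k22: "corner22 p m i j x l = h * corner p (A' ! 0) l (corner p (A' ! 0) l (A' ! m) i j) i j * ?h" if "m < n" for m i j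
    unfolding corner22_def k2[OF that] c2[OF n0(1)]
    by (rule conj_corner[OF gc(2) hi car(2)[OF n0(1)]]) (rule corner_carrier[OF car(2)[OF n0(1)] car(2)[OF that]])
  have "corner1 p 1 i j x l = 0\<^sub>m p p" if "i < p" "j < p" "\<beta> j < \<beta> i" for i j
    unfolding k1[OF n0(2)] \<beta>1[OF that n0(2)] using gc gi by simp
  moreover have "corner2 p 1 i j x l = 0\<^sub>m p p" if "i < p" "j < p" "?\<rho> (\<beta> j) < ?\<rho> (\<beta> i)" for i j
    unfolding k2[OF n0(2)] \<beta>2[OF that n0(2)] using gc hi by simp
  moreover have "corner1 p 1 i j x l $$ (r, s) * corner22 p 2 i j x l $$ (r', s') =
       corner1 p 2 i j x l $$ (r, s) * corner22 p 1 i j x l $$ (r', s')"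
    if ij: "i < p" "j < p" "\<beta> i = \<beta> j" and rs: "r < p" "s < p" "r' < p" "s' < p" for i j r s r' s'
  proof -
    obtain \<kappa> a a' where \<kappa>: "\<forall>m<n. \<forall>r<p. \<forall>s<p.
       corner p (A ! 0) l (A ! m) i j $$ (r, s) = \<kappa> m * a r s \<and>
       corner p (A' ! 0) l (corner p (A' ! 0) l (A' ! m) i j) i j $$ (r, s) = \<kappa> m * a' r s"
      using \<beta>3[OF ij] by (elim exE)
    have 1: "corner1 p m i j x l $$ (r, s) = \<kappa> m * (\<Sum>v<p. \<Sum>u<p. g $$ (r, u) * a u v * ?g $$ (v, s))" if "m < n" for m
      unfolding k1[OF that] triple_entry[OF gc(1) corner_carrier[OF car(1)[OF n0(1)] car(1)[OF that]] gi(1) rs(1,2)]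
        sum_distrib_left
      by (intro sum.cong refl) (use \<kappa> that in simp)
    have 2: "corner22 p m i j x l $$ (r', s') = \<kappa> m * (\<Sum>v<p. \<Sum>u<p. h $$ (r', u) * a' u v * ?h $$ (v, s'))" if "m < n" for m
      unfolding k22[OF that] triple_entry[OF gc(2) corner_carrier[OF car(2)[OF n0(1)] corner_carrier[OF car(2)[OF n0(1)] car(2)[OF that]]] hi(1) rs(3,4)]
        sum_distrib_left
      by (intro sum.cong refl) (use \<kappa> that in simp)
    show ?thesis unfolding 1[OF n0(2)] 1[OF n0(3)] 2[OF n0(2)] 2[OF n0(3)] by (simp add: mult_ac)
  qed
  ultimately have "corner_relations p ?\<rho> \<beta> x l" unfolding corner_relations_def by (intro conjI allI impI)
  moreover have "block_type p \<pi> \<beta>" using \<beta> unfolding block_type_def by (intro conjI) (elim conjE, assumption)+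
  ultimately show ?thesis by (intro exI conjI)
qed

lemma eig_mats_eig_prod:
  assumes Y: "(\<lambda>x l. Y x) \<in> eig_mats p n m" and js: "set js \<subseteq> {..<m}"
  shows "(\<lambda>x l. eig_prod p (Y x) l js) \<in> eig_mats p n m"
  using js
proof (induction js)
  case Nil
  then show ?case using eig_mats_one by (simp only: eig_prod_simps)
next
  case (Cons j js)
  have "(\<lambda>x l. - l j) \<in> eig_functions p n m"
    using eig_functions_diff[OF eig_functions_const[of 0] eig_functions.eig[of j m p n]] Cons.prems by simp
  then show ?case unfolding eig_prod_simps
    using Cons by (intro eig_mats_mult eig_mats_add Y eig_mats_smult eig_mats_one) simp_all
qed

lemma eig_mats_corner:
  assumes "(\<lambda>x l. Y x) \<in> eig_mats p n p" "X \<in> eig_mats p n p" 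
  shows "(\<lambda>x l. corner p (Y x) l (X x l) i j) \<in> eig_mats p n p"
proof -
  have "set (others p i) \<subseteq> {..<p}" for i by auto
  then show ?thesis unfolding corner_def spec_pow_def
    by (intro eig_mats_mult eig_mats_pow eig_mats_eig_prod assms)
qed

lemma eig_mats_corners:
  assumes "0 < n" "m < n"
  shows "corner1 p m i j \<in> eig_mats p n p" "corner2 p m i j \<in> eig_mats p n p" "corner22 p m i j \<in> eig_mats p n p"
proof -
  show "corner1 p m i j \<in> eig_mats p n p"
    using eig_mats_corner[OF eig_mats_coord(1)[OF assms(1)] eig_mats_coord(1)[OF assms(2)]]
    by (simp only: corner1_def[abs_def])
  show 2: "corner2 p m i j \<in> eig_mats p n p"
    using eig_mats_corner[OF eig_mats_coord(2)[OF assms(1)] eig_mats_coord(2)[OF assms(2)]]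
    by (simp only: corner2_def[abs_def])
  show "corner22 p m i j \<in> eig_mats p n p"
    using eig_mats_corner[OF eig_mats_coord(2)[OF assms(1)] 2]
    by (simp only: corner22_def[abs_def])
qed

text \<open>The relations are a system of equations in \<open>eig_functions\<close>, so one violated
  equation witnesses their failure. One function per \<beta> is what the product over all \<beta>
  calls for.\<close>

lemma corner_relations_detect:
  assumes n: "3 \<le> n" and a: "\<not> corner_relations p \<rho> \<beta> a l0"
  shows "\<exists>f. f \<in> eig_functions p n p \<and> f a l0 \<noteq> 0 \<and> (\<forall>x l. corner_relations p \<rho> \<beta> x l \<longrightarrow> f x l = 0)"
proof -
  have n0: "0 < n" "1 < n" "2 < n" using n by auto
  note C = eig_mats_corners[OF n0(1)]
  show ?thesis
  proof (rule ccontr)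
    assume neg: "\<not> ?thesis"
    have H: "f a l0 = 0" if "f \<in> eig_functions p n p" "\<And>x l. corner_relations p \<rho> \<beta> x l \<Longrightarrow> f x l = 0" for f
      using neg that by metis
    have "corner1 p 1 i j a l0 = 0\<^sub>m p p" if ij: "i < p" "j < p" "\<beta> j < \<beta> i" for i j
    proof (rule eq_matI)
      fix r s assume "r < dim_row (0\<^sub>m p p :: cmat)" "s < dim_col (0\<^sub>m p p :: cmat)"
      then have rs: "r < p" "s < p" by auto
      have "corner1 p 1 i j x l $$ (r, s) = 0" if "corner_relations p \<rho> \<beta> x l" for x l
        using that[unfolded corner_relations_def, THEN conjunct1, rule_format, OF ij] rs by simp
      then show "corner1 p 1 i j a l0 $$ (r, s) = 0\<^sub>m p p $$ (r, s)"
        using H[OF eig_matsD(2)[OF C(1)[OF n0(2)] rs]] rs by simp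
    qed (simp_all add: corner_dims)
    moreover have "corner2 p 1 i j a l0 = 0\<^sub>m p p" if ij: "i < p" "j < p" "\<rho> (\<beta> j) < \<rho> (\<beta> i)" for i j
    proof (rule eq_matI)
      fix r s assume "r < dim_row (0\<^sub>m p p :: cmat)" "s < dim_col (0\<^sub>m p p :: cmat)"
      then have rs: "r < p" "s < p" by auto
      have "corner2 p 1 i j x l $$ (r, s) = 0" if "corner_relations p \<rho> \<beta> x l" for x l
        using that[unfolded corner_relations_def, THEN conjunct2, THEN conjunct1, rule_format, OF ij] rs by simp
      then show "corner2 p 1 i j a l0 $$ (r, s) = 0\<^sub>m p p $$ (r, s)"
        using H[OF eig_matsD(2)[OF C(2)[OF n0(2)] rs]] rs by simp
    qed (simp_all add: corner_dims)
    moreover have "corner1 p 1 i j a l0 $$ (r, s) * corner22 p 2 i j a l0 $$ (r', s') =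
        corner1 p 2 i j a l0 $$ (r, s) * corner22 p 1 i j a l0 $$ (r', s')"
      if ij: "i < p" "j < p" "\<beta> i = \<beta> j" and rs: "r < p" "s < p" "r' < p" "s' < p" for i j r s r' s'
    proof -
      let ?f = "\<lambda>x l. corner1 p 1 i j x l $$ (r, s) * corner22 p 2 i j x l $$ (r', s') -
        corner1 p 2 i j x l $$ (r, s) * corner22 p 1 i j x l $$ (r', s')"
      have "?f \<in> eig_functions p n p"
        by (intro eig_functions_diff eig_functions.mult eig_matsD(2)[OF C(1)] eig_matsD(2)[OF C(3)] n0 rs)
      moreover have "?f x l = 0" if "corner_relations p \<rho> \<beta> x l" for x l
        using that[unfolded corner_relations_def, THEN conjunct2, THEN conjunct2, rule_format, OF ij rs] by simp
      ultimately have "?f a l0 = 0" by (rule H)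
      then show ?thesis by simp
    qed
    ultimately have "corner_relations p \<rho> \<beta> a l0" unfolding corner_relations_def by (intro conjI allI impI)
    then show False using a by simp
  qed
qed

text \<open>If every block type failed at \<open>a\<close>, there would be one violated equation for
  each. On the orbit their product, multiplied by all differences \<open>l i - l j\<close>, vanishes
  for every choice of eigenvalues: repeated ones kill a difference, and distinct ones determine a
  \<beta> whose equation holds. Then it would vanish at \<open>a\<close> too, where all its factors
  are nonzero.\<close>

lemma closure_corner_relations:
  assumes \<sigma>: "\<sigma> permutes {..<length \<pi>}" and p: "p = sum_list \<pi>" "length \<pi> \<le> p" "0 < p" and n: "3 \<le> n"
    and a: "a \<in> zariski_closure p n (G2_orbit p (C_pairs p n \<pi> \<sigma>))"
    and Y: "upper_triangular (coord_mat p (fst a) 0)"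
    and l0: "\<And>i. i < p \<Longrightarrow> \<exists>r<p. l0 i = coord_mat p (fst a) 0 $$ (r, r)" and inj: "inj_on l0 {..<p}"
  shows "\<exists>\<beta>. block_type p \<pi> \<beta> \<and> corner_relations p (inv_into UNIV \<sigma>) \<beta> a l0"
proof (rule ccontr)
  assume neg: "\<not> ?thesis"
  let ?\<rho> = "inv_into UNIV \<sigma>"
  \<comment> \<open>Extensional functions keep the set finite. The relations read \<beta> only below
    p, so the \<beta> found at a point of the orbit may be replaced by its restriction.\<close>
  define B where "B = {\<beta> \<in> {..<p} \<rightarrow>\<^sub>E {..<length \<pi>}. block_type p \<pi> \<beta>}"
  have "finite ({..<p} \<rightarrow>\<^sub>E {..<length \<pi>})" by (rule finite_PiE) simp_all
  then have fin: "finite B" unfolding B_def by (rule rev_finite_subset) blast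
  have "\<forall>\<beta>\<in>B. \<exists>f. f \<in> eig_functions p n p \<and> f a l0 \<noteq> 0 \<and> (\<forall>x l. corner_relations p ?\<rho> \<beta> x l \<longrightarrow> f x l = 0)"
  proof
    fix \<beta> assume "\<beta> \<in> B"
    then have "block_type p \<pi> \<beta>" unfolding B_def by simp
    then have "\<not> corner_relations p ?\<rho> \<beta> a l0" using neg by (metis (no_types))
    then show "\<exists>f. f \<in> eig_functions p n p \<and> f a l0 \<noteq> 0 \<and> (\<forall>x l. corner_relations p ?\<rho> \<beta> x l \<longrightarrow> f x l = 0)"
      by (rule corner_relations_detect[OF n])
  qed
  then obtain f where f: "\<forall>\<beta>\<in>B. f \<beta> \<in> eig_functions p n p \<and> f \<beta> a l0 \<noteq> 0 \<and> (\<forall>x l. corner_relations p ?\<rho> \<beta> x l \<longrightarrow> f \<beta> x l = 0)"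
    by (rule bchoice[THEN exE])
  let ?D = "{(i, j). i < p \<and> j < p \<and> i \<noteq> j}"
  have finD: "finite ?D" by (rule finite_subset[of _ "{..<p} \<times> {..<p}"]) auto
  let ?F = "\<lambda>x l. (\<Prod>d\<in>?D. l (fst d) - l (snd d)) * (\<Prod>\<beta>\<in>B. f \<beta> x l)"
  have "?F a l0 = 0"
  proof (rule closure_eig_functions[where f = ?F, OF _ G2_orbit_C_pairs_subset a Y])
    show "0 < n" using n by simp
    show "?F \<in> eig_functions p n p"
    proof (rule eig_functions.mult)
      have "(\<lambda>x l. l (fst d) - l (snd d)) \<in> eig_functions p n p" if "d \<in> ?D" for d
        using that by (intro eig_functions_diff eig_functions.eig) auto
      then show "(\<lambda>x l. \<Prod>d\<in>?D. l (fst d) - l (snd d)) \<in> eig_functions p n p"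
        by (rule eig_functions_prod[OF finD, of "\<lambda>d x l. l (fst d) - l (snd d)"])
      show "(\<lambda>x l. \<Prod>\<beta>\<in>B. f \<beta> x l) \<in> eig_functions p n p"
        by (rule eig_functions_prod[OF fin, of f]) (use f in blast)
    qed
    show "\<exists>r<p. l0 i = coord_mat p (fst a) 0 $$ (r, r)" if "i < p" for i using l0[OF that] .
    fix s l assume s: "s \<in> G2_orbit p (C_pairs p n \<pi> \<sigma>)"
      and l: "\<And>i. i < p \<Longrightarrow> eigenvalue (coord_mat p (fst s) 0) (l i)"
    show "?F s l = 0"
    proof (cases "inj_on l {..<p}")
      case False
      then obtain i j where "i < p" "j < p" "i \<noteq> j" "l i = l j" by (auto simp: inj_on_def)
      then have "(i, j) \<in> ?D" "l (fst (i, j)) - l (snd (i, j)) = 0" by auto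
      then have "(\<Prod>d\<in>?D. l (fst d) - l (snd d)) = 0" by (intro prod_zero[OF finD] bexI)
      then show ?thesis by simp
    next
      case True
      have "\<forall>i<p. eigenvalue (coord_mat p (fst s) 0) (l i)" using l by simp
      note ex = orbit_corner_relations[OF \<sigma> p n s this True]
      obtain \<beta> where \<beta>: "block_type p \<pi> \<beta>" "corner_relations p ?\<rho> \<beta> s l"
        using ex by (elim exE conjE)
      let ?b = "restrict \<beta> {..<p}"
      have bt: "block_type p \<pi> ?b"
        using \<beta>(1) unfolding block_type_def by (simp cong: conj_cong)
      then have "?b \<in> B" unfolding B_def by (auto simp: block_type_def)
      moreover have "corner_relations p ?\<rho> ?b s l"
        using \<beta>(2) unfolding corner_relations_def by simp
      ultimately have "f ?b s l = 0" using f by blast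
      then have "(\<Prod>\<beta>\<in>B. f \<beta> s l) = 0" using \<open>?b \<in> B\<close> by (intro prod_zero[OF fin] bexI)
      then show ?thesis by simp
    qed
  qed
  moreover have "(\<Prod>\<beta>\<in>B. f \<beta> a l0) \<noteq> 0" using f fin by (simp add: prod_zero_iff)
  moreover have "(\<Prod>d\<in>?D. l0 (fst d) - l0 (snd d)) \<noteq> 0"
    using inj finD by (auto simp: prod_zero_iff inj_on_def)
  ultimately show False by simp
qed

section \<open>Merging blocks monotonically\<close>

text \<open>Every step gains at least one. Counting from 0 gives \<open>t \<le> m t\<close>,
  counting back from k - 1 gives \<open>m t \<le> t\<close>.\<close>

lemma strictly_increasing_self_map:
  fixes m :: "nat \<Rightarrow> nat"
  assumes range: "\<And>t. t < k \<Longrightarrow> m t < k" and step: "\<And>t. Suc t < k \<Longrightarrow> m t < m (Suc t)" and t: "t < k"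
  shows "m t = t"
proof -
  have add: "m s + d \<le> m (s + d)" if "s + d < k" for s d
    using that
  proof (induction d)
    case (Suc d)
    then show ?case using step[of "s + d"] by simp
  qed simp
  have "t \<le> m t" using add[of 0 t] t by simp
  moreover have "m t + (k - 1 - t) \<le> m (k - 1)" using add[of t "k - 1 - t"] t by simp
  moreover have "m (k - 1) < k" using range t by simp
  ultimately show ?thesis using t by linarith
qed

text \<open>By \<open>c1\<close> the map \<beta> is constant on the blocks of \<pi> and induces a
  monotone map \<open>m\<close> of block indices. Once \<open>m\<close> is known to be strictly
  increasing, it is a bijection onto the indices of \<pi>' and hence the identity. The absence of
  partial reversals is what makes it strict.\<close>

lemma merging_trivial:
  fixes \<pi> \<pi>' :: "nat list"
  assumes pos: "\<forall>q\<in>set \<pi>. 0 < q" "\<forall>q\<in>set \<pi>'. 0 < q" and p: "sum_list \<pi> = p"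
    and \<sigma>: "\<sigma> permutes {..<length \<pi>}" and \<sigma>': "\<sigma>' permutes {..<length \<pi>'}"
    and type: "block_type p \<pi>' \<beta>"
    and c1: "\<And>i j. i < p \<Longrightarrow> j < p \<Longrightarrow> blk \<pi> i \<le> blk \<pi> j \<Longrightarrow> \<beta> i \<le> \<beta> j"
    and c2: "\<And>i j. i < p \<Longrightarrow> j < p \<Longrightarrow> inv_into UNIV \<sigma> (blk \<pi> i) \<le> inv_into UNIV \<sigma> (blk \<pi> j) \<Longrightarrow>
      inv_into UNIV \<sigma>' (\<beta> i) \<le> inv_into UNIV \<sigma>' (\<beta> j)"
    and c3: "\<And>i j. i < p \<Longrightarrow> j < p \<Longrightarrow> \<beta> i = \<beta> j \<Longrightarrow> blk \<pi> i \<le> blk \<pi> j \<Longrightarrow>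
      inv_into UNIV \<sigma> (blk \<pi> j) \<le> inv_into UNIV \<sigma> (blk \<pi> i)"
    and npr: "\<not> partial_reversal (length \<pi>) \<sigma>"
  shows "\<pi> = \<pi>' \<and> \<sigma> = \<sigma>'"
proof -
  let ?k = "length \<pi>" and ?k' = "length \<pi>'" and ?\<rho> = "inv_into UNIV \<sigma>" and ?\<rho>' = "inv_into UNIV \<sigma>'"
  define i where "i t = block_start \<pi> t" for t
  have i: "i t < p" "blk \<pi> (i t) = t" if "t < ?k" for t
    using that pos(1) block_start_add_less[of t \<pi> 0] blk_block_start[of t \<pi> 0] p by (auto simp: i_def)
  define m where "m t = \<beta> (i t)" for t
  have \<beta>m: "\<beta> j = m (blk \<pi> j)" and bk: "blk \<pi> j < ?k" if "j < p" for j
  proof -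
    show bk: "blk \<pi> j < ?k" using blk(1)[of j \<pi>] that p by simp
    show "\<beta> j = m (blk \<pi> j)" unfolding m_def
      using c1[of j "i (blk \<pi> j)"] c1[of "i (blk \<pi> j)" j] i[OF bk] that by (intro antisym) auto
  qed
  have M1: "m s \<le> m t" if "s \<le> t" "t < ?k" for s t
    using c1[of "i s" "i t"] i[of s] i[of t] that by (simp add: m_def)
  have M2: "?\<rho>' (m s) \<le> ?\<rho>' (m t)" if "?\<rho> s \<le> ?\<rho> t" "s < ?k" "t < ?k" for s t
    using c2[of "i s" "i t"] i[of s] i[of t] that by (simp add: m_def)
  have M3: "?\<rho> t \<le> ?\<rho> s" if "m s = m t" "s \<le> t" "t < ?k" for s t
    using c3[of "i s" "i t"] i[of s] i[of t] that by (simp add: m_def)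
  have inv: "?\<rho> (\<sigma> t) = t" "\<sigma> (?\<rho> t) = t" for t using permutes_inverses[OF \<sigma>] by auto
  have inv': "?\<rho>' (\<sigma>' t) = t" "\<sigma>' (?\<rho>' t) = t" for t using permutes_inverses[OF \<sigma>'] by auto
  have \<rho>k: "?\<rho> t < ?k" if "t < ?k" for t
    using permutes_lessThan[OF permutes_inv[OF \<sigma>] that] .
  have step: "m t < m (Suc t)" if t: "Suc t < ?k" for t
  proof (rule ccontr)
    assume "\<not> ?thesis"
    then have eq: "m t = m (Suc t)" using M1[of t "Suc t"] t by simp
    let ?l = "?\<rho> (Suc t)" and ?l' = "?\<rho> t"
    have "?l \<le> ?l'" using M3[OF eq _ t] by simp
    moreover have "?l \<noteq> ?l'"
    proof
      assume "?l = ?l'"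
      then have "\<sigma> ?l = \<sigma> ?l'" by simp
      then show False unfolding inv by simp
    qed
    ultimately have ll: "?l < ?l'" by simp
    have lk: "?l' < ?k" using \<rho>k t by simp
    \<comment> \<open>The block right after \<open>Suc t\<close> in the order of \<sigma>(\<pi>). It
      stands between \<open>Suc t\<close> and \<open>t\<close> there, so monotonicity on the second
      side forces it to be merged with them.\<close>
    let ?u = "\<sigma> (Suc ?l)"
    have uk: "?u < ?k" using permutes_lessThan[OF \<sigma>, of "Suc ?l"] ll lk by simp
    have "?\<rho>' (m (Suc t)) \<le> ?\<rho>' (m ?u)" using M2[of "Suc t" ?u] t uk inv by simp
    moreover have "?\<rho>' (m ?u) \<le> ?\<rho>' (m t)" using M2[of ?u t] t uk inv ll by simp
    ultimately have "?\<rho>' (m ?u) = ?\<rho>' (m t)" using eq by simp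
    then have mu: "m ?u = m t" using inv'(2) by metis
    show False
    \<comment> \<open>If this block is \<open>t\<close> itself, there is a partial reversal at
      \<open>?l\<close>. Otherwise it should be reversed against \<open>t\<close> when it is below
      \<open>t\<close>, and against \<open>Suc t\<close> when it is above; its place just after
      \<open>Suc t\<close> and before \<open>t\<close> contradicts both.\<close>
    proof (cases "Suc ?l = ?l'")
      case True
      then have "\<sigma> ?l = \<sigma> (?l + 1) + 1" "?l + 1 < ?k" using inv lk by simp_all
      then show False using npr unfolding partial_reversal_def by blast
    next
      case False
      have \<rho>u: "?\<rho> ?u = Suc ?l" by (rule inv(1))
      have "\<not> ?u \<le> t"
      proof
        assume "?u \<le> t"
        then have "?\<rho> t \<le> ?\<rho> ?u" using M3[OF mu] t by simp
        then show False unfolding \<rho>u using ll False by linarith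
      qed
      moreover have "\<not> Suc t \<le> ?u"
      proof
        assume "Suc t \<le> ?u"
        then have "?\<rho> ?u \<le> ?\<rho> (Suc t)" using M3[of "Suc t" ?u] mu eq uk by simp
        then show False unfolding \<rho>u by simp
      qed
      ultimately show False by linarith
    qed
  qed
  have mk: "m t < ?k'" if "t < ?k" for t
    using type i(1)[OF that] by (simp add: block_type_def m_def)
  have less: "m s < m t" if "s < t" "t < ?k" for s t
    using that
  proof (induction t)
    case (Suc t)
    then show ?case using step[of t] by (cases "s = t") auto
  qed simp
  have inj: "inj_on m {..<?k}" using less by (intro linorder_inj_onI) force+
  have "m ` {..<?k} = {..<?k'}"
  proof (intro equalityI subsetI)
    fix u assume u: "u \<in> {..<?k'}"
    \<comment> \<open>The parts of \<pi>' are positive, so \<beta> misses no block index and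
      \<open>m\<close> is onto.\<close>
    then have "card {j. j < p \<and> \<beta> j = u} \<noteq> 0" using type pos(2) by (auto simp: block_type_def)
    then have "{j. j < p \<and> \<beta> j = u} \<noteq> {}" by (metis card.empty)
    then obtain j where "j < p" "\<beta> j = u" by blast
    then show "u \<in> m ` {..<?k}" using \<beta>m bk by auto
  qed (use mk in auto)
  then have kk: "?k' = ?k" using card_image[OF inj] by simp
  have mid: "m t = t" if "t < ?k" for t
    by (rule strictly_increasing_self_map[of ?k m]) (use mk kk step that in auto)
  have \<beta>b: "\<beta> j = blk \<pi> j" if "j < p" for j using \<beta>m[OF that] mid[OF bk[OF that]] by simp
  have "\<pi> = \<pi>'"
  proof (rule nth_equalityI)
    fix t assume t: "t < ?k"
    have "{j. j < p \<and> \<beta> j = t} = {j. j < sum_list \<pi> \<and> blk \<pi> j = t}" using \<beta>b p by auto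
    moreover have "card {j. j < p \<and> \<beta> j = t} = \<pi>' ! t" using type t kk by (simp add: block_type_def)
    ultimately show "\<pi> ! t = \<pi>' ! t" using card_blk[OF t] by (simp only:)
  qed (simp add: kk)
  moreover have "\<sigma> = \<sigma>'"
  proof
    fix l
    show "\<sigma> l = \<sigma>' l"
    proof (cases "l < ?k")
      case True
      \<comment> \<open>With \<open>m\<close> the identity, \<open>c2\<close> says that the inverse
        of \<sigma>' composed with \<sigma> is monotone. Being injective, it is a strictly
        increasing self-map.\<close>
      have "?\<rho>' (\<sigma> l) = l"
      proof (rule strictly_increasing_self_map[of ?k "\<lambda>l. ?\<rho>' (\<sigma> l)"])
        show "?\<rho>' (\<sigma> t) < ?k" if "t < ?k" for t
          using permutes_lessThan[OF permutes_inv[OF \<sigma>']] permutes_lessThan[OF \<sigma> that] kk by simp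
        show "?\<rho>' (\<sigma> t) < ?\<rho>' (\<sigma> (Suc t))" if "Suc t < ?k" for t
        proof -
          have st: "\<sigma> t < ?k" "\<sigma> (Suc t) < ?k" using permutes_lessThan[OF \<sigma>] that by auto
          have "?\<rho>' (\<sigma> t) \<le> ?\<rho>' (\<sigma> (Suc t))" using M2[of "\<sigma> t" "\<sigma> (Suc t)"] st inv mid by simp
          moreover have "?\<rho>' (\<sigma> t) \<noteq> ?\<rho>' (\<sigma> (Suc t))"
          proof
            assume "?\<rho>' (\<sigma> t) = ?\<rho>' (\<sigma> (Suc t))"
            then have "\<sigma>' (?\<rho>' (\<sigma> t)) = \<sigma>' (?\<rho>' (\<sigma> (Suc t)))" by (simp only:)
            then have "?\<rho> (\<sigma> t) = ?\<rho> (\<sigma> (Suc t))" by (simp only: inv')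
            then show False by (simp add: inv)
          qed
          ultimately show ?thesis by simp
        qed
      qed (rule True)
      then show ?thesis using inv'(2)[of "\<sigma> l"] by simp
    next
      case False
      then show ?thesis using \<sigma> \<sigma>' kk by (simp add: permutes_def)
    qed
  qed
  ultimately show ?thesis ..
qed

section \<open>A point outside the larger orbit closures\<close>

lemma eig_prod_mat_diag:
  "eig_prod p (mat_diag p d) l js = mat_diag p (\<lambda>r. \<Prod>j\<leftarrow>js. d r - l j)"
proof (induction js)
  case Nil
  then show ?case by (simp add: eig_prod_simps)
next
  case (Cons j js)
  have "mat_diag p d + (- l j) \<cdot>\<^sub>m 1\<^sub>m p = mat_diag p (\<lambda>r. d r - l j)"
    by (rule eq_matI) (auto simp: mat_diag_def)
  then show ?case by (simp add: eig_prod_simps Cons)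
qed

lemma mat_diag_pow: "mat_diag p (f :: nat \<Rightarrow> complex) ^\<^sub>m N = mat_diag p (\<lambda>r. f r ^ N)"
proof (induction N)
  case 0
  have "dim_row (mat_diag p f) = p" by (simp add: mat_diag_def)
  then show ?case by simp
next
  case (Suc N)
  then show ?case by (simp add: mult.commute)
qed

lemma corner_mat_diag:
  assumes "X \<in> carrier_mat p p" "r < p" "s < p"
  shows "corner p (mat_diag p d) l X i j $$ (r, s) =
    (\<Prod>k\<leftarrow>others p i. d r - l k) ^ p * X $$ (r, s) * (\<Prod>k\<leftarrow>others p j. d s - l k) ^ p"
proof -
  let ?e = "\<lambda>i r. (\<Prod>k\<leftarrow>others p i. d r - l k) ^ p"
  have L: "mat_diag p (?e i) * X \<in> carrier_mat p p" using assms(1) by (intro mult_carrier_mat) auto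
  have "corner p (mat_diag p d) l X i j = mat_diag p (?e i) * X * mat_diag p (?e j)"
    by (simp only: corner_def spec_pow_def eig_prod_mat_diag mat_diag_pow)
  also have "\<dots> = mat p p (\<lambda>(u, v). (mat_diag p (?e i) * X) $$ (u, v) * ?e j v)"
    by (rule mat_diag_mult_right[OF L])
  finally show ?thesis
    using assms(2,3) unfolding mat_diag_mult_left[OF assms(1)] by simp
qed

lemma others_prod_neq_0:
  "((\<Prod>k\<leftarrow>others p i. of_nat i - (of_nat k :: complex))) ^ p \<noteq> 0"
  by (auto simp: prod_list_zero_iff)

text \<open>Matrix 0 has the distinct eigenvalues 0, ..., p - 1. Matrix 1 has a 1 at every position
  that block triangularity admits, so no corner vanishes that is free not to. Matrix 2 is zero here,
  but on the second side it is nonzero strictly above the diagonal blocks: the ratios of the two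
  sides then disagree for any two blocks standing in the same order on both.\<close>

definition test_mat1 :: "nat list \<Rightarrow> nat \<Rightarrow> nat \<Rightarrow> cmat" where
  "test_mat1 \<pi> p m = (if m = 0 then mat_diag p of_nat
     else if m = 1 then mat p p (\<lambda>(r, s). if blk \<pi> r \<le> blk \<pi> s then 1 else 0)
     else 0\<^sub>m p p)"

text \<open>The diagonal of matrix 0 is permuted by \<open>block_pos\<close>, so that each
  eigenvalue sits at matched positions of the two sides.\<close>

definition test_mat2 :: "nat list \<Rightarrow> (nat \<Rightarrow> nat) \<Rightarrow> nat \<Rightarrow> nat \<Rightarrow> cmat" where
  "test_mat2 \<pi> \<sigma> p m = (let bl' = blk (permute_list \<sigma> \<pi>) in
     if m = 0 then mat_diag p (\<lambda>r. of_nat (block_pos \<pi> \<sigma> r))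
     else if m = 1 then mat p p (\<lambda>(r, s). if bl' r \<le> bl' s then 1 else 0)
     else if m = 2 then mat p p (\<lambda>(r, s). if bl' r < bl' s then 1 else 0)
     else 0\<^sub>m p p)"

lemma test_mat_carrier [simp]: "test_mat1 \<pi> p m \<in> carrier_mat p p" "test_mat2 \<pi> \<sigma> p m \<in> carrier_mat p p"
  by (auto simp: test_mat1_def test_mat2_def Let_def)

lemma test_mats_matched:
  assumes \<sigma>: "\<sigma> permutes {..<length \<pi>}" and p: "p = sum_list \<pi>"
  shows "matched \<pi> \<sigma> (test_mat1 \<pi> p m) (test_mat2 \<pi> \<sigma> p m)"
proof -
  let ?bl = "blk \<pi>" and ?bl' = "blk (permute_list \<sigma> \<pi>)" and ?t = "block_pos \<pi> \<sigma>"
  have e1: "test_mat1 \<pi> p m $$ (r, s) = (if m = 0 then (if r = s then of_nat s else 0)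
      else if m = 1 then (if ?bl r \<le> ?bl s then 1 else 0) else 0)" if "r < p" "s < p" for r s
    using that by (simp add: test_mat1_def mat_diag_def)
  have e2: "test_mat2 \<pi> \<sigma> p m $$ (r, s) = (if m = 0 then (if r = s then of_nat (?t s) else 0)
      else if m = 1 then (if ?bl' r \<le> ?bl' s then 1 else 0)
      else if m = 2 then (if ?bl' r < ?bl' s then 1 else 0) else 0)" if "r < p" "s < p" for r s
    using that by (simp add: test_mat2_def mat_diag_def Let_def)
  have t: "?t r < p" "?bl (?t r) = \<sigma> (?bl' r)" if "r < p" for r
    using block_pos[OF \<sigma>, of r] that p by simp_all
  have i: "?t r = ?t s \<longleftrightarrow> r = s" if "r < p" "s < p" for r s
    using inj_on_eq_iff[OF block_pos_inj[OF \<sigma>], of r s] that p by simp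
  show ?thesis
    unfolding matched_def Let_def p[symmetric]
  proof (intro conjI allI impI test_mat_carrier)
    fix r s assume rs: "r < p" "s < p"
    show "test_mat1 \<pi> p m $$ (r, s) = 0" if "?bl s < ?bl r" using that unfolding e1[OF rs] by auto
    show "test_mat2 \<pi> \<sigma> p m $$ (r, s) = 0" if "?bl' s < ?bl' r" using that unfolding e2[OF rs] by auto
    show "test_mat2 \<pi> \<sigma> p m $$ (r, s) = test_mat1 \<pi> p m $$ (?t r, ?t s)" if "?bl' r = ?bl' s"
      using that unfolding e1[OF t(1)[OF rs(1)] t(1)[OF rs(2)]] e2[OF rs] i[OF rs] t(2)[OF rs(1)] t(2)[OF rs(2)] by simp
  qed
qed

text \<open>For a diagonal first matrix, a corner consists of a single entry of the other matrix
  times a nonzero constant. At the test point the corner relations thus become statements about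
  which entries are zero, and these are the hypotheses of \<open>merging_trivial\<close>.\<close>

lemma not_in_closure_of_larger:
  assumes \<pi>: "\<pi> \<in> compositions p (length \<pi>)" and \<pi>': "\<pi>' \<in> compositions p (length \<pi>')"
    and \<sigma>: "\<sigma> permutes {..<length \<pi>}" and \<sigma>': "\<sigma>' permutes {..<length \<pi>'}"
    and p: "0 < p" "length \<pi>' \<le> p" and n: "3 \<le> n"
    and npr: "\<not> partial_reversal (length \<pi>) \<sigma>"
    and sub: "C_pairs p n \<pi> \<sigma> \<subseteq> zariski_closure p n (G2_orbit p (C_pairs p n \<pi>' \<sigma>'))"
  shows "\<pi> = \<pi>' \<and> \<sigma> = \<sigma>'"
proof -
  have s: "sum_list \<pi> = p" "sum_list \<pi>' = p" and pos: "\<forall>q\<in>set \<pi>. 0 < q" "\<forall>q\<in>set \<pi>'. 0 < q"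
    using \<pi> \<pi>' by (auto simp: compositions_def)
  define a where "a = (map (test_mat1 \<pi> p) [0..<n], map (test_mat2 \<pi> \<sigma> p) [0..<n])"
  have "a \<in> C_pairs p n \<pi> \<sigma>"
    unfolding a_def C_pairs_iff[OF \<sigma> s(1)] using test_mats_matched[OF \<sigma> s(1)[symmetric]] by simp
  then have acl: "a \<in> zariski_closure p n (G2_orbit p (C_pairs p n \<pi>' \<sigma>'))" using sub by blast
  have n0: "0 < n" "1 < n" "2 < n" using n by auto
  have co: "coord_mat p (fst a) m = test_mat1 \<pi> p m" "coord_mat p (snd a) m = test_mat2 \<pi> \<sigma> p m" if "m < n" for m
    using that by (simp_all add: a_def coord_mat_eq)
  let ?l = "of_nat :: nat \<Rightarrow> complex" and ?\<rho>' = "inv_into UNIV \<sigma>'" and ?\<rho> = "inv_into UNIV \<sigma>"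
  let ?bl' = "blk (permute_list \<sigma> \<pi>)" and ?t = "block_pos \<pi> \<sigma>"
  have ex: "\<exists>\<beta>. block_type p \<pi>' \<beta> \<and> corner_relations p ?\<rho>' \<beta> a ?l"
  proof (rule closure_corner_relations[OF \<sigma>' s(2)[symmetric] p(2,1) n acl])
    show "upper_triangular (coord_mat p (fst a) 0)"
      unfolding co(1)[OF n0(1)] by (auto simp: test_mat1_def mat_diag_def intro!: upper_triangularI)
    show "\<exists>r<p. ?l i = coord_mat p (fst a) 0 $$ (r, r)" if "i < p" for i
      unfolding co(1)[OF n0(1)] using that by (intro exI[of _ i]) (auto simp: test_mat1_def mat_diag_def)
    show "inj_on ?l {..<p}" by (simp add: inj_on_def)
  qed
  then obtain \<beta> where type: "block_type p \<pi>' \<beta>" and R: "corner_relations p ?\<rho>' \<beta> a ?l" by (elim exE conjE)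
  define c where "c i = (\<Prod>k\<leftarrow>others p i. ?l i - ?l k) ^ p" for i
  have k1: "corner1 p m i j a ?l $$ (i, j) = c i * test_mat1 \<pi> p m $$ (i, j) * c j"
    if "m < n" "i < p" "j < p" for m i j
    unfolding corner1_def co(1)[OF n0(1)] co(1)[OF that(1)] using that
    by (simp add: test_mat1_def[of _ _ 0] corner_mat_diag c_def)
  have k2: "corner2 p m (?t r) (?t s) a ?l $$ (r, s) = c (?t r) * test_mat2 \<pi> \<sigma> p m $$ (r, s) * c (?t s)"
    if "m < n" "r < p" "s < p" for m r s
    unfolding corner2_def co(2)[OF n0(1)] co(2)[OF that(1)] using that
    by (simp add: test_mat2_def[of _ _ _ 0] corner_mat_diag c_def)
  have k22: "corner22 p m (?t r) (?t s) a ?l $$ (r, s) =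
      c (?t r) * (c (?t r) * test_mat2 \<pi> \<sigma> p m $$ (r, s) * c (?t s)) * c (?t s)"
    if "m < n" "r < p" "s < p" for m r s
  proof -
    have "corner2 p m (?t r) (?t s) a ?l \<in> carrier_mat p p"
      unfolding corner2_def by (intro corner_carrier coord_mat_carrier)
    then show ?thesis
      unfolding corner22_def co(2)[OF n0(1)] k2[OF that, symmetric] using that
      by (simp add: test_mat2_def[of _ _ _ 0] corner_mat_diag c_def[symmetric])
  qed
  have c: "c i \<noteq> 0" for i unfolding c_def by (rule others_prod_neq_0)
  \<comment> \<open>On the second side the eigenvalue i is found in the row that
    \<open>block_pos\<close> sends to i, and so in the block whose place is given by the inverse of
    \<sigma>.\<close>
  have pre: "\<exists>r. r < p \<and> ?t r = i \<and> ?bl' r = ?\<rho> (blk \<pi> i)" if "i < p" for i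
  proof -
    have "i \<in> ?t ` {..<p}" using block_pos_bij[OF \<sigma>] that s(1) by (simp add: bij_betw_def)
    then obtain r where r: "r < p" "?t r = i" by blast
    then have "\<sigma> (?bl' r) = blk \<pi> i" using block_pos(2)[OF \<sigma>, of r] s(1) by simp
    then have "?bl' r = ?\<rho> (blk \<pi> i)" using permutes_inverses(2)[OF \<sigma>] by metis
    then show ?thesis using r by blast
  qed
  have t1: "test_mat1 \<pi> p 1 $$ (i, j) = (if blk \<pi> i \<le> blk \<pi> j then 1 else 0)" "test_mat1 \<pi> p 2 $$ (i, j) = 0"
    if "i < p" "j < p" for i j
    using that by (simp_all add: test_mat1_def)
  have t2: "test_mat2 \<pi> \<sigma> p 1 $$ (i, j) = (if ?bl' i \<le> ?bl' j then 1 else 0)"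
      "test_mat2 \<pi> \<sigma> p 2 $$ (i, j) = (if ?bl' i < ?bl' j then 1 else 0)"
    if "i < p" "j < p" for i j
    using that by (simp_all add: test_mat2_def Let_def)
  note R1 = R[unfolded corner_relations_def, THEN conjunct1, rule_format]
  note R2 = R[unfolded corner_relations_def, THEN conjunct2, THEN conjunct1, rule_format]
  note R3 = R[unfolded corner_relations_def, THEN conjunct2, THEN conjunct2, rule_format]
  show ?thesis
  proof (rule merging_trivial[OF pos s(1) \<sigma> \<sigma>' type _ _ _ npr])
    fix i j assume ij: "i < p" "j < p"
    show "\<beta> i \<le> \<beta> j" if "blk \<pi> i \<le> blk \<pi> j"
    proof (rule ccontr)
      assume "\<not> \<beta> i \<le> \<beta> j"
      then have "corner1 p 1 i j a ?l $$ (i, j) = 0" using R1[OF ij] ij by simp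
      then show False unfolding k1[OF n0(2) ij] t1[OF ij] using that c[of i] c[of j] by simp
    qed
    obtain r s where r: "r < p" "?t r = i" "?bl' r = ?\<rho> (blk \<pi> i)" and s: "s < p" "?t s = j" "?bl' s = ?\<rho> (blk \<pi> j)"
      using pre[OF ij(1)] pre[OF ij(2)] by (elim exE conjE)
    show "?\<rho>' (\<beta> i) \<le> ?\<rho>' (\<beta> j)" if "?\<rho> (blk \<pi> i) \<le> ?\<rho> (blk \<pi> j)"
    proof (rule ccontr)
      assume "\<not> ?thesis"
      then have "corner2 p 1 i j a ?l $$ (r, s) = 0" using R2[OF ij] r s by simp
      then show False using k2[OF n0(2) r(1) s(1)] t2[OF r(1) s(1)] that c[of i] c[of j] r s by simp
    qed
    show "?\<rho> (blk \<pi> j) \<le> ?\<rho> (blk \<pi> i)" if b: "\<beta> i = \<beta> j" "blk \<pi> i \<le> blk \<pi> j"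
    proof (rule ccontr)
      assume "\<not> ?thesis"
      then have less: "?bl' r < ?bl' s" using r s by simp
      \<comment> \<open>If the two blocks stood in the same order on both sides, the left product
        would be nonzero, while the right one contains a corner of the zero matrix.\<close>
      have "corner1 p 1 i j a ?l $$ (i, j) * corner22 p 2 i j a ?l $$ (r, s) =
        corner1 p 2 i j a ?l $$ (i, j) * corner22 p 1 i j a ?l $$ (r, s)"
        by (rule R3[OF ij b(1) ij r(1) s(1)])
      then have "corner1 p 1 i j a ?l $$ (i, j) * corner22 p 2 i j a ?l $$ (r, s) = 0"
        unfolding k1[OF n0(3) ij] t1[OF ij] by simp
      then show False
        using k22[OF n0(3) r(1) s(1)] t2[OF r(1) s(1)] less b(2) c[of i] c[of j] r s
        unfolding k1[OF n0(2) ij] t1[OF ij] by simp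
    qed
  qed
qed

section \<open>Merging two reversed blocks\<close>

definition merge_at :: "nat \<Rightarrow> nat list \<Rightarrow> nat list" where
  "merge_at a \<pi> = take a \<pi> @ (\<pi> ! a + \<pi> ! Suc a) # drop (Suc (Suc a)) \<pi>"

definition merge_index :: "nat \<Rightarrow> nat \<Rightarrow> nat" where
  "merge_index a j = (if j \<le> a then j else j - 1)"

lemma length_merge_at: "Suc a < length \<pi> \<Longrightarrow> length (merge_at a \<pi>) = length \<pi> - 1"
  by (simp add: merge_at_def)

lemma merge_at_nth:
  assumes "Suc a < length \<pi>" "i < length \<pi> - 1"
  shows "merge_at a \<pi> ! i = (if i < a then \<pi> ! i else if i = a then \<pi> ! a + \<pi> ! Suc a else \<pi> ! Suc i)"
  using assms by (auto simp: merge_at_def nth_append nth_Cons split: nat.split)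
    (metis Suc_diff_Suc Suc_lessD add_Suc_right le_add_diff_inverse less_or_eq_imp_le linorder_neqE_nat)+

lemma block_start_merge_at:
  assumes "Suc a < length \<pi>" "i \<le> length \<pi> - 1"
  shows "block_start (merge_at a \<pi>) i = (if i \<le> a then block_start \<pi> i else block_start \<pi> (Suc i))"
  using assms(2)
proof (induction i)
  case 0
  then show ?case by (simp add: block_start_def)
next
  case (Suc i)
  then show ?case
    using assms(1) block_start_Suc[of i "merge_at a \<pi>"] block_start_Suc[of i \<pi>] block_start_Suc[of "Suc i" \<pi>]
    by (auto simp: length_merge_at merge_at_nth)
qed

lemma sum_list_merge_at:
  assumes "Suc a < length \<pi>"
  shows "sum_list (merge_at a \<pi>) = sum_list \<pi>"
proof -
  have "\<not> length \<pi> - 1 \<le> a" "Suc (length \<pi> - 1) = length \<pi>" using assms by auto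
  then show ?thesis
    using block_start_merge_at[OF assms, of "length \<pi> - 1"] block_start_length[of "merge_at a \<pi>"]
      block_start_length[of \<pi>] length_merge_at[OF assms] by simp
qed

lemma blk_merge_at:
  assumes "Suc a < length \<pi>" "r < sum_list \<pi>"
  shows "blk (merge_at a \<pi>) r = merge_index a (blk \<pi> r)"
proof (rule blk_eqI)
  note b = blk[OF assms(2)]
  let ?j = "blk \<pi> r" let ?i = "merge_index a ?j"
  show l: "?i < length (merge_at a \<pi>)" using b(1) assms(1) by (auto simp: merge_index_def length_merge_at)
  then have i: "?i < length \<pi> - 1" using assms(1) by (simp add: length_merge_at)
  show "block_start (merge_at a \<pi>) ?i \<le> r"
    using b block_start_merge_at[OF assms(1), of ?i] i block_start_mono[of "?j - 1" ?j \<pi>]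
    by (auto simp: merge_index_def split: if_splits)
  show "r < block_start (merge_at a \<pi>) ?i + merge_at a \<pi> ! ?i"
    using b block_start_merge_at[OF assms(1), of ?i] merge_at_nth[OF assms(1) i] i
      block_start_Suc[of a \<pi>] assms(1)
    by (cases "?j = a"; cases "?j = Suc a") (auto simp: merge_index_def split: if_splits)
qed

text \<open>The permutation induced on collapsed indices: a position is represented by an old
  position other than \<open>Suc l\<close>, and its value is collapsed at
  \<open>\<sigma> (Suc l)\<close>. Outside the k - 1 positions it is the identity, as
  \<open>permutes\<close> demands.\<close>

definition merge_perm :: "nat \<Rightarrow> nat \<Rightarrow> (nat \<Rightarrow> nat) \<Rightarrow> nat \<Rightarrow> nat" where
  "merge_perm k l \<sigma> i = (if i < k - 1 then merge_index (\<sigma> (Suc l)) (\<sigma> (if i \<le> l then i else Suc i)) else i)"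

locale reversed_blocks =
  fixes \<pi> :: "nat list" and \<sigma> :: "nat \<Rightarrow> nat" and l p :: nat
  assumes \<sigma>: "\<sigma> permutes {..<length \<pi>}" and l: "Suc l < length \<pi>" and rev: "\<sigma> l = Suc (\<sigma> (Suc l))"
    and p: "sum_list \<pi> = p"
begin

abbreviation (input) "a \<equiv> \<sigma> (Suc l)"
abbreviation (input) "\<pi>m \<equiv> merge_at a \<pi>"
abbreviation (input) "\<sigma>m \<equiv> merge_perm (length \<pi>) l \<sigma>"
abbreviation (input) "bl \<equiv> blk \<pi>"
abbreviation (input) "bl' \<equiv> blk (permute_list \<sigma> \<pi>)"
abbreviation (input) "\<tau> \<equiv> block_pos \<pi> \<sigma>"
abbreviation (input) "\<tau>m \<equiv> block_pos \<pi>m \<sigma>m"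

lemma merge_bounds: "Suc a < length \<pi>" "Suc l < length (permute_list \<sigma> \<pi>)"
  using permutes_lessThan[OF \<sigma>, of l] l rev by auto

lemma \<sigma>_eq_iff: "\<sigma> i = \<sigma> j \<longleftrightarrow> i = j"
  by (rule inj_eq[OF permutes_inj[OF \<sigma>]])

lemma merge_perm_merge_index:
  assumes "j < length \<pi>"
  shows "\<sigma>m (merge_index l j) = merge_index a (\<sigma> j)"
proof -
  consider "j \<le> l" | "j = Suc l" | "j > Suc l" by linarith
  then show ?thesis
  proof cases
    case 1
    then have "merge_index l j = j" "j < length \<pi> - 1" using l by (auto simp: merge_index_def)
    then show ?thesis using 1 by (simp add: merge_perm_def)
  next
    case 2
    then have "merge_index l j = l" "l < length \<pi> - 1" using l by (auto simp: merge_index_def)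
    then show ?thesis using 2 rev by (simp add: merge_perm_def merge_index_def)
  next
    case 3
    then have "merge_index l j = j - 1" "\<not> j - 1 \<le> l" "Suc (j - 1) = j" "j - 1 < length \<pi> - 1"
      using assms by (auto simp: merge_index_def)
    then show ?thesis by (simp add: merge_perm_def)
  qed
qed

lemma merge_perm_permutes: "\<sigma>m permutes {..<length \<pi>m}"
proof -
  let ?k = "length \<pi>"
  let ?e = "\<lambda>i. if i \<le> l then i else Suc i"
  have len: "length \<pi>m = ?k - 1" by (rule length_merge_at[OF merge_bounds(1)])
  have e: "?e i < ?k" "?e i \<noteq> Suc l" if "i < ?k - 1" for i using that l by auto
  have na: "\<sigma> (?e i) \<noteq> a" if "i < ?k - 1" for i using e(2)[OF that] \<sigma>_eq_iff by blast
  have mi: "x = y" if "merge_index a x = merge_index a y" "x \<noteq> a" "y \<noteq> a" for x y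
    using that by (auto simp: merge_index_def split: if_splits)
  have "inj_on \<sigma>m {..<?k - 1}"
  proof (rule inj_onI)
    fix i j assume ij: "i \<in> {..<?k - 1}" "j \<in> {..<?k - 1}" "\<sigma>m i = \<sigma>m j"
    then have "merge_index a (\<sigma> (?e i)) = merge_index a (\<sigma> (?e j))" by (simp add: merge_perm_def)
    then have "\<sigma> (?e i) = \<sigma> (?e j)" using mi na ij by blast
    then have "?e i = ?e j" by (simp only: \<sigma>_eq_iff)
    then show "i = j" by (auto split: if_splits)
  qed
  moreover have "\<sigma>m ` {..<?k - 1} \<subseteq> {..<?k - 1}"
  proof
    fix y assume "y \<in> \<sigma>m ` {..<?k - 1}"
    then obtain i where i: "i < ?k - 1" "y = merge_index a (\<sigma> (?e i))" by (auto simp: merge_perm_def)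
    have "\<sigma> (?e i) < ?k" by (rule permutes_lessThan[OF \<sigma> e(1)[OF i(1)]])
    then show "y \<in> {..<?k - 1}" using i(2) merge_bounds(1) by (auto simp: merge_index_def)
  qed
  ultimately have "bij_betw \<sigma>m {..<?k - 1} {..<?k - 1}"
    by (simp add: bij_betw_def endo_inj_surj)
  moreover have "\<sigma>m i = i" if "i \<notin> {..<?k - 1}" for i using that by (simp add: merge_perm_def)
  ultimately show ?thesis unfolding len by (intro bij_imp_permutes)
qed

text \<open>A partial reversal makes the two blocks adjacent in both compositions, so merging
  commutes with permuting. The sum of the two parts does not see that they stand in opposite orders;
  the coordinates do, which is corrected by \<rho> below.\<close>

lemma permute_list_merge: "permute_list \<sigma>m \<pi>m = merge_at l (permute_list \<sigma> \<pi>)"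
proof (rule nth_equalityI)
  let ?k = "length \<pi>"
  have len: "length \<pi>m = ?k - 1" by (rule length_merge_at[OF merge_bounds(1)])
  show "length (permute_list \<sigma>m \<pi>m) = length (merge_at l (permute_list \<sigma> \<pi>))"
    using length_merge_at[OF merge_bounds(2)] len by simp
  fix i assume "i < length (permute_list \<sigma>m \<pi>m)"
  then have i: "i < ?k - 1" using len by simp
  note nth = permute_list_nth[OF \<sigma>]
  have R: "merge_at l (permute_list \<sigma> \<pi>) ! i =
    (if i < l then \<pi> ! \<sigma> i else if i = l then \<pi> ! \<sigma> l + \<pi> ! \<sigma> (Suc l) else \<pi> ! \<sigma> (Suc i))"
    using merge_at_nth[OF merge_bounds(2), of i] i l by (simp add: nth)
  have off: "\<pi>m ! merge_index a x = \<pi> ! x" if "x < ?k" "x \<noteq> a" "x \<noteq> Suc a" for x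
    using that merge_at_nth[OF merge_bounds(1), of "merge_index a x"] merge_bounds(1)
    by (auto simp: merge_index_def)
  have L: "permute_list \<sigma>m \<pi>m ! i = \<pi>m ! \<sigma>m i"
    using permute_list_nth[OF merge_perm_permutes] i len by simp
  consider "i < l" | "i = l" | "i > l" by linarith
  then show "permute_list \<sigma>m \<pi>m ! i = merge_at l (permute_list \<sigma> \<pi>) ! i"
  proof cases
    case 1
    have "\<sigma> i \<noteq> a" "\<sigma> i \<noteq> Suc a" "\<sigma> i < ?k"
      using 1 i permutes_lessThan[OF \<sigma>, of i] \<sigma>_eq_iff[of i "Suc l"] \<sigma>_eq_iff[of i l] rev by auto
    then show ?thesis using 1 i by (simp add: L R off merge_perm_def)
  next
    case 2
    have "\<sigma>m i = a" using 2 i rev by (simp add: merge_perm_def merge_index_def)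
    moreover have "a < length \<pi> - 1" using merge_bounds(1) by simp
    ultimately show ?thesis unfolding L R using 2 merge_at_nth[OF merge_bounds(1), of a] rev by simp
  next
    case 3
    have "\<sigma> (Suc i) \<noteq> a" "\<sigma> (Suc i) \<noteq> Suc a" "\<sigma> (Suc i) < ?k"
      using 3 i permutes_lessThan[OF \<sigma>, of "Suc i"] \<sigma>_eq_iff[of "Suc i" "Suc l"] \<sigma>_eq_iff[of "Suc i" l] rev by auto
    then show ?thesis using 3 i by (simp add: L R off merge_perm_def)
  qed
qed

lemma blk_merged:
  assumes "r < p"
  shows "blk \<pi>m r = merge_index a (bl r)" "blk (permute_list \<sigma>m \<pi>m) r = merge_index l (bl' r)"
  using blk_merge_at[OF merge_bounds(1), of r] blk_merge_at[OF merge_bounds(2), of r] assms p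
    sum_list_permute[OF \<sigma>] by (simp_all add: permute_list_merge)

lemma sum_merged: "sum_list \<pi>m = p"
  using sum_list_merge_at[OF merge_bounds(1)] p by simp

section \<open>Deforming the matched pair into the merged one\<close>

definition \<theta> where "\<theta> = inv_into {..<p} \<tau>"

lemma \<theta>: "r < p \<Longrightarrow> \<theta> r < p" "r < p \<Longrightarrow> \<tau> (\<theta> r) = r" "r < p \<Longrightarrow> \<theta> (\<tau> r) = r"
proof -
  note b = block_pos_bij[OF \<sigma>, unfolded p]
  show "r < p \<Longrightarrow> \<theta> r < p" using bij_betw_inv_into[OF b] unfolding \<theta>_def bij_betw_def by blast
  show "r < p \<Longrightarrow> \<tau> (\<theta> r) = r" using bij_betw_inv_into_right[OF b] unfolding \<theta>_def by simp
  show "r < p \<Longrightarrow> \<theta> (\<tau> r) = r" using bij_betw_inv_into_left[OF b] unfolding \<theta>_def by simp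
qed

text \<open>\<open>\<tau>m\<close> copies a merged block as a whole, whereas \<open>\<tau>\<close>
  matches the two old blocks, which stand in reverse order on the second side. Comparing them gives
  a permutation of the rows of the second side that stays inside merged blocks.\<close>

definition \<rho> where "\<rho> r = \<theta> (\<tau>m r)"

lemma \<tau>m: "r < p \<Longrightarrow> \<tau>m r < p" "r < p \<Longrightarrow> blk \<pi>m (\<tau>m r) = \<sigma>m (blk (permute_list \<sigma>m \<pi>m) r)"
  using block_pos[OF merge_perm_permutes, of r] sum_merged by auto

lemma \<rho>_bij: "bij_betw \<rho> {..<p} {..<p}"
proof -
  have "bij_betw \<tau>m {..<p} {..<p}" using block_pos_bij[OF merge_perm_permutes] sum_merged by simp
  moreover have "bij_betw \<theta> {..<p} {..<p}"
    using bij_betw_inv_into[OF block_pos_bij[OF \<sigma>, unfolded p]] unfolding \<theta>_def .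
  ultimately have "bij_betw (\<theta> \<circ> \<tau>m) {..<p} {..<p}" by (rule bij_betw_trans)
  then show ?thesis by (simp add: \<rho>_def[abs_def] comp_def)
qed

lemma bl'_\<theta>: "r < p \<Longrightarrow> \<sigma> (bl' (\<theta> r)) = bl r"
  using block_pos(2)[OF \<sigma>, of "\<theta> r"] \<theta>[of r] p by simp

lemma bl'_\<rho>:
  assumes "r < p"
  shows "merge_index l (bl' (\<rho> r)) = blk (permute_list \<sigma>m \<pi>m) r"
proof -
  have r: "\<rho> r < p" using \<theta>(1) \<tau>m(1) assms by (simp add: \<rho>_def)
  have "\<sigma>m (merge_index l (bl' (\<rho> r))) = merge_index a (\<sigma> (bl' (\<rho> r)))"
    using blk_permute(1)[OF \<sigma>, of "\<rho> r"] r p by (intro merge_perm_merge_index) simp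
  also have "\<dots> = merge_index a (bl (\<tau>m r))" using bl'_\<theta> \<tau>m(1) assms by (simp add: \<rho>_def)
  also have "\<dots> = \<sigma>m (blk (permute_list \<sigma>m \<pi>m) r)" using blk_merged(1) \<tau>m assms by simp
  finally show ?thesis using permutes_inj[OF merge_perm_permutes] by (simp add: inj_def)
qed

text \<open>The direction of the deformation fills the block at (a + 1, a), below the diagonal, with
  the block of \<open>X'\<close> at (l, l + 1), above the diagonal on the second side.
  \<open>tangent2\<close> is the mirror image, taking the block of \<open>X\<close> at (a, a +
  1).\<close>

definition tangent1 :: "cmat \<Rightarrow> cmat" where
  "tangent1 X' = mat p p (\<lambda>(r, s). if bl r = Suc a \<and> bl s = a then X' $$ (\<theta> r, \<theta> s) else 0)"

definition tangent2 :: "cmat \<Rightarrow> cmat" where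
  "tangent2 X = mat p p (\<lambda>(r, s). if bl' r = Suc l \<and> bl' s = l then X $$ (\<tau> r, \<tau> s) else 0)"

text \<open>Reordered by \<rho>, the deformed second matrix reads [B, t X; Y, C]. Conjugation by the
  diagonal matrix diag(1, t) makes it [B, X; t Y, C], the deformed first matrix.\<close>

definition weight :: "complex \<Rightarrow> nat \<Rightarrow> complex" where
  "weight t r = (if bl (\<tau>m r) = Suc a then t else 1)"

definition merged2 :: "complex \<Rightarrow> cmat \<Rightarrow> cmat" where
  "merged2 t X' = mat p p (\<lambda>(r, s). weight t r / weight t s * X' $$ (\<rho> r, \<rho> s))"

lemma merge_index_less: "merge_index b j < merge_index b i \<Longrightarrow> j < i"
  by (auto simp: merge_index_def split: if_splits)

lemma merge_index_eq: "merge_index b i = merge_index b j \<Longrightarrow> i \<noteq> j \<Longrightarrow> i = b \<and> j = Suc b \<or> i = Suc b \<and> j = b"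
  by (auto simp: merge_index_def split: if_splits)

lemma matched_merged:
  assumes m: "matched \<pi> \<sigma> X X'" and t: "t \<noteq> 0"
  shows "matched \<pi>m \<sigma>m (X + t \<cdot>\<^sub>m tangent1 X') (merged2 t (X' + t \<cdot>\<^sub>m tangent2 X))"
proof -
  note m = matchedD[OF m, unfolded p]
  let ?At = "X + t \<cdot>\<^sub>m tangent1 X'" and ?At' = "X' + t \<cdot>\<^sub>m tangent2 X"
  have At: "?At $$ (r, s) = X $$ (r, s) + t * (if bl r = Suc a \<and> bl s = a then X' $$ (\<theta> r, \<theta> s) else 0)"
    if "r < p" "s < p" for r s
    using that m(1) by (simp add: tangent1_def)
  have At': "?At' $$ (r, s) = X' $$ (r, s) + t * (if bl' r = Suc l \<and> bl' s = l then X $$ (\<tau> r, \<tau> s) else 0)"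
    if "r < p" "s < p" for r s
    using that m(2) by (simp add: tangent2_def)
  have \<rho>: "\<rho> r < p" if "r < p" for r using \<theta>(1) \<tau>m(1) that by (simp add: \<rho>_def)
  have M: "merged2 t ?At' $$ (r, s) = weight t r / weight t s * ?At' $$ (\<rho> r, \<rho> s)" if "r < p" "s < p" for r s
    using that by (simp add: merged2_def)
  show ?thesis
    unfolding matched_def Let_def sum_merged
  proof (intro conjI allI impI)
    show "?At \<in> carrier_mat p p" "merged2 t ?At' \<in> carrier_mat p p"
      using m(1) by (auto simp: tangent1_def merged2_def)
    fix r s assume rs: "r < p" "s < p"
    show "?At $$ (r, s) = 0" if "blk \<pi>m s < blk \<pi>m r"
    proof -
      have "bl s < bl r" "\<not> (bl r = Suc a \<and> bl s = a)"
        using that merge_index_less[of a "bl s" "bl r"] unfolding blk_merged(1)[OF rs(1)] blk_merged(1)[OF rs(2)]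
        by (auto simp: merge_index_def)
      then show ?thesis unfolding At[OF rs] using m(3)[OF rs] by auto
    qed
    show "merged2 t ?At' $$ (r, s) = 0" if "blk (permute_list \<sigma>m \<pi>m) s < blk (permute_list \<sigma>m \<pi>m) r"
    proof -
      have "bl' (\<rho> s) < bl' (\<rho> r)" "\<not> (bl' (\<rho> r) = Suc l \<and> bl' (\<rho> s) = l)"
        using that merge_index_less[of l "bl' (\<rho> s)" "bl' (\<rho> r)"]
        unfolding bl'_\<rho>[OF rs(1), symmetric] bl'_\<rho>[OF rs(2), symmetric] by (auto simp: merge_index_def)
      then have "?At' $$ (\<rho> r, \<rho> s) = 0" unfolding At'[OF \<rho>[OF rs(1)] \<rho>[OF rs(2)]]
        using m(4)[OF \<rho>[OF rs(1)] \<rho>[OF rs(2)]] by auto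
      then show ?thesis unfolding M[OF rs] by simp
    qed
    show "merged2 t ?At' $$ (r, s) = ?At $$ (\<tau>m r, \<tau>m s)"
      if eq: "blk (permute_list \<sigma>m \<pi>m) r = blk (permute_list \<sigma>m \<pi>m) s"
    proof -
      define x where "x = \<tau>m r"
      define y where "y = \<tau>m s"
      have xy: "x < p" "y < p" using \<tau>m(1) rs by (simp_all add: x_def y_def)
      have \<theta>xy: "\<rho> r = \<theta> x" "\<rho> s = \<theta> y" by (simp_all add: \<rho>_def x_def y_def)
      have bxy: "\<sigma> (bl' (\<theta> x)) = bl x" "\<sigma> (bl' (\<theta> y)) = bl y" using bl'_\<theta> xy by auto
      have w: "weight t r = (if bl x = Suc a then t else 1)" "weight t s = (if bl y = Suc a then t else 1)"
        by (simp_all add: weight_def x_def y_def)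
      have "merge_index a (bl x) = merge_index a (bl y)"
        using \<tau>m(2)[OF rs(1)] \<tau>m(2)[OF rs(2)] eq blk_merged(1)[OF xy(1)] blk_merged(1)[OF xy(2)]
        by (simp add: x_def y_def)
      moreover have E: "(merged2 t ?At' $$ (r, s) = ?At $$ (\<tau>m r, \<tau>m s)) \<longleftrightarrow>
          ((if bl x = Suc a then t else 1) / (if bl y = Suc a then t else 1) *
          (X' $$ (\<theta> x, \<theta> y) + t * (if bl' (\<theta> x) = Suc l \<and> bl' (\<theta> y) = l then X $$ (\<tau> (\<theta> x), \<tau> (\<theta> y)) else 0)) =
          X $$ (x, y) + t * (if bl x = Suc a \<and> bl y = a then X' $$ (\<theta> x, \<theta> y) else 0))"
        unfolding M[OF rs] \<theta>xy w At'[OF \<theta>(1)[OF xy(1)] \<theta>(1)[OF xy(2)]]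
          x_def[symmetric] y_def[symmetric] At[OF xy] ..
      ultimately consider "bl x = bl y" | "bl x = a" "bl y = Suc a" | "bl x = Suc a" "bl y = a"
        using merge_index_eq by blast
      then show ?thesis
      proof cases
        case 1
        then have "bl' (\<theta> x) = bl' (\<theta> y)" using bxy \<sigma>_eq_iff by metis
        then show ?thesis unfolding E
          using 1 t m(5)[OF \<theta>(1)[OF xy(1)] \<theta>(1)[OF xy(2)]] \<theta>(2) xy by auto
      next
        \<comment> \<open>Off-diagonal part of the merged block. Above the diagonal the quotient of
          the weights is 1 / t and cancels the t before \<open>tangent2\<close>; below the diagonal,
          in the next case, it is t and agrees with the t before \<open>tangent1\<close>.\<close>
        case 2
        then have b: "bl' (\<theta> x) = Suc l" "bl' (\<theta> y) = l" using bxy \<sigma>_eq_iff rev by metis+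
        then have "X' $$ (\<theta> x, \<theta> y) = 0" using m(4)[OF \<theta>(1)[OF xy(1)] \<theta>(1)[OF xy(2)]] by simp
        then show ?thesis unfolding E
          using 2 b t \<theta>(2) xy by simp
      next
        case 3
        then have b: "bl' (\<theta> x) = l" "bl' (\<theta> y) = Suc l" using bxy \<sigma>_eq_iff rev by metis+
        have "X $$ (x, y) = 0" using m(3)[OF xy] 3 by simp
        then show ?thesis unfolding E
          using 3 b by simp
      qed
    qed
  qed
qed

text \<open>The monomial matrix that undoes \<open>merged2\<close> by conjugation. It shows that the
  deformed second matrices, in their old coordinates, belong to the orbit of the merged set.\<close>

definition shuffle :: "complex \<Rightarrow> cmat" where
  "shuffle t = mat p p (\<lambda>(u, v). if u = \<rho> v then 1 / weight t v else 0)"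

definition unshuffle :: "complex \<Rightarrow> cmat" where
  "unshuffle t = mat p p (\<lambda>(v, u). if u = \<rho> v then weight t v else 0)"

lemma shuffle_carrier: "shuffle t \<in> carrier_mat p p" "unshuffle t \<in> carrier_mat p p"
  by (simp_all add: shuffle_def unshuffle_def)

lemma \<rho>_less: "r < p \<Longrightarrow> \<rho> r < p"
  using \<rho>_bij by (auto simp: bij_betw_def)

lemma \<rho>_eq_iff: "r < p \<Longrightarrow> s < p \<Longrightarrow> \<rho> r = \<rho> s \<longleftrightarrow> r = s"
  using \<rho>_bij by (auto simp: bij_betw_def inj_on_def)

lemma \<rho>_surj: "r < p \<Longrightarrow> \<exists>x<p. r = \<rho> x"
  using \<rho>_bij by (auto simp: bij_betw_def)

lemma weight_neq_0: "t \<noteq> 0 \<Longrightarrow> weight t r \<noteq> 0"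
  by (simp add: weight_def)

lemma shuffle_conj:
  assumes t: "t \<noteq> 0" and X: "X \<in> carrier_mat p p"
  shows "shuffle t * merged2 t X * unshuffle t = X"
proof (rule eq_matI)
  fix r s assume "r < dim_row X" "s < dim_col X"
  then have rs: "r < p" "s < p" using X by auto
  obtain x y where xy: "x < p" "r = \<rho> x" "y < p" "s = \<rho> y" using \<rho>_surj rs by blast
  have "(shuffle t * merged2 t X * unshuffle t) $$ (r, s) =
      (\<Sum>v<p. \<Sum>u<p. shuffle t $$ (r, u) * merged2 t X $$ (u, v) * unshuffle t $$ (v, s))"
    using rs by (intro triple_entry shuffle_carrier) (simp_all add: merged2_def)
  also have "\<dots> = (\<Sum>v<p. \<Sum>u<p. if u = x then (if v = y then X $$ (r, s) else 0) else 0)"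
  proof (intro sum.cong refl)
    fix u v assume "v \<in> {..<p}" "u \<in> {..<p}"
    then show "shuffle t $$ (r, u) * merged2 t X $$ (u, v) * unshuffle t $$ (v, s) =
        (if u = x then (if v = y then X $$ (r, s) else 0) else 0)"
      using rs xy \<rho>_eq_iff[of x u] \<rho>_eq_iff[of y v] weight_neq_0[OF t]
      by (auto simp: shuffle_def unshuffle_def merged2_def)
  qed
  also have "\<dots> = X $$ (r, s)" using xy by (simp add: sum.delta)
  finally show "(shuffle t * merged2 t X * unshuffle t) $$ (r, s) = X $$ (r, s)" .
qed (use X shuffle_carrier[of t] in auto)

lemma shuffle_inverse:
  assumes t: "t \<noteq> 0"
  shows "shuffle t * unshuffle t = 1\<^sub>m p" "unshuffle t * shuffle t = 1\<^sub>m p"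
proof -
  show "shuffle t * unshuffle t = 1\<^sub>m p"
  proof (rule eq_matI)
    fix r s assume "r < dim_row (1\<^sub>m p :: cmat)" "s < dim_col (1\<^sub>m p :: cmat)"
    then have rs: "r < p" "s < p" by auto
    obtain x where x: "x < p" "r = \<rho> x" using \<rho>_surj rs by blast
    have "(shuffle t * unshuffle t) $$ (r, s) = (\<Sum>v<p. shuffle t $$ (r, v) * unshuffle t $$ (v, s))"
      using rs by (intro mat_mult_entry shuffle_carrier)
    also have "\<dots> = (\<Sum>v<p. if v = x then (if r = s then 1 else 0) else 0)"
      using rs x \<rho>_eq_iff weight_neq_0[OF t] by (intro sum.cong refl) (auto simp: shuffle_def unshuffle_def)
    finally show "(shuffle t * unshuffle t) $$ (r, s) = 1\<^sub>m p $$ (r, s)" using x rs by simp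
  qed (use shuffle_carrier[of t] in auto)
  show "unshuffle t * shuffle t = 1\<^sub>m p"
  proof (rule eq_matI)
    fix r s assume "r < dim_row (1\<^sub>m p :: cmat)" "s < dim_col (1\<^sub>m p :: cmat)"
    then have rs: "r < p" "s < p" by auto
    have "(unshuffle t * shuffle t) $$ (r, s) = (\<Sum>v<p. unshuffle t $$ (r, v) * shuffle t $$ (v, s))"
      using rs by (intro mat_mult_entry shuffle_carrier)
    also have "\<dots> = (\<Sum>v<p. if v = \<rho> r then (if r = s then 1 else 0) else 0)"
      using rs \<rho>_eq_iff weight_neq_0[OF t] by (intro sum.cong refl) (auto simp: shuffle_def unshuffle_def)
    finally show "(unshuffle t * shuffle t) $$ (r, s) = 1\<^sub>m p $$ (r, s)" using \<rho>_less rs by simp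
  qed (use shuffle_carrier[of t] in auto)
qed

end

section \<open>The limit t -> 0 along an affine line\<close>

lemma poly_function_on_curve:
  fixes F :: "complex \<Rightarrow> cmat list \<times> cmat list"
  assumes "f \<in> poly_functions p n"
    and "\<And>i r s. i < n \<Longrightarrow> r < p \<Longrightarrow> s < p \<Longrightarrow> \<exists>q. \<forall>t. (fst (F t) ! i) $$ (r, s) = poly q t"
    and "\<And>i r s. i < n \<Longrightarrow> r < p \<Longrightarrow> s < p \<Longrightarrow> \<exists>q. \<forall>t. (snd (F t) ! i) $$ (r, s) = poly q t"
  shows "\<exists>q. \<forall>t. f (F t) = poly q t"
  using assms(1)
proof induction
  case (const c)
  show ?case by (rule exI[of _ "[:c:]"]) simp
next
  case (add f g)
  then obtain q q' where "\<forall>t. f (F t) = poly q t" "\<forall>t. g (F t) = poly q' t" by (elim exE)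
  then show ?case by (intro exI[of _ "q + q'"]) simp
next
  case (mult f g)
  then obtain q q' where "\<forall>t. f (F t) = poly q t" "\<forall>t. g (F t) = poly q' t" by (elim exE)
  then show ?case by (intro exI[of _ "q * q'"]) simp
qed (use assms(2,3) in auto)

lemma poly_zero_of_nonzero_arguments:
  fixes q :: "complex poly"
  assumes "\<And>t. t \<noteq> 0 \<Longrightarrow> poly q t = 0"
  shows "poly q 0 = 0"
proof -
  have "infinite (UNIV - {0 :: complex})" using infinite_UNIV_char_0 by (rule Diff_infinite_finite[rotated]) simp
  moreover have "UNIV - {0} \<subseteq> {t. poly q t = 0}" using assms by auto
  ultimately have "infinite {t. poly q t = 0}" using finite_subset by blast
  then have "q = 0" using poly_roots_finite by blast
  then show ?thesis by simp
qed

definition affine_line :: "cmat list \<Rightarrow> (nat \<Rightarrow> cmat) \<Rightarrow> complex \<Rightarrow> cmat list" where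
  "affine_line A Z t = map (\<lambda>m. A ! m + t \<cdot>\<^sub>m Z m) [0..<length A]"

lemma affine_line_0:
  assumes "set A \<subseteq> carrier_mat p p" "\<And>m. m < length A \<Longrightarrow> Z m \<in> carrier_mat p p"
  shows "affine_line A Z 0 = A"
proof (rule nth_equalityI)
  fix m assume "m < length (affine_line A Z 0)"
  then have m: "m < length A" by (simp add: affine_line_def)
  then have "A ! m \<in> carrier_mat p p" using assms(1) by (meson nth_mem subsetD)
  then show "affine_line A Z 0 ! m = A ! m"
    using m assms(2)[OF m] by (intro eq_matI) (auto simp: affine_line_def)
qed (simp add: affine_line_def)

lemma conj_affine_line_entry:
  assumes g: "g \<in> GL p" and A: "set A \<subseteq> carrier_mat p p" and Z: "\<And>m. m < length A \<Longrightarrow> Z m \<in> carrier_mat p p"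
    and i: "i < length A" and rs: "r < p" "s < p"
  shows "\<exists>q. \<forall>t. (conj_tuple g (affine_line A Z t) ! i) $$ (r, s) = poly q t"
proof -
  let ?h = "the (mat_inverse g)"
  have gc: "g \<in> carrier_mat p p" using g by (simp add: GL_iff)
  note h = GL_inverse(1)[OF g]
  have Ai: "A ! i \<in> carrier_mat p p" using A i by (meson nth_mem subsetD)
  have "(conj_tuple g (affine_line A Z t) ! i) $$ (r, s) =
      (g * A ! i * ?h) $$ (r, s) + t * (g * Z i * ?h) $$ (r, s)" for t
  proof -
    have "conj_tuple g (affine_line A Z t) ! i = g * (A ! i + t \<cdot>\<^sub>m Z i) * ?h"
      using i by (simp add: conj_tuple_def affine_line_def)
    also have "\<dots> $$ (r, s) = (\<Sum>v<p. \<Sum>u<p. g $$ (r, u) * (A ! i + t \<cdot>\<^sub>m Z i) $$ (u, v) * ?h $$ (v, s))"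
      using Ai Z[OF i] by (intro triple_entry gc h rs) auto
    also have "\<dots> = (\<Sum>v<p. \<Sum>u<p. g $$ (r, u) * (A ! i) $$ (u, v) * ?h $$ (v, s) +
        t * (g $$ (r, u) * Z i $$ (u, v) * ?h $$ (v, s)))"
      using Ai Z[OF i] by (intro sum.cong refl) (simp add: algebra_simps)
    also have "\<dots> = (g * A ! i * ?h) $$ (r, s) + t * (g * Z i * ?h) $$ (r, s)"
      unfolding triple_entry[OF gc Ai h rs] triple_entry[OF gc Z[OF i] h rs]
      by (simp add: sum.distrib sum_distrib_left)
    finally show ?thesis .
  qed
  then show ?thesis
    by (intro exI[of _ "[:(g * A ! i * ?h) $$ (r, s), (g * Z i * ?h) $$ (r, s):]"]) simp
qed

text \<open>The curve \<open>F\<close> uses the fixed matrices \<open>g\<close> and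
  \<open>h\<close>, so its entries are affine in t and a polynomial restricted to it is a polynomial
  in t. If that vanishes for all nonzero t, it vanishes at t = 0, where the curve passes through the
  given point.\<close>

lemma (in reversed_blocks) orbit_subset_closure_merged:
  "G2_orbit p (C_pairs p n \<pi> \<sigma>) \<subseteq> zariski_closure p n (G2_orbit p (C_pairs p n \<pi>m \<sigma>m))"
proof
  fix x assume x: "x \<in> G2_orbit p (C_pairs p n \<pi> \<sigma>)"
  then obtain g h A A' where g: "g \<in> GL p" and h: "h \<in> GL p" and AA: "(A, A') \<in> C_pairs p n \<pi> \<sigma>"
    and xeq: "x = (conj_tuple g A, conj_tuple h A')"
    by (auto simp: G2_orbit_def)
  have len: "length A = n" "length A' = n" and m: "\<And>m. m < n \<Longrightarrow> matched \<pi> \<sigma> (A ! m) (A' ! m)"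
    using AA C_pairs_iff[OF \<sigma> p] by auto
  have car: "set A \<subseteq> carrier_mat p p" "set A' \<subseteq> carrier_mat p p"
    using matchedD(1,2)[OF m] len p by (auto simp: in_set_conv_nth)
  define Z where "Z m = tangent1 (A' ! m)" for m
  define Z' where "Z' m = tangent2 (A ! m)" for m
  have Zc: "Z m \<in> carrier_mat p p" "Z' m \<in> carrier_mat p p" for m
    by (simp_all add: Z_def Z'_def tangent1_def tangent2_def)
  define F where "F t = (conj_tuple g (affine_line A Z t), conj_tuple h (affine_line A' Z' t))" for t
  have F: "F t \<in> G2_orbit p (C_pairs p n \<pi>m \<sigma>m)" if t: "t \<noteq> 0" for t
  proof -
    \<comment> \<open>The conjugation depending on t is hidden here: the second tuple of the line is
      \<open>shuffle t\<close> applied to \<open>D\<close>, so that \<open>h * shuffle t\<close>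
      conjugates a member of the merged set.\<close>
    define D where "D = map (\<lambda>m. merged2 t (A' ! m + t \<cdot>\<^sub>m Z' m)) [0..<n]"
    have "(affine_line A Z t, D) \<in> C_pairs p n \<pi>m \<sigma>m"
      unfolding C_pairs_iff[OF merge_perm_permutes sum_merged]
      using matched_merged[OF m t] len by (simp add: D_def affine_line_def Z_def Z'_def)
    moreover have sG: "shuffle t \<in> GL p"
      using shuffle_carrier shuffle_inverse[OF t] by (auto simp: GL_iff)
    have si: "the (mat_inverse (shuffle t)) = unshuffle t"
      by (rule mat_inverse_unique[OF shuffle_carrier shuffle_inverse[OF t]])
    have "affine_line A' Z' t = conj_tuple (shuffle t) D"
    proof (rule nth_equalityI)
      fix i assume "i < length (affine_line A' Z' t)"
      then have i: "i < n" using len by (simp add: affine_line_def)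
      have "A' ! i + t \<cdot>\<^sub>m Z' i \<in> carrier_mat p p" using Zc(2) by simp
      then show "affine_line A' Z' t ! i = conj_tuple (shuffle t) D ! i"
        using i len shuffle_conj[OF t] by (simp add: affine_line_def conj_tuple_def D_def si)
    qed (simp add: affine_line_def conj_tuple_def D_def len)
    moreover have "set D \<subseteq> carrier_mat p p" by (auto simp: D_def merged2_def)
    ultimately have "F t = (conj_tuple g (affine_line A Z t), conj_tuple (h * shuffle t) D)"
      unfolding F_def using conj_tuple_mult[OF h sG] by simp
    then show ?thesis
      unfolding G2_orbit_def using g GL_mult[OF h sG] \<open>(affine_line A Z t, D) \<in> _\<close> by (intro CollectI) metis
  qed
  have F0: "F 0 = x" unfolding F_def xeq using affine_line_0[OF car(1) Zc(1)] affine_line_0[OF car(2) Zc(2)] by simp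
  show "x \<in> zariski_closure p n (G2_orbit p (C_pairs p n \<pi>m \<sigma>m))"
    unfolding zariski_closure_iff[OF G2_orbit_C_pairs_subset]
  proof (intro conjI ballI impI)
    show "x \<in> mat_tuples p n \<times> mat_tuples p n" using x G2_orbit_C_pairs_subset by blast
    fix f assume f: "f \<in> poly_functions p n" "\<forall>s\<in>G2_orbit p (C_pairs p n \<pi>m \<sigma>m). f s = 0"
    have "\<exists>q. \<forall>t. f (F t) = poly q t"
    proof (rule poly_function_on_curve[OF f(1)])
      fix i r s assume "i < n" "r < p" "s < p"
      then show "\<exists>q. \<forall>t. (fst (F t) ! i) $$ (r, s) = poly q t" "\<exists>q. \<forall>t. (snd (F t) ! i) $$ (r, s) = poly q t"
        using conj_affine_line_entry[OF g car(1) Zc(1), of i r s] conj_affine_line_entry[OF h car(2) Zc(2), of i r s] len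
        by (simp_all add: F_def)
    qed
    then obtain q where q: "\<forall>t. f (F t) = poly q t" by (elim exE)
    have "poly q t = 0" if "t \<noteq> 0" for t using f(2) F[OF that] q by metis
    then have "poly q 0 = 0" by (rule poly_zero_of_nonzero_arguments)
    then show "f x = 0" using q F0 by metis
  qed
qed

theorem proposition4p1:
  fixes p n :: nat and \<pi> :: "nat list" and \<sigma> :: "nat \<Rightarrow> nat"
  assumes "p \<ge> 2" and "n \<ge> 3" and "(\<pi>, \<sigma>) \<in> P_set p"
  shows "P_maximal p n (\<pi>, \<sigma>) \<longleftrightarrow> \<not> partial_reversal (length \<pi>) \<sigma>"
proof -
  have \<pi>: "\<pi> \<in> compositions p (length \<pi>)" "length \<pi> \<le> p" and \<sigma>: "\<sigma> permutes {..<length \<pi>}"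
    using assms(3) by (auto simp: P_set_def compositions_def)
  have "\<not> partial_reversal (length \<pi>) \<sigma>" if max: "P_maximal p n (\<pi>, \<sigma>)"
  proof
    assume "partial_reversal (length \<pi>) \<sigma>"
    then obtain l where l: "Suc l < length \<pi>" "\<sigma> l = Suc (\<sigma> (Suc l))" by (auto simp: partial_reversal_def)
    interpret reversed_blocks \<pi> \<sigma> l p
      using \<sigma> l \<pi>(1) by unfold_locales (auto simp: compositions_def)
    let ?\<pi> = "merge_at (\<sigma> (Suc l)) \<pi>" and ?\<sigma> = "merge_perm (length \<pi>) l \<sigma>"
    have len: "length ?\<pi> = length \<pi> - 1" by (rule length_merge_at[OF merge_bounds(1)])
    have "\<forall>q\<in>set ?\<pi>. 0 < q"
      using \<pi>(1) merge_bounds(1) by (auto simp: compositions_def merge_at_def dest!: in_set_takeD in_set_dropD)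
    then have "?\<pi> \<in> compositions p (length ?\<pi>)" using sum_merged by (simp add: compositions_def)
    moreover have "length ?\<pi> \<in> {1..p}" using len l \<pi>(2) by auto
    ultimately have "(?\<pi>, ?\<sigma>) \<in> P_set p" using merge_perm_permutes unfolding P_set_def by blast
    moreover have "P_le p n (\<pi>, \<sigma>) (?\<pi>, ?\<sigma>)"
      using orbit_subset_closure_merged by (simp add: P_le_def zariski_closure_le_iff)
    ultimately have "(\<pi>, \<sigma>) = (?\<pi>, ?\<sigma>)" using max unfolding P_maximal_def by blast
    \<comment> \<open>Merging shortens the composition by one, so the larger element is a different
      one.\<close>
    then have "length \<pi> = length ?\<pi>" by simp
    then show False using len l by simp
  qed
  moreover have "P_maximal p n (\<pi>, \<sigma>)" if npr: "\<not> partial_reversal (length \<pi>) \<sigma>"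
  proof -
    have "(\<pi>, \<sigma>) = y" if y: "y \<in> P_set p" "P_le p n (\<pi>, \<sigma>) y" for y
    proof -
      obtain \<pi>' \<sigma>' where y': "y = (\<pi>', \<sigma>')" by (cases y)
      have *: "\<pi>' \<in> compositions p (length \<pi>')" "length \<pi>' \<le> p" "\<sigma>' permutes {..<length \<pi>'}"
        using y(1) by (auto simp: y' P_set_def compositions_def)
      have "G2_orbit p (C_pairs p n \<pi> \<sigma>) \<subseteq> zariski_closure p n (G2_orbit p (C_pairs p n \<pi>' \<sigma>'))"
        using y(2) by (simp add: y' P_le_def zariski_closure_le_iff)
      then have "C_pairs p n \<pi> \<sigma> \<subseteq> zariski_closure p n (G2_orbit p (C_pairs p n \<pi>' \<sigma>'))"
        using C_pairs_subset_orbit by blast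
      then have "\<pi> = \<pi>' \<and> \<sigma> = \<sigma>'"
        using assms(1) by (intro not_in_closure_of_larger[OF \<pi>(1) *(1) \<sigma> *(3) _ *(2) assms(2) npr]) simp_all
      then show ?thesis by (simp add: y')
    qed
    then show ?thesis using assms(3) unfolding P_maximal_def by blast
  qed
  ultimately show ?thesis by blast
qed

end
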